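(* Let $q\in(-1,1]$, $\mathbf m\in\mathbb R^d$, $\boldsymbol\rho\in((-1,1)\setminus\{0\})^{d-1}$ and $(X_1,\dots,X_d)\sim N_d(\mathbf m,\mathbf 1,\boldsymbol\rho|q)$. Below, "$\sim$" followed by a function of $x_i$ means that the (conditional) distribution of $X_i$ has that density. (i) For all $n\in\mathbb N$ and $1\le j_1<j_2<\dots<j_m<i\le d$, $$X_i\,|\,X_{j_m},\dots,X_{j_1}\ \sim\ f_{CN}\Big(x_i\,\Big|\,x_{j_m},\prod_{k=j_m}^{i-1}\rho_k,q\Big).$$ Thus in particular $$\mathbb E\big(H_n(X_i-m_i|q)\,\big|\,X_{j_1},\dots,X_{j_m}\big)=\Big(\prod_{k=j_m}^{i-1}\rho_k\Big)^n H_n(X_{j_m}-m_{j_m}|q)$$ and $\operatorname{var}(X_i|X_{j_1},\dots,X_{j_m})=1-\Big(\prod_{k=j_m}^{i-1}\rho_k\Big)^2$. (ii) For all $1\le j_1<\dots<j_k<i<j_m<\dots<j_h\le d$ ($j_k$ is the largest selected index below $i$, $j_m$ the smallest selected index above $i$), $$X_i\,|\,X_{j_1},\dots,X_{j_k},X_{j_m},\dots,X_{j_h}\ \sim\ f_N(x_i|q)\prod_{l=0}^\infty\frac{h_l(x_{j_k},x_{j_m},\rho_k^*\rho_m^*,q)}{h_l(x_i,x_{j_k},\rho_k^*,q)\,h_l(x_i,x_{j_m},\rho_m^*,q)},$$ where $h_l(x,y,\rho,q)=(1-\rho^2q^{2l})^2-(1-q)\rho q^l(1+\rho^2q^{2l})xy+(1-q)\rho^2q^{2l}(x^2+y^2)$,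 $\rho_k^*=\prod_{s=j_k}^{i-1}\rho_s$, $\rho_m^*=\prod_{s=i}^{j_m-1}\rho_s$. Thus in particular this density depends only on $X_{j_k}$ and $X_{j_m}$.
   Context: Convention $0^0=1$. $[n]_q=1+q+\dots+q^{n-1}$, $[0]_q=0$. $S(q)=[-2/\sqrt{1-q},\,2/\sqrt{1-q}]$ for $|q|<1$, $S(1)=\mathbb R$. $q$-Hermite polynomials: $H_{-1}(x|q)=0$, $H_0(x|q)=1$, $H_{n+1}(x|q)=xH_n(x|q)-[n]_qH_{n-1}(x|q)$ for $n\ge 0$. For $|q|<1$ and $x\in S(q)$, $$f_N(x|q)=\frac{\sqrt{1-q}}{2\pi\sqrt{4-(1-q)x^2}}\prod_{k=0}^\infty\big((1+q^k)^2-(1-q)x^2q^k\big)\prod_{k=0}^\infty(1-q^{k+1}),$$ and for $|\rho|<1$, $x,y\in S(q)$, $$f_{CN}(x|y,\rho,q)=f_N(x|q)\prod_{k=0}^\infty\frac{1-\rho^2q^k}{(1-\rho^2q^{2k})^2-(1-q)\rho q^k(1+\rho^2q^{2k})xy+(1-q)\rho^2(x^2+y^2)q^{2k}};$$ both are $0$ for $x\notin S(q)$ (and at the endpoints). For $q=1$: $f_N(x|1)=\frac1{\sqrt{2\pi}}e^{-x^2/2}$, $f_{CN}(x|y,\rho,1)=\frac1{\sqrt{2\pi(1-\rho^2)}}\exp\!\big(-\frac{(x-\rho y)^2}{2(1-\rho^2)}\big)$. $N_d(\mathbf m,\mathbf 1,\boldsymbol\rho|q)$ is the distribution on $\mathbb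 R^d$ with density $f_N(x_1-m_1|q)\prod_{i=1}^{d-1}f_{CN}(x_{i+1}-m_{i+1}|x_i-m_i,\rho_i,q)$ where all $x_i-m_i\in S(q)$ (zero elsewhere).
   Formalization: Densities in (i),(ii) are taken at the centred variables x_i-m_i. In (ii) the printed density is multiplied by the missing constant prod_l (1-a^2q^l)(1-b^2q^l)/(1-a^2b^2q^l), a=rho_k^*, b=rho_m^*; for q=1, where the product diverges, the Gaussian bridge density is used. *)

theory Defs
  imports "HOL-Probability.Probability"
begin

definition q_int :: "real \<Rightarrow> nat \<Rightarrow> real" where
  "q_int q n = (\<Sum>k<n. q ^ k)"

definition q_supp :: "real \<Rightarrow> real set" where
  "q_supp q = (if q = 1 then UNIV else {- 2 / sqrt (1 - q) .. 2 / sqrt (1 - q)})"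

(* The second equation is the recurrence at n = 0 with the convention H_{-1} = 0. *)
fun q_hermite :: "nat \<Rightarrow> real \<Rightarrow> real \<Rightarrow> real" where
  "q_hermite 0 x q = 1"
| "q_hermite (Suc 0) x q = x"
| "q_hermite (Suc (Suc n)) x q =
     x * q_hermite (Suc n) x q - q_int q (Suc n) * q_hermite n x q"

(* For \<bar>q\<bar> < 1 the value at the two end points of the support is 0, because sqrt 0 = 0
   and r / 0 = 0. *)
definition q_normal :: "real \<Rightarrow> real \<Rightarrow> real" where
  "q_normal x q =
     (if q = 1 then std_normal_density x
      else if x \<in> q_supp q then
        sqrt (1 - q) / (2 * pi * sqrt (4 - (1 - q) * x\<^sup>2))
        * (\<Prod>k. (1 + q ^ k)\<^sup>2 - (1 - q) * x\<^sup>2 * q ^ k)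
        * (\<Prod>k. 1 - q ^ (k + 1))
      else 0)"

definition h_factor :: "nat \<Rightarrow> real \<Rightarrow> real \<Rightarrow> real \<Rightarrow> real \<Rightarrow> real" where
  "h_factor l x y \<rho> q =
     (1 - \<rho>\<^sup>2 * q ^ (2 * l))\<^sup>2
     - (1 - q) * \<rho> * q ^ l * (1 + \<rho>\<^sup>2 * q ^ (2 * l)) * x * y
     + (1 - q) * \<rho>\<^sup>2 * q ^ (2 * l) * (x\<^sup>2 + y\<^sup>2)"

(* Density in x; y is the conditioning value. For \<bar>q\<bar> < 1 it is only meaningful for
   y in the support; it vanishes for x outside the interior of the support because
   q_normal does. *)
definition q_cond_normal :: "real \<Rightarrow> real \<Rightarrow> real \<Rightarrow> real \<Rightarrow> real" where
  "q_cond_normal x y \<rho> q =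
     (if q = 1 then normal_density (\<rho> * y) (sqrt (1 - \<rho>\<^sup>2)) x
      else q_normal x q * (\<Prod>k. (1 - \<rho>\<^sup>2 * q ^ k) / h_factor k x y \<rho> q))"

(* Normalizing factor, independent of x, y, z, which makes
   q_normal x q * (\<Prod>l. h_factor l y z (a * b) q / (h_factor l x y a q * h_factor l x z b q))
   a probability density in x. It collects the numerators 1 - \<rho>\<^sup>2 * q ^ l of q_cond_normal in
   the quotient
   q_cond_normal x y a q * q_cond_normal z x b q / q_cond_normal z y (a * b) q. *)
definition q_bridge_const :: "real \<Rightarrow> real \<Rightarrow> real \<Rightarrow> real" where
  "q_bridge_const a b q =
     (\<Prod>l. (1 - a\<^sup>2 * q ^ l) * (1 - b\<^sup>2 * q ^ l) / (1 - a\<^sup>2 * b\<^sup>2 * q ^ l))"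

(* For q = 1 the infinite product diverges; the density is then its limit as q tends to 1
   from the left, the Gaussian density given by the quotient above. *)
definition q_bridge :: "real \<Rightarrow> real \<Rightarrow> real \<Rightarrow> real \<Rightarrow> real \<Rightarrow> real \<Rightarrow> real" where
  "q_bridge x y z a b q =
     (if q = 1 then
        normal_density
          ((a * (1 - b\<^sup>2) * y + b * (1 - a\<^sup>2) * z) / (1 - a\<^sup>2 * b\<^sup>2))
          (sqrt ((1 - a\<^sup>2) * (1 - b\<^sup>2) / (1 - a\<^sup>2 * b\<^sup>2))) x
      else
        q_bridge_const a b q
        * (q_normal x q
           * (\<Prod>l. h_factor l y z (a * b) q / (h_factor l x y a q * h_factor l x z b q))))"

(* A point of d-dimensional space is a function on the index set {1..d}. *)
definition q_normal_joint ::
    "nat \<Rightarrow> (nat \<Rightarrow> real) \<Rightarrow> (nat \<Rightarrow> real) \<Rightarrow> real \<Rightarrow> (nat \<Rightarrow> real) \<Rightarrow> real" where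
  "q_normal_joint d m \<rho> q x =
     (if \<forall>i\<in>{1..d}. x i - m i \<in> q_supp q then
        q_normal (x 1 - m 1) q
        * (\<Prod>i\<in>{1..<d}. q_cond_normal (x (Suc i) - m (Suc i)) (x i - m i) (\<rho> i) q)
      else 0)"

(* The sigma-algebra generated by the random variables X j, j in J. *)
definition sigma_gen_by :: "'a measure \<Rightarrow> (nat \<Rightarrow> 'a \<Rightarrow> real) \<Rightarrow> nat set \<Rightarrow> 'a measure" where
  "sigma_gen_by M X J =
     vimage_algebra (space M) (\<lambda>\<omega>. \<lambda>j\<in>J. X j \<omega>) (Pi\<^sub>M J (\<lambda>_. borel))"

(* The conditional distribution of Y given F has the (random) Lebesgue density f \<omega>. *)
definition cond_density ::
    "'a measure \<Rightarrow> 'a measure \<Rightarrow> ('a \<Rightarrow> real) \<Rightarrow> ('a \<Rightarrow> real \<Rightarrow> real) \<Rightarrow> bool" where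
  "cond_density M F Y f \<longleftrightarrow>
     subalgebra M F \<and>
     Y \<in> borel_measurable M \<and>
     (AE \<omega> in M. f \<omega> \<in> borel_measurable borel \<and> (\<forall>x. 0 \<le> f \<omega> x) \<and>
        (\<integral>\<^sup>+ x. ennreal (f \<omega> x) \<partial>lborel) = 1) \<and>
     (\<forall>B\<in>sets borel. AE \<omega> in M.
        real_cond_exp M F (indicator (Y -` B \<inter> space M)) \<omega> =
        measure (density lborel (\<lambda>x. ennreal (f \<omega> x))) B)"

definition cond_var :: "'a measure \<Rightarrow> 'a measure \<Rightarrow> ('a \<Rightarrow> real) \<Rightarrow> 'a \<Rightarrow> real" where
  "cond_var M F Y = real_cond_exp M F (\<lambda>\<omega>. (Y \<omega> - real_cond_exp M F Y \<omega>)\<^sup>2)"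

end

theory Submission
  imports Defs
begin

text \<open>
  For \<open>q < 1\<close> rescale to \<open>c = sqrt (1 - q) x \<in> [-2, 2]\<close>. Truncating the infinite product in \<open>f\<^sub>N\<close> gives
  polynomial multiples of the semicircle density, whose integrals against Chebyshev polynomials
  satisfy a recurrence with an explicit solution (a finite form of the Jacobi triple product);
  in the limit this yields orthogonality of the \<open>H\<^sub>n\<close> with respect to \<open>f\<^sub>N\<close>. The series
  \<open>\<Sum> \<rho>\<^sup>n H\<^sub>n(x) H\<^sub>n(y) / [n]\<^sub>q!\<close> and the product \<open>f\<^sub>C\<^sub>N(x|y,\<rho>,q) / f\<^sub>N(x|q)\<close> solve the same functional equation
  relating \<open>\<rho>\<close> and \<open>q \<rho>\<close>, so they agree (Poisson--Mehler), and integrating termwise gives both the moments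
  \<open>\<integral> H\<^sub>n f\<^sub>C\<^sub>N = \<rho>\<^sup>n H\<^sub>n\<close> and the Chapman--Kolmogorov equation for \<open>f\<^sub>C\<^sub>N\<close>. For \<open>q = 1\<close> the same two facts follow by
  completing the square and by Gaussian integration by parts.

  Hence the coordinates form a Markov chain with transition densities \<open>p\<close>, and any coordinate can be
  integrated out of the joint density. What remains of the joint density shows that \<open>X\<^sub>i\<close> given a set
  of earlier coordinates has density \<open>p\<^sub>j\<^sub>i\<close>, and given coordinates on both sides it has density
  \<open>p\<^sub>j\<^sub>i p\<^sub>i\<^sub>k / p\<^sub>j\<^sub>k\<close>, where \<open>j\<close> and \<open>k\<close> are the neighbours of \<open>i\<close>.
\<close>

section \<open>Continuous q-Hermite polynomials and their orthogonality\<close>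

text \<open>For \<open>\<bar>q\<bar> < 1\<close> the infinite products cannot be integrated
  directly. The only integrals computed in closed form are those of polynomials against the
  semicircle; everything else is a limit of these under a majorant uniform in the truncation, or a
  series summed term by term. The series has to converge for every correlation below 1 in absolute
  value, not just for small ones. This forces a polynomial bound on the growth of the rescaled
  polynomials on [-2, 2], where the obvious estimate of the three-term recurrence grows
  exponentially. The functional equation identifies series and product because iterating it replaces
  t by t q^N, which tends to 0, where both sides are 1. On the probabilistic side a conditional law
  is identified by integrating arbitrary nonnegative functions of the conditioning vector and the
  variable. The kernels are set to 0 off the support, so that the Chapman-Kolmogorov equation holds
  at all real points; the two-sided density is a quotient whose denominator is nonzero only almost
  surely.\<close>

text \<open>\<open>qh q n (sqrt (1 - q) x) = (1 - q)\<^bsup>n/2\<^esup> H\<^sub>n(x|q)\<close>; in particular \<open>qh 0 n\<close> is the Chebyshev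
  polynomial \<open>U\<^sub>n(c/2)\<close>.\<close>

fun qh :: "real \<Rightarrow> nat \<Rightarrow> real \<Rightarrow> real" where
  "qh q 0 c = 1"
| "qh q (Suc 0) c = c"
| "qh q (Suc (Suc n)) c = c * qh q (Suc n) c - (1 - q ^ Suc n) * qh q n c"

definition qpoch :: "real \<Rightarrow> nat \<Rightarrow> real" where
  "qpoch q n = (\<Prod>k<n. 1 - q ^ Suc k)"

lemma qpoch_0 [simp]: "qpoch q 0 = 1"
  by (simp add: qpoch_def)

lemma qpoch_Suc: "qpoch q (Suc n) = qpoch q n * (1 - q ^ Suc n)"
  by (simp add: qpoch_def)

lemma qh_rec: "c * qh q (Suc n) c = qh q (Suc (Suc n)) c + (1 - q ^ Suc n) * qh q n c"
  by simp

declare qh.simps(3) [simp del]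

lemma continuous_qh [continuous_intros]: "continuous_on A (\<lambda>c. qh q n c)"
  by (induction n rule: induct_nat_012) (auto simp: qh.simps(3) intro!: continuous_on_diff continuous_on_mult continuous_on_const continuous_on_id)

lemma measurable_qh [measurable]: "qh q n \<in> borel_measurable borel"
  by (intro borel_measurable_continuous_onI continuous_qh)

section \<open>Chebyshev polynomials and the semicircle law\<close>

lemma qh_chebyshev: "qh 0 n (2 * cos t) * sin t = sin (real (Suc n) * t)"
proof (induction n rule: induct_nat_012)
  case 1
  then show ?case by (simp add: sin_double)
next
  case (ge2 n)
  have "qh 0 (Suc (Suc n)) (2 * cos t) * sin t =
      2 * cos t * (qh 0 (Suc n) (2 * cos t) * sin t) - qh 0 n (2 * cos t) * sin t"
    by (simp add: qh.simps algebra_simps)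
  also have "\<dots> = 2 * cos t * sin (real (Suc (Suc n)) * t) - sin (real (Suc n) * t)"
    using ge2 by simp
  also have "\<dots> = sin (real (Suc (Suc (Suc n))) * t)"
    using sin_add[of "real (Suc (Suc n)) * t" t] sin_diff[of "real (Suc (Suc n)) * t" t]
    by (simp add: algebra_simps)
  finally show ?case .
qed simp

definition semicircle :: "real \<Rightarrow> real" where
  "semicircle c = indicator {-2..2} c * (sqrt (4 - c\<^sup>2) / (2 * pi))"

lemma semicircle_measurable [measurable]: "semicircle \<in> borel_measurable borel"
  unfolding semicircle_def by measurable

lemma semicircle_qh_has_integral:
  "((\<lambda>c. sqrt (4 - c\<^sup>2) * qh 0 n c) has_integral (if n = 0 then 2 * pi else 0)) {-2..2}"
proof -
  \<comment> \<open>With \<open>c = 2 cos t\<close> the integrand is 2 sin ((n+1) t) and dc = -2 sin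
    t dt, which gives 2 (cos ((n+2) t) - cos (n t)) dt. \<open>F\<close> is the antiderivative read
    back through \<open>t = arccos (c/2)\<close>; for \<open>n = 0\<close> the term sin (n t) / n
    becomes t.\<close>
  define F where "F = (\<lambda>c. (if n = 0 then -2 * arccos (c/2) else -2 * (sin (real n * arccos (c/2)) / real n))
       + 2 * (sin (real (Suc (Suc n)) * arccos (c/2)) / real (Suc (Suc n))))"
  have der: "(F has_real_derivative sqrt (4 - c\<^sup>2) * qh 0 n c) (at c)" if "-2 < c" "c < 2" for c
  proof -
    define t where "t = arccos (c/2)"
    have ct: "c = 2 * cos t" unfolding t_def using that by simp
    have t: "0 < t" "t < pi" unfolding t_def using that arccos_lt_bounded[of "c/2"] by auto
    have st: "sin t > 0" using t by (simp add: sin_gt_zero)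
    have s4: "sqrt (4 - c\<^sup>2) = 2 * sin t"
    proof -
      have "4 - c\<^sup>2 = (2 * sin t)\<^sup>2"
        by (simp add: ct power_mult_distrib sin_squared_eq)
      then show ?thesis using st by (simp only: real_sqrt_abs)
    qed
    have sq: "sqrt (1 - (c/2)\<^sup>2) = sin t"
      using st unfolding ct by (simp add: sin_squared_eq[symmetric])
    have dt: "((\<lambda>c. arccos (c/2)) has_real_derivative - (1 / (2 * sin t))) (at c)"
    proof -
      have "((\<lambda>c. arccos (c/2)) has_real_derivative inverse (- sqrt (1 - (c/2)\<^sup>2)) * (1/2)) (at c)"
        using that by (intro DERIV_chain2[OF DERIV_arccos]) (auto intro!: derivative_eq_intros)
      then show ?thesis unfolding sq by (simp add: field_simps)
    qed
    have c1: "2 * (cos (real (Suc (Suc n)) * t) - cos (real n * t)) = - 4 * (sin (real (Suc n) * t) * sin t)"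
      using cos_add[of "real (Suc n) * t" t] cos_diff[of "real (Suc n) * t" t] by (simp add: algebra_simps)
    have ds: "((\<lambda>c. sin (real k * arccos (c/2)) / real k) has_real_derivative cos (real k * t) * (- (1 / (2 * sin t)))) (at c)"
      if "k > 0" for k
    proof -
      have "((\<lambda>c. sin (real k * arccos (c/2)) / real k) has_real_derivative
          cos (real k * arccos (c/2)) * (real k * (- (1 / (2 * sin t)))) / real k) (at c)"
        by (intro DERIV_cdivide DERIV_chain2[OF DERIV_sin] DERIV_cmult dt)
      then show ?thesis using that unfolding t_def[symmetric] by simp
    qed
    have first: "((\<lambda>c. if n = 0 then -2 * arccos (c/2) else -2 * (sin (real n * arccos (c/2)) / real n)) has_real_derivative
         -2 * (cos (real n * t) * (- (1 / (2 * sin t))))) (at c)"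
    proof (cases "n = 0")
      case True
      then show ?thesis using DERIV_cmult[OF dt, of "-2"] by simp
    next
      case False
      then show ?thesis using DERIV_cmult[OF ds[of n], of "-2"] by simp
    qed
    have "(F has_real_derivative -2 * (cos (real n * t) * (- (1 / (2 * sin t))))
           + 2 * (cos (real (Suc (Suc n)) * t) * (- (1 / (2 * sin t))))) (at c)"
      unfolding F_def using DERIV_add[OF first DERIV_cmult[OF ds[of "Suc (Suc n)"], of 2]] by simp
    also have "-2 * (cos (real n * t) * (- (1 / (2 * sin t)))) + 2 * (cos (real (Suc (Suc n)) * t) * (- (1 / (2 * sin t))))
        = 2 * (cos (real (Suc (Suc n)) * t) - cos (real n * t)) * (- (1 / (2 * sin t)))"
      by (simp add: algebra_simps)
    also have "\<dots> = 2 * sin (real (Suc n) * t)"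
      unfolding c1 using st by simp
    also have "\<dots> = sqrt (4 - c\<^sup>2) * qh 0 n c"
      unfolding s4 using qh_chebyshev[of n t] by (simp add: ct algebra_simps)
    finally show ?thesis .
  qed
  \<comment> \<open>At the end points arccos is only continuous, hence the interior form of the
    fundamental theorem.\<close>
  have "((\<lambda>c. sqrt (4 - c\<^sup>2) * qh 0 n c) has_integral (F 2 - F (-2))) {-2..2}"
  proof (rule fundamental_theorem_of_calculus_interior)
    show "continuous_on {- 2..2} F"
      unfolding F_def by (cases "n = 0") (auto intro!: continuous_intros)
    show "(F has_vector_derivative sqrt (4 - x\<^sup>2) * qh 0 n x) (at x)" if "x \<in> {-2<..<2}" for x
      using der[of x] that by (simp add: has_real_derivative_iff_has_vector_derivative)
  qed simp
  moreover have "F 2 - F (-2) = (if n = 0 then 2 * pi else 0)"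
    unfolding F_def by (simp add: sin_npi del: of_nat_Suc)
  ultimately show ?thesis by simp
qed

lemma has_bochner_integral_semicircle_qh:
  "has_bochner_integral lborel (\<lambda>c. semicircle c * qh 0 n c) (if n = 0 then 1 else 0)"
proof -
  have "set_integrable lborel {-2..2} (\<lambda>c::real. sqrt (4 - c\<^sup>2) * qh 0 n c)"
    by (intro borel_integrable_atLeastAtMost' continuous_intros)
  from set_borel_integral_eq_integral(2)[OF this] this
  have "has_bochner_integral lborel (\<lambda>c. indicator {-2..2} c *\<^sub>R (sqrt (4 - c\<^sup>2) * qh 0 n c)) (if n = 0 then 2 * pi else 0)"
    using integral_unique[OF semicircle_qh_has_integral[of n]]
    by (simp add: has_bochner_integral_iff set_lebesgue_integral_def set_integrable_def)
  from has_bochner_integral_mult_left[OF this, of "1 / (2 * pi)"]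
  show ?thesis by (simp add: semicircle_def algebra_simps split: if_splits)
qed

lemma convergent_prod_near_one:
  fixes f :: "nat \<Rightarrow> real"
  assumes "\<And>n. \<bar>f n - 1\<bar> \<le> g n" "summable g"
  shows "convergent_prod f"
proof -
  have "summable (\<lambda>n. norm (f n - 1))"
    by (rule summable_comparison_test'[OF assms(2), of 0]) (use assms(1) in auto)
  then show ?thesis
    by (intro abs_convergent_prod_imp_convergent_prod summable_imp_abs_convergent_prod)
qed

lemma convergent_prod_LIMSEQ_lessThan:
  fixes f :: "nat \<Rightarrow> real"
  assumes "convergent_prod f"
  shows "(\<lambda>n. \<Prod>k<n. f k) \<longlonglongrightarrow> prodinf f"
  using convergent_prod_LIMSEQ[OF assms]
  by (subst (asm) lessThan_Suc_atMost[symmetric]) (rule LIMSEQ_imp_Suc)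

lemma integrable_semicircle:
  assumes "continuous_on UNIV g"
  shows "integrable lborel (\<lambda>c. semicircle c * g c)"
proof -
  have "set_integrable lborel {-2..2} (\<lambda>c::real. sqrt (4 - c\<^sup>2) / (2 * pi) * g c)"
    by (intro borel_integrable_atLeastAtMost' continuous_intros)
       (auto intro: continuous_on_subset[OF assms])
  then show ?thesis
    by (simp add: set_integrable_def semicircle_def algebra_simps)
qed

lemma semicircle_outside: "\<not> \<bar>c\<bar> \<le> 2 \<Longrightarrow> semicircle c = 0"
  by (auto simp: semicircle_def indicator_def)

lemma qh_0_rec: "c * qh 0 (Suc n) c = qh 0 (Suc (Suc n)) c + qh 0 n c"
  using qh_rec[of c 0 n] by simp

text \<open>With \<open>c = 2 cos t\<close> the factor \<open>c\<^sup>2 - 2\<close> is 2 cos 2t, so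
  it shifts the Chebyshev index by two in both directions. The factors of the truncated weights are
  affine in \<open>c\<^sup>2 - 2\<close>, and each new factor thus becomes a recurrence for the
  moments.\<close>

lemma qh_0_rec2:
  "(c\<^sup>2 - 2) * qh 0 (Suc (Suc n)) c = qh 0 (Suc (Suc (Suc (Suc n)))) c + qh 0 n c"
proof -
  have "c\<^sup>2 * qh 0 (Suc (Suc n)) c = c * (c * qh 0 (Suc (Suc n)) c)"
    by (simp add: power2_eq_square)
  also have "\<dots> = c * qh 0 (Suc (Suc (Suc n))) c + c * qh 0 (Suc n) c"
    by (subst qh_0_rec) (simp add: algebra_simps)
  also have "\<dots> = qh 0 (Suc (Suc (Suc (Suc n)))) c + 2 * qh 0 (Suc (Suc n)) c + qh 0 n c"
    by (subst qh_0_rec, subst qh_0_rec) simp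
  finally show ?thesis by (simp add: algebra_simps)
qed

text \<open>The generic induction step of \<open>partial_weight_moment_even\<close>, cleared of
  denominators. There \<open>A = q ^ i\<close>, \<open>B = q ^ N\<close> and
  \<open>n = Suc (i + N)\<close>, so \<open>p\<close> is \<open>q ^ Suc n\<close> and
  \<open>X\<close> is \<open>q ^ (n + i + 2)\<close>.\<close>

lemma partial_weight_moment_even_identity:
  fixes q A B :: real
  defines "p \<equiv> q * q * A * B" and "X \<equiv> q * q * q * A * A * B"
  shows "- (q * A) * ((1 - p\<^sup>2) * (1 - q * p\<^sup>2)) =
     - ((1 + p\<^sup>2) * (q * A) * (1 - q * B) * (1 - q * X))
     - p * ((q * A) * (q * q * A) * (1 - q * B) * (1 - B) + (1 - X) * (1 - q * X))"
  unfolding assms by algebra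

section \<open>The q-Hermite weight and its truncations\<close>

locale q_disc =
  fixes q :: real
  assumes abs_q: "\<bar>q\<bar> < 1"
begin

lemma summable_abs_pow: "summable (\<lambda>k. \<bar>q\<bar> ^ k)"
  using abs_q by (intro summable_geometric) simp

lemma pow_less_1: "q ^ Suc k < 1"
proof -
  have "\<bar>q\<bar> ^ Suc k < 1" using abs_q by (subst power_less_one_iff) auto
  then show ?thesis by (metis abs_ge_self order_le_less_trans power_abs)
qed

lemma qpoch_pos: "qpoch q n > 0"
  unfolding qpoch_def using pow_less_1 by (intro prod_pos) auto

lemma qpoch_nz [simp]: "qpoch q n \<noteq> 0"
  using qpoch_pos[of n] by simp

lemma pow_Suc_nz: "1 - q ^ Suc n \<noteq> 0"
  using pow_less_1[of n] by simp

definition qinf :: real where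
  "qinf = (\<Prod>k. 1 - q ^ (k + 1))"

lemma convergent_qinf: "convergent_prod (\<lambda>k. 1 - q ^ (k + 1))"
  by (rule convergent_prod_near_one[where g = "\<lambda>k. \<bar>q\<bar> ^ Suc k"])
     (use summable_abs_pow in \<open>auto simp: power_abs abs_mult summable_mult\<close>)

lemma qpoch_LIMSEQ: "qpoch q \<longlonglongrightarrow> qinf"
  using convergent_prod_LIMSEQ_lessThan[OF convergent_qinf]
  by (simp add: qpoch_def[abs_def] qinf_def)

lemma qinf_nz: "qinf \<noteq> 0"
  unfolding qinf_def using pow_Suc_nz by (intro prodinf_nonzero convergent_qinf) simp

lemma qinf_pos: "qinf > 0"
proof -
  have "qinf \<ge> 0"
    by (rule LIMSEQ_le_const[OF qpoch_LIMSEQ]) (use qpoch_pos in \<open>auto intro: less_imp_le\<close>)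
  with qinf_nz show ?thesis by simp
qed

text \<open>For \<open>c = 2 cos t\<close> this is |1 - q^(k+1) e^(2it)|^2. It is the factor of
  index k + 1 in the product of \<open>q_normal\<close>; the factor of index 0 is 4 - c^2 and is
  absorbed by the semicircle.\<close>

definition weight_factor :: "real \<Rightarrow> nat \<Rightarrow> real" where
  "weight_factor c k = 1 + (2 - c\<^sup>2) * q ^ Suc k + (q ^ Suc k)\<^sup>2"

lemma weight_factor_bound:
  assumes "\<bar>c\<bar> \<le> 2"
  shows "\<bar>weight_factor c k - 1\<bar> \<le> 3 * \<bar>q\<bar> ^ k"
proof -
  let ?p = "q ^ Suc k"
  have c2: "c\<^sup>2 \<le> 4"
    using assms power_mono[of "\<bar>c\<bar>" 2 2] by simp
  have p1: "\<bar>?p\<bar> \<le> 1" using abs_q by (simp add: abs_mult power_abs mult_le_one power_le_one)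
  have pk: "\<bar>?p\<bar> \<le> \<bar>q\<bar> ^ k" using abs_q by (simp add: abs_mult power_abs mult_left_le_one_le)
  have "\<bar>weight_factor c k - 1\<bar> \<le> \<bar>(2 - c\<^sup>2) * ?p\<bar> + \<bar>?p\<^sup>2\<bar>"
    unfolding weight_factor_def by linarith
  also have "\<bar>(2 - c\<^sup>2) * ?p\<bar> \<le> 2 * \<bar>?p\<bar>"
    unfolding abs_mult using c2 by (intro mult_right_mono) (auto simp: abs_le_iff)
  also have "\<bar>?p\<^sup>2\<bar> \<le> \<bar>?p\<bar>"
    using p1 by (simp only: power2_eq_square abs_mult) (rule mult_left_le, auto)
  finally show ?thesis using pk by linarith
qed

lemma weight_factor_pos:
  assumes "\<bar>c\<bar> \<le> 2"
  shows "weight_factor c k > 0"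
proof -
  let ?p = "q ^ Suc k"
  have c2: "c\<^sup>2 \<le> 4" using assms power_mono[of "\<bar>c\<bar>" 2 2] by simp
  have p1: "\<bar>?p\<bar> < 1" using abs_q by (simp only: power_abs power_less_one_iff abs_ge_zero) simp
  have "(2 - c\<^sup>2) * ?p \<ge> - (2 * \<bar>?p\<bar>)"
  proof -
    have "\<bar>(2 - c\<^sup>2) * ?p\<bar> \<le> 2 * \<bar>?p\<bar>"
      unfolding abs_mult using c2 by (intro mult_right_mono) (auto simp: abs_le_iff)
    then show ?thesis by linarith
  qed
  moreover have "(1 - \<bar>?p\<bar>)\<^sup>2 > 0" using p1 by simp
  moreover have "(1 - \<bar>?p\<bar>)\<^sup>2 = 1 - 2 * \<bar>?p\<bar> + ?p\<^sup>2" 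
    by (simp add: power2_diff)
  ultimately show ?thesis unfolding weight_factor_def by linarith
qed

lemma convergent_weight_factor: "\<bar>c\<bar> \<le> 2 \<Longrightarrow> convergent_prod (weight_factor c)"
  by (rule convergent_prod_near_one[OF weight_factor_bound summable_mult[OF summable_abs_pow]])

text \<open>Obtained from \<open>weight_factor_bound\<close> and 1 + x \<le> exp x. It bounds all
  partial products uniformly in the truncation and in the point, so a multiple of the semicircle
  dominates all truncated weights.\<close>

definition wbound :: real where
  "wbound = exp (\<Sum>k. 3 * \<bar>q\<bar> ^ k)"

lemma prod_weight_factor_le:
  assumes "\<bar>c\<bar> \<le> 2"
  shows "\<bar>\<Prod>k<n. weight_factor c k\<bar> \<le> wbound"
proof -
  have "\<bar>\<Prod>k<n. weight_factor c k\<bar> = (\<Prod>k<n. \<bar>weight_factor c k\<bar>)" by (simp add: abs_prod)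
  also have "\<dots> \<le> (\<Prod>k<n. exp (3 * \<bar>q\<bar> ^ k))"
  proof (intro prod_mono conjI)
    fix k
    have "\<bar>weight_factor c k\<bar> \<le> 1 + 3 * \<bar>q\<bar> ^ k" using weight_factor_bound[OF assms, of k] by linarith
    also have "\<dots> \<le> exp (3 * \<bar>q\<bar> ^ k)" by (rule exp_ge_add_one_self)
    finally show "\<bar>weight_factor c k\<bar> \<le> exp (3 * \<bar>q\<bar> ^ k)" .
  qed simp
  also have "\<dots> = exp (\<Sum>k<n. 3 * \<bar>q\<bar> ^ k)" by (simp add: exp_sum)
  also have "\<dots> \<le> wbound"
    unfolding wbound_def exp_le_cancel_iff
    by (intro sum_le_suminf summable_mult summable_abs_pow) auto
  finally show ?thesis .
qed

definition partial_weight :: "nat \<Rightarrow> real \<Rightarrow> real" where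
  "partial_weight n c = semicircle c * (\<Prod>k<n. weight_factor c k)"

text \<open>The factor \<open>qinf\<close> is the second product of \<open>q_normal\<close>. It
  makes the total mass 1, because the masses of the truncated weights tend to
  \<open>1 / qinf\<close>.\<close>

definition weight :: "real \<Rightarrow> real" where
  "weight c = qinf * (semicircle c * prodinf (weight_factor c))"

lemma partial_weight_LIMSEQ: "(\<lambda>n. qinf * partial_weight n c) \<longlonglongrightarrow> weight c"
proof (cases "\<bar>c\<bar> \<le> 2")
  case True
  then show ?thesis
    unfolding partial_weight_def weight_def
    by (intro tendsto_intros convergent_prod_LIMSEQ_lessThan convergent_weight_factor)
next
  case False
  then have "semicircle c = 0" by (rule semicircle_outside)
  then show ?thesis by (simp add: partial_weight_def weight_def)
qed

lemma partial_weight_measurable [measurable]: "partial_weight n \<in> borel_measurable borel"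
  unfolding partial_weight_def weight_factor_def by measurable

lemma weight_measurable [measurable]: "weight \<in> borel_measurable borel"
  by (rule borel_measurable_LIMSEQ_real[OF partial_weight_LIMSEQ]) simp

lemma semicircle_nonneg: "semicircle c \<ge> 0"
proof (cases "\<bar>c\<bar> \<le> 2")
  case True
  then have "c\<^sup>2 \<le> 4" using power_mono[of "\<bar>c\<bar>" 2 2] by simp
  then show ?thesis by (auto simp: semicircle_def)
next
  case False
  then show ?thesis by (simp add: semicircle_outside)
qed

lemma partial_weight_le: "\<bar>partial_weight n c\<bar> \<le> wbound * semicircle c"
proof (cases "\<bar>c\<bar> \<le> 2")
  case True
  then show ?thesis unfolding partial_weight_def abs_mult
    using mult_left_mono[OF prod_weight_factor_le[OF True, of n] semicircle_nonneg[of c]] semicircle_nonneg[of c]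
    by (simp add: mult_ac)
next
  case False
  then have "semicircle c = 0" by (rule semicircle_outside)
  then show ?thesis by (simp add: partial_weight_def)
qed

lemma weight_le: "\<bar>weight c\<bar> \<le> qinf * wbound * semicircle c"
proof (rule LIMSEQ_le_const2[OF tendsto_rabs[OF partial_weight_LIMSEQ]], intro exI allI impI)
  fix n show "\<bar>qinf * partial_weight n c\<bar> \<le> qinf * wbound * semicircle c"
    using mult_left_mono[OF partial_weight_le, of qinf n c] qinf_pos by (simp add: abs_mult)
qed

lemma weight_nonneg: "weight c \<ge> 0"
proof (rule LIMSEQ_le_const[OF partial_weight_LIMSEQ], intro exI allI impI)
  fix n
  show "0 \<le> qinf * partial_weight n c"
  proof (cases "\<bar>c\<bar> \<le> 2")
    case True
    then show ?thesis unfolding partial_weight_def using qinf_pos semicircle_nonneg weight_factor_pos[OF True]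
      by (auto intro!: mult_nonneg_nonneg prod_nonneg intro: less_imp_le)
  next
    case False
    then have "semicircle c = 0" by (rule semicircle_outside)
    then show ?thesis by (simp add: partial_weight_def)
  qed
qed

lemma weight_outside: "\<not> \<bar>c\<bar> \<le> 2 \<Longrightarrow> weight c = 0"
  by (simp add: weight_def semicircle_outside)

lemma integrable_partial_weight:
  assumes "continuous_on UNIV g"
  shows "integrable lborel (\<lambda>c. partial_weight n c * g c)"
proof -
  have "continuous_on UNIV (\<lambda>c. (\<Prod>k<n. weight_factor c k) * g c)"
    unfolding weight_factor_def by (intro continuous_intros assms)
  from integrable_semicircle[OF this] show ?thesis
    by (simp add: partial_weight_def mult_ac)
qed

lemma integrable_weight:
  assumes "continuous_on UNIV g"
  shows "integrable lborel (\<lambda>c. weight c * g c)"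
proof (rule Bochner_Integration.integrable_bound)
  show "integrable lborel (\<lambda>c. qinf * wbound * (semicircle c * g c))"
    by (intro integrable_mult_right integrable_semicircle assms)
  have [measurable]: "g \<in> borel_measurable borel"
    by (intro borel_measurable_continuous_onI assms)
  show "(\<lambda>c. weight c * g c) \<in> borel_measurable lborel" by measurable
  show "AE c in lborel. norm (weight c * g c) \<le> norm (qinf * wbound * (semicircle c * g c))"
  proof (intro AE_I2)
    fix c
    have "norm (weight c * g c) \<le> (qinf * wbound * semicircle c) * \<bar>g c\<bar>"
      using mult_right_mono[OF weight_le[of c], of "\<bar>g c\<bar>"] by (simp add: abs_mult)
    also have "\<dots> \<le> norm (qinf * wbound * (semicircle c * g c))"
      using qinf_pos semicircle_nonneg[of c] by (simp add: abs_mult wbound_def)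
    finally show "norm (weight c * g c) \<le> norm (qinf * wbound * (semicircle c * g c))" .
  qed
qed

section \<open>Chebyshev moments of the truncated weights and of their limit\<close>

definition partial_weight_moment :: "nat \<Rightarrow> nat \<Rightarrow> real" where
  "partial_weight_moment n j = (LINT c|lborel. partial_weight n c * qh 0 j c)"

lemma partial_weight_moment_0: "partial_weight_moment 0 j = (if j = 0 then 1 else 0)"
  unfolding partial_weight_moment_def partial_weight_def
  using has_bochner_integral_integral_eq[OF has_bochner_integral_semicircle_qh[of j]] by simp

lemma partial_weight_Suc:
  "partial_weight (Suc n) c = (1 + (q ^ Suc n)\<^sup>2) * partial_weight n c - q ^ Suc n * ((c\<^sup>2 - 2) * partial_weight n c)"
  by (simp add: partial_weight_def weight_factor_def algebra_simps)

text \<open>The next truncation multiplies the weight by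
  \<open>1 + p\<^sup>2 - p * (c\<^sup>2 - 2)\<close> with \<open>p = q ^ Suc n\<close>. The
  coefficient \<open>b\<close> covers the reflection at the lower end of the index range: it is -1
  for \<open>j = 0\<close>, 0 for \<open>j = 1\<close> and 1 afterwards, as if the Chebyshev
  polynomials of index -2 and -1 were \<open>- qh 0 0\<close> and 0.\<close>

lemma partial_weight_moment_Suc_shift:
  assumes "\<And>c. (c\<^sup>2 - 2) * qh 0 j c = qh 0 k c + b * qh 0 l c"
  shows "partial_weight_moment (Suc n) j = (1 + (q ^ Suc n)\<^sup>2) * partial_weight_moment n j - q ^ Suc n * (partial_weight_moment n k + b * partial_weight_moment n l)"
proof -
  have int: "integrable lborel (\<lambda>c. partial_weight n c * qh 0 j c)" for j
    by (intro integrable_partial_weight continuous_intros)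
  have "partial_weight_moment (Suc n) j = (LINT c|lborel. (1 + (q ^ Suc n)\<^sup>2) * (partial_weight n c * qh 0 j c)
       - q ^ Suc n * (partial_weight n c * qh 0 k c + b * (partial_weight n c * qh 0 l c)))"
    unfolding partial_weight_moment_def
  proof (rule Bochner_Integration.integral_cong[OF refl])
    fix c
    have "partial_weight (Suc n) c * qh 0 j c = (1 + (q ^ Suc n)\<^sup>2) * (partial_weight n c * qh 0 j c)
        - q ^ Suc n * (partial_weight n c * ((c\<^sup>2 - 2) * qh 0 j c))"
      by (simp add: partial_weight_Suc algebra_simps)
    then show "partial_weight (Suc n) c * qh 0 j c = (1 + (q ^ Suc n)\<^sup>2) * (partial_weight n c * qh 0 j c)
       - q ^ Suc n * (partial_weight n c * qh 0 k c + b * (partial_weight n c * qh 0 l c))"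
      unfolding assms by (simp add: algebra_simps)
  qed
  also have "\<dots> = (1 + (q ^ Suc n)\<^sup>2) * partial_weight_moment n j - q ^ Suc n * (partial_weight_moment n k + b * partial_weight_moment n l)"
    unfolding partial_weight_moment_def using int by simp
  finally show ?thesis .
qed

lemma partial_weight_moment_Suc_0: "partial_weight_moment (Suc n) 0 = (1 + (q ^ Suc n)\<^sup>2) * partial_weight_moment n 0 - q ^ Suc n * (partial_weight_moment n 2 - partial_weight_moment n 0)"
  using partial_weight_moment_Suc_shift[of 0 2 "-1" 0 n] by (simp add: numeral_2_eq_2 qh.simps(3) power2_eq_square)

lemma partial_weight_moment_Suc_1: "partial_weight_moment (Suc n) 1 = (1 + (q ^ Suc n)\<^sup>2) * partial_weight_moment n 1 - q ^ Suc n * partial_weight_moment n 3"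
  using partial_weight_moment_Suc_shift[of 1 3 0 0 n]
  by (simp add: numeral_3_eq_3 qh.simps(3) power2_eq_square algebra_simps)

lemma partial_weight_moment_Suc_ge2:
  "partial_weight_moment (Suc n) (Suc (Suc j)) = (1 + (q ^ Suc n)\<^sup>2) * partial_weight_moment n (Suc (Suc j))
      - q ^ Suc n * (partial_weight_moment n (Suc (Suc (Suc (Suc j)))) + partial_weight_moment n j)"
  using partial_weight_moment_Suc_shift[of "Suc (Suc j)" "Suc (Suc (Suc (Suc j)))" 1 j n] qh_0_rec2[of _ j] by simp

lemma partial_weight_moment_odd: "partial_weight_moment n (Suc (2 * j)) = 0"
proof (induction n arbitrary: j)
  case (Suc n)
  show ?case
  proof (cases j)
    case 0
    then show ?thesis using partial_weight_moment_Suc_1[of n] Suc[of 0] Suc[of 1] by (simp add: numeral_3_eq_3)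
  next
    case (Suc i)
    then show ?thesis
      using partial_weight_moment_Suc_ge2[of n "Suc (2 * i)"] Suc.IH[of i] Suc.IH[of "Suc i"] Suc.IH[of "Suc (Suc i)"] by simp
  qed
qed (simp add: partial_weight_moment_0)

text \<open>This is (-1)^j q^(j(j+1)/2), a coefficient of the Jacobi theta series.\<close>

definition theta_coeff :: "nat \<Rightarrow> real" where
  "theta_coeff j = (\<Prod>i<j. - (q ^ Suc i))"

lemma theta_coeff_0 [simp]: "theta_coeff 0 = 1" and theta_coeff_Suc: "theta_coeff (Suc j) = - (q ^ Suc j) * theta_coeff j"
  by (simp_all add: theta_coeff_def)

text \<open>The usual convention that 1 / (q;q)_(n-j) vanishes for \<open>j > n\<close>; truncated
  subtraction alone would give 1 there.\<close>

definition recip_qpoch :: "nat \<Rightarrow> nat \<Rightarrow> real" where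
  "recip_qpoch n j = (if j \<le> n then 1 / qpoch q (n - j) else 0)"

text \<open>For \<open>j \<le> n\<close> the right-hand side is \<open>theta_coeff j\<close> times
  the q-binomial coefficient with entries 2n + 1 and n - j. It is checked against the recurrence in
  \<open>n\<close>, which couples the indices j - 1, j and j + 1; the reflection at
  \<open>j = 0\<close> and the upper boundary are treated separately.\<close>

lemma partial_weight_moment_even: "partial_weight_moment n (2 * j) = theta_coeff j * qpoch q (Suc (2 * n)) * recip_qpoch n j / qpoch q (Suc n + j)"
proof (induction n arbitrary: j)
  case 0
  then show ?case by (auto simp: partial_weight_moment_0 recip_qpoch_def)
next
  case (Suc n)
  define p where "p = q ^ Suc n"
  have p2: "q ^ Suc (Suc (2 * n)) = p\<^sup>2" "q ^ Suc (Suc (Suc (2 * n))) = q * p\<^sup>2"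
    unfolding p_def by (simp_all add: power2_eq_square power_mult[symmetric] mult_2 power_add)
  define Q where "Q = qpoch q (Suc (2 * n))"
  have Q3: "qpoch q (Suc (2 * Suc n)) = Q * (1 - p\<^sup>2) * (1 - q * p\<^sup>2)"
    using qpoch_Suc[of q "Suc (2 * n)"] qpoch_Suc[of q "Suc (Suc (2 * n))"]
    unfolding Q_def p2 by simp
  show ?case
  proof (cases j)
    case 0
    have nz: "1 - p \<noteq> 0" "1 - q * p \<noteq> 0"
      using pow_Suc_nz[of n] pow_Suc_nz[of "Suc n"] by (simp_all add: p_def)
    define R where "R = qpoch q n"
    have R: "R \<noteq> 0" by (simp add: R_def)
    have R1: "qpoch q (Suc n) = R * (1 - p)" "qpoch q (Suc (Suc n)) = R * (1 - p) * (1 - q * p)"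
      by (simp_all add: R_def p_def qpoch_Suc)
    \<comment> \<open>This holds for \<open>n = 0\<close> too, where both sides are 0.\<close>
    have r1: "recip_qpoch n 1 = (1 - q ^ n) / R"
      using pow_Suc_nz[of "n - 1"] by (cases n) (auto simp: recip_qpoch_def R_def qpoch_Suc)
    have qn: "q * q ^ n = p" by (simp add: p_def)
    have "partial_weight_moment (Suc n) 0 = (1 + p\<^sup>2) * (Q / (R * (R * (1 - p))))
        - p * (- q * Q * ((1 - q ^ n) / R) / (R * (1 - p) * (1 - q * p)) - Q / (R * (R * (1 - p))))"
      unfolding partial_weight_moment_Suc_0 using Suc[of 0] Suc[of 1] r1 R1 p_def
      by (simp add: theta_coeff_Suc Q_def R_def recip_qpoch_def)
    also have "\<dots> = Q / (R * R * (1 - p) * (1 - q * p)) *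
        ((1 + p\<^sup>2 + p) * (1 - q * p) + p * (q - p))"
    proof -
      have "(1 + p\<^sup>2) * (Q / (R * (R * v))) - p * (- q * Q * ((1 - z) / R) / (R * v * w) - Q / (R * (R * v)))
          = Q / (R * R * v * w) * ((1 + p\<^sup>2 + p) * w + p * (q - q * z))"
        if "v \<noteq> 0" "w \<noteq> 0" for v w z
        using that R by (simp add: field_simps)
      from this[OF nz, of "q ^ n"] show ?thesis unfolding qn .
    qed
    also have "(1 + p\<^sup>2 + p) * (1 - q * p) + p * (q - p) = (1 + p) * (1 - q * p\<^sup>2)"
      by algebra
    also have "Q / (R * R * (1 - p) * (1 - q * p)) * ((1 + p) * (1 - q * p\<^sup>2))
       = Q * (1 - p\<^sup>2) * (1 - q * p\<^sup>2) * (1 / (R * (1 - p))) / (R * (1 - p) * (1 - q * p))"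
    proof -
      have "Q / (R * R * v * w) * ((1 + p) * E) = Q * (v * (1 + p)) * E * (1 / (R * v)) / (R * v * w)"
        if "v \<noteq> 0" "w \<noteq> 0" for v w E
        using that R by (simp add: field_simps)
      moreover have "1 - p\<^sup>2 = (1 - p) * (1 + p)" by algebra
      ultimately show ?thesis using nz by metis
    qed
    finally show ?thesis
      using 0 R1 Q3 by (simp add: recip_qpoch_def)
  next
    case j: (Suc i)
    have rec: "partial_weight_moment (Suc n) (2 * j) = (1 + p\<^sup>2) * partial_weight_moment n (2 * Suc i) - p * (partial_weight_moment n (2 * Suc (Suc i)) + partial_weight_moment n (2 * i))"
      using partial_weight_moment_Suc_ge2[of n "2 * i"] by (simp add: j p_def)
    \<comment> \<open>The neighbours i, i + 1, i + 2 enter through \<open>recip_qpoch n\<close>. All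
      of them vanish for \<open>i > n\<close>, and for \<open>i = n\<close> only the lowest
      survives.\<close>
    consider "i > n" | "i = n" | "i < n" by linarith
    then show ?thesis
    proof cases
      case 1
      then show ?thesis unfolding rec Suc.IH by (simp add: recip_qpoch_def j)
    next
      case 2
      have "partial_weight_moment (Suc n) (2 * j) = - p * theta_coeff n"
        unfolding rec Suc.IH by (simp add: recip_qpoch_def 2 mult_2)
      then show ?thesis
        by (simp add: j 2 recip_qpoch_def theta_coeff_Suc p_def mult_2)
    next
      case 3
      define N where "N = n - Suc i"
      have n: "n = Suc (i + N)" using 3 by (simp add: N_def)
      define A B X where "A = q ^ i" and "B = q ^ N" and "X = q * q * q * A * A * B"
      have p: "p = q * q * A * B" by (simp add: p_def n A_def B_def power_add)
      define T where "T = qpoch q (Suc n + i)"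
      have X1: "q ^ Suc (Suc n + i) = X" "q ^ Suc (Suc (Suc n + i)) = q * X"
        by (simp_all add: X_def n A_def B_def power_add)
      have T: "qpoch q (Suc n + Suc i) = T * (1 - X)" "qpoch q (Suc n + Suc (Suc i)) = T * (1 - X) * (1 - q * X)"
        using X1 by (simp_all add: T_def qpoch_Suc del: power_Suc)
      have nz: "T \<noteq> 0" "1 - X \<noteq> 0" "1 - q * X \<noteq> 0"
        using pow_Suc_nz[of "Suc n + i"] pow_Suc_nz[of "Suc (Suc n + i)"] unfolding X1 by (simp_all add: T_def)
      define b where "b = recip_qpoch (Suc n) (Suc i)"
      have b0: "recip_qpoch n i = b" "recip_qpoch n (Suc i) = b * (1 - q * B)" "recip_qpoch n (Suc (Suc i)) = b * (1 - q * B) * (1 - B)"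
      proof -
        show "recip_qpoch n i = b" by (simp add: b_def recip_qpoch_def)
        have bb: "b = 1 / (qpoch q N * (1 - q * B))"
          by (simp add: b_def recip_qpoch_def n B_def qpoch_Suc Suc_diff_le)
        have nzB: "1 - q * B \<noteq> 0" using pow_Suc_nz[of N] by (simp add: B_def)
        show 1: "recip_qpoch n (Suc i) = b * (1 - q * B)"
          using nzB by (simp add: recip_qpoch_def n bb)
        show "recip_qpoch n (Suc (Suc i)) = b * (1 - q * B) * (1 - B)"
        \<comment> \<open>For \<open>N = 0\<close> the factor \<open>1 - B\<close> is 0, in
          agreement with \<open>recip_qpoch n (Suc n) = 0\<close>.\<close>
        proof (cases N)
          case 0
          then show ?thesis by (simp add: recip_qpoch_def n B_def)
        next
          case (Suc N')
          have "1 - B \<noteq> 0" using pow_Suc_nz[of N'] by (simp add: B_def Suc)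
          then show ?thesis using nzB by (simp add: recip_qpoch_def n bb Suc qpoch_Suc B_def)
        qed
      qed
      have sgs: "theta_coeff (Suc i) = - (q * A) * theta_coeff i" "theta_coeff (Suc (Suc i)) = (q * A) * (q * q * A) * theta_coeff i"
        by (simp_all add: theta_coeff_Suc A_def)
      have "partial_weight_moment (Suc n) (2 * j) = Q * b * theta_coeff i / (T * (1 - X) * (1 - q * X)) *
         (- ((1 + p\<^sup>2) * (q * A) * (1 - q * B) * (1 - q * X))
           - p * ((q * A) * (q * q * A) * (1 - q * B) * (1 - B) + (1 - X) * (1 - q * X)))"
        unfolding rec Suc.IH T b0 sgs Q_def[symmetric] T_def[symmetric] using nz
        by (simp add: divide_simps) (simp add: algebra_simps)
      also have "\<dots> = Q * b * theta_coeff i / (T * (1 - X) * (1 - q * X)) * (- (q * A) * ((1 - p\<^sup>2) * (1 - q * p\<^sup>2)))"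
        using partial_weight_moment_even_identity[of q A B] unfolding p X_def by simp
      also have "\<dots> = theta_coeff j * qpoch q (Suc (2 * Suc n)) * recip_qpoch (Suc n) j / qpoch q (Suc (Suc n) + j)"
        unfolding Q3 j using T sgs by (simp add: b_def)
      finally show ?thesis .
    qed
  qed
qed

lemma partial_weight_moment_LIMSEQ: "(\<lambda>n. qinf * partial_weight_moment n j) \<longlonglongrightarrow> (LINT c|lborel. weight c * qh 0 j c)"
proof -
  have "(\<lambda>n. LINT c|lborel. qinf * partial_weight n c * qh 0 j c) \<longlonglongrightarrow> (LINT c|lborel. weight c * qh 0 j c)"
  proof (rule integral_dominated_convergence)
    show "integrable lborel (\<lambda>c. qinf * wbound * \<bar>semicircle c * qh 0 j c\<bar>)"
      by (intro integrable_mult_right integrable_abs integrable_semicircle continuous_intros)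
    show "AE c in lborel. (\<lambda>n. qinf * partial_weight n c * qh 0 j c) \<longlonglongrightarrow> weight c * qh 0 j c"
      by (intro AE_I2 tendsto_mult partial_weight_LIMSEQ tendsto_const)
    show "AE c in lborel. norm (qinf * partial_weight n c * qh 0 j c) \<le> qinf * wbound * \<bar>semicircle c * qh 0 j c\<bar>" for n
    proof (intro AE_I2)
      fix c
      show "norm (qinf * partial_weight n c * qh 0 j c) \<le> qinf * wbound * \<bar>semicircle c * qh 0 j c\<bar>"
        using mult_left_mono[OF mult_right_mono[OF partial_weight_le[of n c], of "\<bar>qh 0 j c\<bar>"], of qinf]
          qinf_pos semicircle_nonneg[of c] by (simp add: abs_mult mult_ac)
    qed
  qed measurable
  then show ?thesis by (simp add: partial_weight_moment_def mult.assoc)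
qed

lemma integral_weight_chebyshev_odd: "(LINT c|lborel. weight c * qh 0 (Suc (2 * j)) c) = 0"
  using partial_weight_moment_LIMSEQ[of "Suc (2 * j)"] unfolding partial_weight_moment_odd by (simp add: LIMSEQ_const_iff)

text \<open>All three q-Pochhammer symbols of the finite formula tend to \<open>qinf\<close>. One
  reciprocal is left over, and the factor \<open>qinf\<close> of \<open>weight\<close> cancels
  it.\<close>

lemma integral_weight_chebyshev_even: "(LINT c|lborel. weight c * qh 0 (2 * j) c) = theta_coeff j"
proof (rule LIMSEQ_unique[OF partial_weight_moment_LIMSEQ])
  have shift: "(\<lambda>n. qpoch q (f n)) \<longlonglongrightarrow> qinf" if "filterlim f sequentially sequentially" for f
    by (rule filterlim_compose[OF qpoch_LIMSEQ that])
  have 1: "(\<lambda>n. qpoch q (Suc (2 * n))) \<longlonglongrightarrow> qinf"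
    by (intro shift filterlim_compose[OF filterlim_Suc] filterlim_subseq) (simp add: strict_mono_def)
  have 2: "(\<lambda>n. qpoch q (Suc n + j)) \<longlonglongrightarrow> qinf"
    by (intro shift filterlim_subseq) (simp add: strict_mono_def)
  have 3: "(\<lambda>n. qpoch q (n - j)) \<longlonglongrightarrow> qinf"
    by (rule LIMSEQ_offset[of _ j]) (simp add: qpoch_LIMSEQ)
  have "recip_qpoch n j = 1 / qpoch q (n - j)" if "n \<ge> j" for n using that by (simp add: recip_qpoch_def)
  then have ev: "\<forall>\<^sub>F n in sequentially. 1 / qpoch q (n - j) = recip_qpoch n j"
    by (intro eventually_sequentiallyI[of j]) simp
  have 4: "(\<lambda>n. recip_qpoch n j) \<longlonglongrightarrow> 1 / qinf"
    by (rule Lim_transform_eventually[OF tendsto_divide[OF tendsto_const 3] ev]) (simp add: qinf_nz)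
  have "(\<lambda>n. qinf * partial_weight_moment n (2 * j)) \<longlonglongrightarrow> qinf * (theta_coeff j * qinf * (1 / qinf) / qinf)"
    unfolding partial_weight_moment_even by (intro tendsto_intros 1 2 4 qinf_nz)
  then show "(\<lambda>n. qinf * partial_weight_moment n (2 * j)) \<longlonglongrightarrow> theta_coeff j" using qinf_nz by simp
qed

end

text \<open>A recurrence for products of two q-Hermite polynomials. Here \<open>p = q ^ k\<close>,
  \<open>u\<close> and \<open>v\<close> are \<open>qh q k c\<close> and
  \<open>qh q (Suc k) c\<close>, and \<open>U\<close>, \<open>V\<close> are the same at
  \<open>e\<close>. Then \<open>h2\<close>, \<open>g2\<close> have index k + 2 and the left-hand
  side is the product at index k + 3. The last product stands for index k - 1, because c u - v is (1
  - q^k) times the polynomial of that index; in this form it makes sense for k = 0 as well.\<close>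

lemma mehler_step:
  fixes c e u v U V q p :: real
  defines "h2 \<equiv> c * v - (1 - q * p) * u" and "g2 \<equiv> e * V - (1 - q * p) * U"
  shows "(c * h2 - (1 - q * (q * p)) * v) * (e * g2 - (1 - q * (q * p)) * V) =
    c * e * (h2 * g2) - (c\<^sup>2 + e\<^sup>2 - 2 + (1 + q) * (q * p)) * (1 - q * (q * p)) * (v * V)
    + c * e * ((1 - q * p) * (1 - q * (q * p))) * (u * U)
    - (1 - q * p) * (1 - q * (q * p)) * ((c * u - v) * (e * U - V))"
  unfolding assms by algebra

definition mehler_fac :: "real \<Rightarrow> real \<Rightarrow> real \<Rightarrow> real" where
  "mehler_fac c e t = (1 - t\<^sup>2)\<^sup>2 - t * (1 + t\<^sup>2) * c * e + t\<^sup>2 * (c\<^sup>2 + e\<^sup>2)"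

text \<open>For \<open>c = 2 cos a\<close> and \<open>e = 2 cos b\<close> the quartic in
  \<open>t\<close> factors as |1 - t e^(i(a+b))|^2 |1 - t e^(i(a-b))|^2, and each factor is at least
  (1 - |t|)^2.\<close>

lemma mehler_fac_pos:
  assumes "\<bar>t\<bar> < 1" "\<bar>c\<bar> \<le> 2" "\<bar>e\<bar> \<le> 2"
  shows "mehler_fac c e t > 0"
proof -
  define a b where "a = arccos (c/2)" and "b = arccos (e/2)"
  have c: "c = 2 * cos a" and e: "e = 2 * cos b"
    using assms by (simp_all add: a_def b_def abs_le_iff)
  have pos: "1 - 2 * t * cos x + t\<^sup>2 > 0" for x
  proof -
    have "\<bar>t * cos x\<bar> \<le> \<bar>t\<bar>" by (simp add: abs_mult mult_left_le)
    then have "1 - 2 * t * cos x + t\<^sup>2 \<ge> 1 - 2 * \<bar>t\<bar> + t\<^sup>2" by linarith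
    also have "1 - 2 * \<bar>t\<bar> + t\<^sup>2 = (1 - \<bar>t\<bar>)\<^sup>2" by (simp add: power2_diff)
    finally show ?thesis using assms zero_less_power2[of "1 - \<bar>t\<bar>"] by linarith
  qed
  have "mehler_fac c e t = (1 - 2 * t * cos (a + b) + t\<^sup>2) * (1 - 2 * t * cos (a - b) + t\<^sup>2)"
  proof -
    have id: "(1 - t\<^sup>2)\<^sup>2 - t * (1 + t\<^sup>2) * (2 * x) * (2 * y) + t\<^sup>2 * ((2 * x)\<^sup>2 + (2 * y)\<^sup>2)
       = (1 - 2 * t * (x * y - z * w) + t\<^sup>2) * (1 - 2 * t * (x * y + z * w) + t\<^sup>2)"
      if "z\<^sup>2 = 1 - x\<^sup>2" "w\<^sup>2 = 1 - y\<^sup>2" for x y z w :: real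
      using that by algebra
    show ?thesis unfolding mehler_fac_def c e cos_add cos_diff
      by (rule id) (simp_all add: sin_squared_eq)
  qed
  with pos show ?thesis by simp
qed

text \<open>15 = 4 + 6 + 4 + 1, the bounds on the coefficients of t, t^2, t^3 and t^4.\<close>

lemma mehler_fac_near_one:
  assumes "\<bar>t\<bar> \<le> 1" "\<bar>c\<bar> \<le> 2" "\<bar>e\<bar> \<le> 2"
  shows "\<bar>mehler_fac c e t - 1\<bar> \<le> 15 * \<bar>t\<bar>"
proof -
  have ce: "\<bar>c * e\<bar> \<le> 4" using mult_mono[OF assms(2,3)] by (simp add: abs_mult)
  have "c\<^sup>2 \<le> 4" "e\<^sup>2 \<le> 4"
    using assms power_mono[of "\<bar>c\<bar>" 2 2] power_mono[of "\<bar>e\<bar>" 2 2] by simp_all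
  moreover have "0 \<le> c\<^sup>2" "0 \<le> e\<^sup>2" by simp_all
  ultimately have ce2: "\<bar>c\<^sup>2 + e\<^sup>2 - 2\<bar> \<le> 6" by linarith
  have tn: "\<bar>t ^ Suc n\<bar> \<le> \<bar>t\<bar>" for n
    using assms by (simp add: abs_mult power_abs mult_left_le power_le_one)
  have b1: "\<bar>x * t ^ Suc n\<bar> \<le> k * \<bar>t\<bar>" if "\<bar>x\<bar> \<le> k" for x k n
    unfolding abs_mult using that tn[of n] by (intro mult_mono) auto
  have "mehler_fac c e t - 1 = - (c * e * t ^ Suc 0) + (c\<^sup>2 + e\<^sup>2 - 2) * t ^ Suc (Suc 0)
      - c * e * t ^ Suc (Suc (Suc 0)) + 1 * t ^ Suc (Suc (Suc (Suc 0)))"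
    unfolding mehler_fac_def by (simp add: power2_eq_square algebra_simps)
  then show ?thesis
    using b1[OF ce, of 0] b1[OF ce2, of "Suc 0"] b1[OF ce, of "Suc (Suc 0)"] b1[of 1 1 "Suc (Suc (Suc 0))"]
    by linarith
qed

text \<open>With \<open>r = s ^ 4\<close>, half of the decay keeps (n + 1) s^n bounded and the other
  half is still geometric. The quadratic factor is what a product of two q-Hermite polynomials
  contributes.\<close>

lemma summable_poly2_geometric:
  fixes r :: real
  assumes "0 \<le> r" "r < 1"
  shows "summable (\<lambda>n. (real (Suc n))\<^sup>2 * r ^ n)"
proof -
  define s where "s = sqrt (sqrt r)"
  have s: "0 \<le> s" "s < 1" "s * s < 1" using assms by (simp_all add: s_def)
  have s4: "r = s * s * (s * s)" unfolding s_def using assms by simp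
  have "(\<lambda>n. real n * s ^ n + s ^ n) \<longlonglongrightarrow> 0 + 0"
    using s by (intro tendsto_add powser_times_n_limit_0 LIMSEQ_power_zero) auto
  then have "Bseq (\<lambda>n. real (Suc n) * s ^ n)"
    by (intro convergent_imp_Bseq convergentI[of _ 0]) (simp add: algebra_simps)
  then obtain B where B: "\<And>n. norm (real (Suc n) * s ^ n) \<le> B" by (elim BseqE) blast
  show ?thesis
  proof (rule summable_comparison_test')
    show "summable (\<lambda>n. B\<^sup>2 * (s * s) ^ n)"
      using s by (intro summable_mult summable_geometric) simp
    fix n :: nat
    have "(real (Suc n))\<^sup>2 * r ^ n = (real (Suc n) * s ^ n)\<^sup>2 * (s * s) ^ n"
      unfolding s4 by (simp add: power_mult_distrib power2_eq_square del: of_nat_Suc)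
    moreover have "(real (Suc n) * s ^ n)\<^sup>2 \<le> B\<^sup>2"
      using B[of n] by (simp add: abs_le_square_iff[symmetric] del: of_nat_Suc)
    ultimately show "norm ((real (Suc n))\<^sup>2 * r ^ n) \<le> B\<^sup>2 * (s * s) ^ n"
      using s assms by (simp add: mult_right_mono del: of_nat_Suc)
  qed
qed

section \<open>From Chebyshev moments to the orthogonality of the q-Hermite polynomials\<close>

context q_disc
begin

text \<open>An intermediate between the Chebyshev moments, which are row \<open>n = 0\<close>, and
  orthogonality. A factor \<open>c\<close> can be expanded by the recurrence of either family, so
  each later row follows from the two before it.\<close>

definition mixed_moment :: "nat \<Rightarrow> nat \<Rightarrow> real" where
  "mixed_moment n j = (LINT c|lborel. weight c * (qh q n c * qh 0 j c))"

lemma integrable_mixed: "integrable lborel (\<lambda>c. weight c * (qh q n c * qh 0 j c))"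
  by (intro integrable_weight continuous_intros)

lemma mixed_moment_0: "mixed_moment 0 (2 * j) = theta_coeff j" "mixed_moment 0 (Suc (2 * j)) = 0"
  using integral_weight_chebyshev_even integral_weight_chebyshev_odd by (simp_all add: mixed_moment_def)

lemma mixed_moment_Suc_0: "mixed_moment 1 0 = mixed_moment 0 1"
  by (simp add: mixed_moment_def)

lemma mixed_moment_Suc_Suc: "mixed_moment 1 (Suc j) = mixed_moment 0 (Suc (Suc j)) + mixed_moment 0 j"
proof -
  have "mixed_moment 1 (Suc j) = (LINT c|lborel. weight c * (qh q 0 c * qh 0 (Suc (Suc j)) c) + weight c * (qh q 0 c * qh 0 j c))"
    unfolding mixed_moment_def by (intro Bochner_Integration.integral_cong) (auto simp: qh_0_rec algebra_simps)
  also have "\<dots> = mixed_moment 0 (Suc (Suc j)) + mixed_moment 0 j"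
    unfolding mixed_moment_def by (intro Bochner_Integration.integral_add integrable_mixed)
  finally show ?thesis .
qed

lemma mixed_moment_rec_0: "mixed_moment (Suc (Suc n)) 0 = mixed_moment (Suc n) 1 - (1 - q ^ Suc n) * mixed_moment n 0"
proof -
  have "mixed_moment (Suc (Suc n)) 0 = (LINT c|lborel. weight c * (qh q (Suc n) c * qh 0 1 c) - (1 - q ^ Suc n) * (weight c * (qh q n c * qh 0 0 c)))"
    unfolding mixed_moment_def by (intro Bochner_Integration.integral_cong) (auto simp: qh.simps(3) algebra_simps)
  also have "\<dots> = mixed_moment (Suc n) 1 - (1 - q ^ Suc n) * mixed_moment n 0"
    unfolding mixed_moment_def by (simp add: integrable_mixed del: qh.simps)
  finally show ?thesis .
qed

lemma mixed_moment_rec_Suc: "mixed_moment (Suc (Suc n)) (Suc j) = mixed_moment (Suc n) (Suc (Suc j)) + mixed_moment (Suc n) j - (1 - q ^ Suc n) * mixed_moment n (Suc j)"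
proof -
  have "mixed_moment (Suc (Suc n)) (Suc j) = (LINT c|lborel. weight c * (qh q (Suc n) c * qh 0 (Suc (Suc j)) c)
     + weight c * (qh q (Suc n) c * qh 0 j c) - (1 - q ^ Suc n) * (weight c * (qh q n c * qh 0 (Suc j) c)))"
    unfolding mixed_moment_def
  proof (intro Bochner_Integration.integral_cong refl)
    fix c
    have "weight c * (qh q (Suc (Suc n)) c * qh 0 (Suc j) c) =
       weight c * (qh q (Suc n) c * (c * qh 0 (Suc j) c)) - (1 - q ^ Suc n) * (weight c * (qh q n c * qh 0 (Suc j) c))"
      by (simp add: qh.simps(3) algebra_simps)
    then show "weight c * (qh q (Suc (Suc n)) c * qh 0 (Suc j) c) = weight c * (qh q (Suc n) c * qh 0 (Suc (Suc j)) c)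
     + weight c * (qh q (Suc n) c * qh 0 j c) - (1 - q ^ Suc n) * (weight c * (qh q n c * qh 0 (Suc j) c))"
      unfolding qh_0_rec by (simp add: algebra_simps)
  qed
  also have "\<dots> = mixed_moment (Suc n) (Suc (Suc j)) + mixed_moment (Suc n) j - (1 - q ^ Suc n) * mixed_moment n (Suc j)"
    unfolding mixed_moment_def by (simp add: integrable_mixed del: qh.simps)
  finally show ?thesis .
qed

text \<open>The zeros for \<open>j < n\<close> say that \<open>qh q n\<close> is orthogonal to all
  polynomials of lower degree. The values from the diagonal on have to be carried along, because row
  n + 2 at column j uses row n + 1 at the columns j - 1 and j + 1.\<close>

lemma mixed_moment_values:
  "(\<forall>j. mixed_moment n (n + 2 * j) = theta_coeff j * qpoch q (n + j) / qpoch q j \<and> mixed_moment n (Suc (n + 2 * j)) = 0) \<and> (\<forall>j<n. mixed_moment n j = 0)"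
proof (induction n rule: induct_nat_012)
  case 0
  then show ?case by (simp add: mixed_moment_0)
next
  case 1
  have "mixed_moment 1 (1 + 2 * j) = theta_coeff j * qpoch q (1 + j) / qpoch q j" for j
  proof -
    have "mixed_moment 1 (1 + 2 * j) = theta_coeff (Suc j) + theta_coeff j"
      using mixed_moment_Suc_Suc[of "2 * j"] mixed_moment_0(1)[of j] mixed_moment_0(1)[of "Suc j"] by simp
    then show ?thesis by (simp add: theta_coeff_Suc qpoch_Suc) (simp add: algebra_simps)
  qed
  moreover have "mixed_moment 1 (Suc (1 + 2 * j)) = 0" for j
    using mixed_moment_Suc_Suc[of "Suc (2 * j)"] mixed_moment_0(2)[of j] mixed_moment_0(2)[of "Suc j"] by simp
  moreover have "mixed_moment 1 0 = 0"
    using mixed_moment_Suc_0 mixed_moment_0(2)[of 0] by simp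
  ultimately show ?case by auto
next
  case (ge2 n)
  have A: "mixed_moment n (n + 2 * j) = theta_coeff j * qpoch q (n + j) / qpoch q j" "mixed_moment n (Suc (n + 2 * j)) = 0"
     and A0: "i < n \<Longrightarrow> mixed_moment n i = 0" for i j using ge2(1) by auto
  have B: "mixed_moment (Suc n) (Suc n + 2 * j) = theta_coeff j * qpoch q (Suc n + j) / qpoch q j" "mixed_moment (Suc n) (Suc (Suc n + 2 * j)) = 0"
     and B0: "i < Suc n \<Longrightarrow> mixed_moment (Suc n) i = 0" for i j using ge2(2) by auto
  show ?case
  proof (intro conjI allI impI)
    fix j
    define x y where "x = q ^ Suc j" and "y = q ^ Suc n"
    have s: "theta_coeff (Suc j) = - x * theta_coeff j" by (simp add: theta_coeff_Suc x_def)
    define R where "R = qpoch q (Suc n + j)"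
    have z: "q ^ Suc (Suc n + j) = x * y" by (simp add: x_def y_def power_add mult_ac)
    have R2: "qpoch q (Suc n + Suc j) = R * (1 - x * y)" "qpoch q (Suc (Suc n) + j) = R * (1 - x * y)"
      using z by (simp_all add: R_def qpoch_Suc del: power_Suc)
    have nz: "1 - x \<noteq> 0" using pow_Suc_nz[of j] by (simp add: x_def)
    have Qj: "qpoch q (Suc j) = qpoch q j * (1 - x)" by (simp add: qpoch_Suc x_def)
    have "mixed_moment (Suc (Suc n)) (Suc (Suc n) + 2 * j) =
        mixed_moment (Suc n) (Suc n + 2 * Suc j) + mixed_moment (Suc n) (Suc n + 2 * j) - (1 - y) * mixed_moment n (n + 2 * Suc j)"
      using mixed_moment_rec_Suc[of n "Suc n + 2 * j"] by (simp add: y_def)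
    also have "\<dots> = - x * theta_coeff j * (R * (1 - x * y)) / (qpoch q j * (1 - x)) + theta_coeff j * R / qpoch q j
         - (1 - y) * (- x * theta_coeff j * R / (qpoch q j * (1 - x)))"
      unfolding A B using R2 s Qj by (simp add: R_def)
    \<comment> \<open>Comes down to -x (1 - xy) + (1 - x) + (1 - y) x = (1 - x)(1 - xy).\<close>
    also have "\<dots> = theta_coeff j * (R * (1 - x * y)) / qpoch q j"
      using nz by (simp add: divide_simps) (simp add: algebra_simps)
    finally show "mixed_moment (Suc (Suc n)) (Suc (Suc n) + 2 * j) = theta_coeff j * qpoch q (Suc (Suc n) + j) / qpoch q j"
      unfolding R2 .
    show "mixed_moment (Suc (Suc n)) (Suc (Suc (Suc n) + 2 * j)) = 0"
      using mixed_moment_rec_Suc[of n "Suc (Suc n + 2 * j)"] B(2)[of "Suc j"] B(2)[of j] A(2)[of "Suc j"] by simp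
  next
    fix j assume j: "j < Suc (Suc n)"
    show "mixed_moment (Suc (Suc n)) j = 0"
    proof (cases j)
      case 0
      show ?thesis
      proof (cases "n = 0")
        case True
        then show ?thesis using 0 mixed_moment_rec_0[of 0] B(1)[of 0] A(1)[of 0] by (simp add: qpoch_Suc)
      next
        case False
        then show ?thesis using 0 mixed_moment_rec_0[of n] B0[of 1] A0[of 0] by simp
      qed
    next
      case (Suc i)
      \<comment> \<open>At \<open>Suc i = n\<close> two nonzero terms meet, and (q;q)_(n+1) cancels
        against (1 - q^(n+1)) (q;q)_n. In the other cases every term vanishes by parity or by
        degree.\<close>
      consider "i = n" | "Suc i = n" | "Suc (Suc i) < Suc n" using j Suc by linarith
      then show ?thesis
      proof cases
        case 1
        then show ?thesis using Suc mixed_moment_rec_Suc[of n n] B(2)[of 0] A(2)[of 0] B0[of n] by simp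
      next
        case 2
        then show ?thesis using Suc mixed_moment_rec_Suc[of n i] B(1)[of 0] A(1)[of 0] B0[of i] by (simp add: qpoch_Suc)
      next
        case 3
        then show ?thesis using Suc mixed_moment_rec_Suc[of n i] B0[of "Suc (Suc i)"] A0[of "Suc i"] B0[of i] by simp
      qed
    qed
  qed
qed

definition hermite_moment :: "nat \<Rightarrow> nat \<Rightarrow> real" where
  "hermite_moment m n = (LINT c|lborel. weight c * (qh q m c * qh q n c))"

lemma integrable_hermite_pair: "integrable lborel (\<lambda>c. weight c * (qh q m c * qh q n c))"
  by (intro integrable_weight continuous_intros)

lemma hermite_moment_0: "hermite_moment 0 n = (if n = 0 then 1 else 0)"
proof -
  have "hermite_moment 0 n = mixed_moment n 0" by (simp add: hermite_moment_def mixed_moment_def)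
  then show ?thesis using mixed_moment_values[of n] spec[OF conjunct1[OF mixed_moment_values[of 0]], of 0] by simp
qed

lemma hermite_moment_sym: "hermite_moment m n = hermite_moment n m"
  by (simp add: hermite_moment_def mult_ac)

lemma hermite_moment_1_Suc: "hermite_moment 1 (Suc k) = hermite_moment 0 (Suc (Suc k)) + (1 - q ^ Suc k) * hermite_moment 0 k"
proof -
  have "hermite_moment 1 (Suc k) = (LINT c|lborel. weight c * (qh q 0 c * qh q (Suc (Suc k)) c) + (1 - q ^ Suc k) * (weight c * (qh q 0 c * qh q k c)))"
    unfolding hermite_moment_def by (intro Bochner_Integration.integral_cong) (auto simp: qh.simps(3) algebra_simps)
  also have "\<dots> = hermite_moment 0 (Suc (Suc k)) + (1 - q ^ Suc k) * hermite_moment 0 k"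
    unfolding hermite_moment_def by (simp add: integrable_hermite_pair del: qh.simps)
  finally show ?thesis .
qed

lemma hermite_moment_rec: "hermite_moment (Suc (Suc m)) (Suc k) = hermite_moment (Suc m) (Suc (Suc k)) + (1 - q ^ Suc k) * hermite_moment (Suc m) k - (1 - q ^ Suc m) * hermite_moment m (Suc k)"
proof -
  have "hermite_moment (Suc (Suc m)) (Suc k) = (LINT c|lborel. weight c * (qh q (Suc m) c * qh q (Suc (Suc k)) c)
     + (1 - q ^ Suc k) * (weight c * (qh q (Suc m) c * qh q k c)) - (1 - q ^ Suc m) * (weight c * (qh q m c * qh q (Suc k) c)))"
    unfolding hermite_moment_def by (intro Bochner_Integration.integral_cong) (auto simp: qh.simps(3) algebra_simps)
  also have "\<dots> = hermite_moment (Suc m) (Suc (Suc k)) + (1 - q ^ Suc k) * hermite_moment (Suc m) k - (1 - q ^ Suc m) * hermite_moment m (Suc k)"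
    unfolding hermite_moment_def by (simp add: integrable_hermite_pair del: qh.simps)
  finally show ?thesis .
qed

text \<open>Row 0 comes from the mixed moments. Multiplication by \<open>c\<close> is symmetric, so
  \<open>hermite_moment_rec\<close> yields the remaining rows; the norm (q;q)_n builds up from the
  coefficients 1 - q^n of the three-term recurrence.\<close>

lemma qh_orthogonal: "hermite_moment m n = (if m = n then qpoch q n else 0)"
proof (induction m arbitrary: n rule: induct_nat_012)
  case 0
  then show ?case by (auto simp: hermite_moment_0)
next
  case 1
  show ?case
  proof (cases n)
    case 0
    then show ?thesis using hermite_moment_sym[of 1 0] by (simp add: hermite_moment_0)
  next
    case (Suc k)
    then show ?thesis using hermite_moment_1_Suc[of k] by (auto simp: hermite_moment_0 qpoch_Suc)
  qed
next
  case (ge2 m)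
  show ?case
  proof (cases n)
    case 0
    then show ?thesis using hermite_moment_sym[of "Suc (Suc m)" 0] by (simp add: hermite_moment_0)
  next
    case (Suc k)
    then show ?thesis using hermite_moment_rec[of m k] ge2 by (auto simp: qpoch_Suc)
  qed
qed

section \<open>Growth of the q-Hermite polynomials on [-2, 2]\<close>

definition qh_prod :: "nat \<Rightarrow> real" where
  "qh_prod n = (\<Prod>k<n. 1 + real k * \<bar>q\<bar> ^ k)"

lemma qh_prod_mono: "qh_prod n \<le> qh_prod (Suc n)" "1 \<le> qh_prod n"
proof -
  have "1 \<le> qh_prod n" unfolding qh_prod_def by (intro prod_ge_1) simp
  moreover have "qh_prod (Suc n) = qh_prod n * (1 + real n * \<bar>q\<bar> ^ n)" by (simp add: qh_prod_def)
  ultimately show "qh_prod n \<le> qh_prod (Suc n)" "1 \<le> qh_prod n"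
    by (simp_all add: mult_le_cancel_left1)
qed

text \<open>With \<open>c = z + 1/z\<close> and \<open>|z| = 1\<close> the differences \<open>d\<^sub>n = h\<^sub>n - z h\<^sub>n\<^sub>-\<^sub>1\<close> satisfy
  \<open>d\<^sub>n\<^sub>+\<^sub>1 = d\<^sub>n / z + q\<^sup>n h\<^sub>n\<^sub>-\<^sub>1\<close>, which avoids the factor that a direct estimate of the three-term
  recurrence would lose in every step.\<close>

lemma qh_bound_aux:
  assumes "\<bar>c\<bar> \<le> 2"
  defines "z \<equiv> cis (arccos (c / 2))"
  shows "norm (complex_of_real (qh q (Suc n) c) - z * complex_of_real (qh q n c)) \<le> qh_prod (Suc n)
    \<and> \<bar>qh q n c\<bar> \<le> real (Suc n) * qh_prod n \<and> \<bar>qh q (Suc n) c\<bar> \<le> real (Suc (Suc n)) * qh_prod (Suc n)"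
proof -
  have nz: "norm z = 1" by (simp add: z_def)
  have c: "complex_of_real c = z + cnj z"
    using assms by (simp add: z_def complex_eq_iff abs_le_iff)
  have zz: "z * cnj z = 1" using nz by (simp add: complex_norm_square[symmetric])
  show ?thesis
  proof (induction n)
    case 0
    have "norm (complex_of_real c - z) = 1" unfolding c using nz by simp
    then show ?case using assms qh_prod_mono(2)[of 1] by (simp add: qh_prod_def)
  next
    case (Suc n)
    define P where "P = qh_prod (Suc n)"
    define Q where "Q = qh_prod (Suc (Suc n))"
    have Q: "Q = P * (1 + real (Suc n) * \<bar>q\<bar> ^ Suc n)" by (simp add: P_def Q_def qh_prod_def)
    have PQ: "P \<le> Q" "0 \<le> P" using qh_prod_mono(1)[of "Suc n"] qh_prod_mono(2)[of "Suc n"] by (simp_all add: P_def Q_def)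
    let ?d = "complex_of_real (qh q (Suc n) c) - z * complex_of_real (qh q n c)"
    have "complex_of_real (qh q (Suc (Suc n)) c) - z * complex_of_real (qh q (Suc n) c) =
       cnj z * ?d + complex_of_real (q ^ Suc n * qh q n c)"
    proof -
      have "cnj z * ?d = cnj z * complex_of_real (qh q (Suc n) c) - (z * cnj z) * complex_of_real (qh q n c)"
        by (simp add: algebra_simps)
      then show ?thesis unfolding zz by (simp add: qh.simps(3) c algebra_simps)
    qed
    then have "norm (complex_of_real (qh q (Suc (Suc n)) c) - z * complex_of_real (qh q (Suc n) c))
        \<le> norm (cnj z * ?d) + norm (complex_of_real (q ^ Suc n * qh q n c))"
      by (metis norm_triangle_ineq)
    also have "norm (cnj z * ?d) \<le> P" using Suc nz by (simp add: norm_mult P_def)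
    also have "norm (complex_of_real (q ^ Suc n * qh q n c)) \<le> \<bar>q\<bar> ^ Suc n * (real (Suc n) * P)"
    proof -
      have "\<bar>qh q n c\<bar> \<le> real (Suc n) * P"
        using Suc qh_prod_mono(1)[of n] unfolding P_def
        by (meson order_trans mult_left_mono of_nat_0_le_iff)
      then show ?thesis by (simp only: norm_of_real abs_mult power_abs) (intro mult_left_mono, auto)
    qed
    also have "P + \<bar>q\<bar> ^ Suc n * (real (Suc n) * P) = Q" unfolding Q by (simp add: algebra_simps)
    finally have 1: "norm (complex_of_real (qh q (Suc (Suc n)) c) - z * complex_of_real (qh q (Suc n) c)) \<le> Q" by simp
    have "\<bar>qh q (Suc (Suc n)) c\<bar> = norm (complex_of_real (qh q (Suc (Suc n)) c))" by simp
    also have "\<dots> \<le> norm (complex_of_real (qh q (Suc (Suc n)) c) - z * complex_of_real (qh q (Suc n) c)) + norm (z * complex_of_real (qh q (Suc n) c))"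
      by (metis diff_add_cancel norm_triangle_ineq)
    also have "\<dots> \<le> Q + real (Suc (Suc n)) * P"
      using 1 Suc nz by (simp add: norm_mult P_def)
    also have "\<dots> \<le> Q + real (Suc (Suc n)) * Q" using PQ by (intro add_left_mono mult_left_mono) auto
    also have "\<dots> = real (Suc (Suc (Suc n))) * Q" by (simp add: algebra_simps)
    finally show ?case using 1 Suc by (simp add: Q_def P_def)
  qed
qed

text \<open>The products \<open>qh_prod\<close> stay bounded because the sum of k |q|^k converges,
  so the growth is at most linear, uniformly on [-2, 2].\<close>

lemma qh_bound: "\<exists>K\<ge>0. \<forall>n c. \<bar>c\<bar> \<le> 2 \<longrightarrow> \<bar>qh q n c\<bar> \<le> K * real (Suc n)"
proof -
  have "summable (\<lambda>n. (real (Suc n))\<^sup>2 * \<bar>q\<bar> ^ n)" using abs_q by (intro summable_poly2_geometric) auto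
  then have sm: "summable (\<lambda>k. real k * \<bar>q\<bar> ^ k)"
  proof (rule summable_comparison_test')
    fix n :: nat
    have "real n \<le> (real (Suc n))\<^sup>2" by (simp add: power2_eq_square algebra_simps)
    then show "norm (real n * \<bar>q\<bar> ^ n) \<le> (real (Suc n))\<^sup>2 * \<bar>q\<bar> ^ n"
      by (simp add: abs_mult mult_right_mono)
  qed
  define K where "K = exp (\<Sum>k. real k * \<bar>q\<bar> ^ k)"
  have PK: "qh_prod n \<le> K" for n
  proof -
    have "qh_prod n \<le> (\<Prod>k<n. exp (real k * \<bar>q\<bar> ^ k))"
      unfolding qh_prod_def by (intro prod_mono) auto
    also have "\<dots> = exp (\<Sum>k<n. real k * \<bar>q\<bar> ^ k)" by (simp add: exp_sum)
    also have "\<dots> \<le> K" unfolding K_def exp_le_cancel_iff by (intro sum_le_suminf sm) auto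
    finally show ?thesis .
  qed
  have "\<bar>qh q n c\<bar> \<le> K * real (Suc n)" if "\<bar>c\<bar> \<le> 2" for n c
  proof -
    have "\<bar>qh q n c\<bar> \<le> real (Suc n) * qh_prod n" using qh_bound_aux[OF that, of n] by blast
    also have "\<dots> \<le> real (Suc n) * K" using PK by (intro mult_left_mono) auto
    finally show ?thesis by (simp add: mult.commute)
  qed
  moreover have "K \<ge> 0" by (simp add: K_def)
  ultimately show ?thesis by blast
qed

section \<open>The Poisson-Mehler kernel as a series and as a product\<close>

lemma qpoch_inverse_bound: "\<exists>B. \<forall>n. 1 / qpoch q n \<le> B"
proof -
  have "(\<lambda>n. 1 / qpoch q n) \<longlonglongrightarrow> 1 / qinf"
    by (intro tendsto_intros qpoch_LIMSEQ qinf_nz)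
  then have "Bseq (\<lambda>n. 1 / qpoch q n)" by (intro convergent_imp_Bseq convergentI)
  then obtain B where "\<And>n. norm (1 / qpoch q n) \<le> B" by (elim BseqE) blast
  then show ?thesis by (intro exI[of _ B]) (metis abs_ge_self order_trans real_norm_def)
qed

text \<open>For c = sqrt (1 - q) x and e = sqrt (1 - q) y this equals H_n(x|q) H_n(y|q) / [n]_q!,
  because \<open>qpoch q n\<close> is (1 - q)^n [n]_q! and the powers of 1 - q cancel.\<close>

definition mcoeff :: "real \<Rightarrow> real \<Rightarrow> nat \<Rightarrow> real" where
  "mcoeff c e n = qh q n c * qh q n e / qpoch q n"

lemma mcoeff_bound: "\<exists>K\<ge>0. \<forall>n c e. \<bar>c\<bar> \<le> 2 \<longrightarrow> \<bar>e\<bar> \<le> 2 \<longrightarrow> \<bar>mcoeff c e n\<bar> \<le> K * (real (Suc n))\<^sup>2"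
proof -
  obtain K where K: "K \<ge> 0" "\<And>n c. \<bar>c\<bar> \<le> 2 \<Longrightarrow> \<bar>qh q n c\<bar> \<le> K * real (Suc n)" using qh_bound by blast
  obtain B where B: "\<And>n. 1 / qpoch q n \<le> B" using qpoch_inverse_bound by blast
  have B0: "B \<ge> 0" using B[of 0] by simp
  have "\<bar>mcoeff c e n\<bar> \<le> (K * K * B) * (real (Suc n))\<^sup>2" if "\<bar>c\<bar> \<le> 2" "\<bar>e\<bar> \<le> 2" for n c e
  proof -
    have "\<bar>mcoeff c e n\<bar> = (\<bar>qh q n c\<bar> * \<bar>qh q n e\<bar>) * (1 / qpoch q n)"
      using qpoch_pos[of n] by (simp add: mcoeff_def abs_mult)
    also have "\<dots> \<le> ((K * real (Suc n)) * (K * real (Suc n))) * B"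
      using K that B qpoch_pos[of n] by (intro mult_mono) (auto intro: less_imp_le)
    finally show ?thesis by (simp add: power2_eq_square mult_ac)
  qed
  then show ?thesis using K B0 by (intro exI[of _ "K * K * B"]) auto
qed

lemma mcoeff_summable:
  assumes "\<bar>c\<bar> \<le> 2" "\<bar>e\<bar> \<le> 2" "\<bar>t\<bar> < 1"
  shows "summable (\<lambda>n. mcoeff c e n * t ^ n)"
proof -
  obtain K where K: "\<And>n. \<bar>mcoeff c e n\<bar> \<le> K * (real (Suc n))\<^sup>2" using mcoeff_bound assms by blast
  show ?thesis
  proof (rule summable_comparison_test')
    show "summable (\<lambda>n. K * ((real (Suc n))\<^sup>2 * \<bar>t\<bar> ^ n))"
      using assms by (intro summable_mult summable_poly2_geometric) auto
    show "norm (mcoeff c e n * t ^ n) \<le> K * ((real (Suc n))\<^sup>2 * \<bar>t\<bar> ^ n)" for n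
      using mult_right_mono[OF K[of n], of "\<bar>t\<bar> ^ n"] by (simp only: real_norm_def abs_mult power_abs mult.assoc) simp
  qed
qed

lemma mcoeff_rec_1: "(1 - q) * mcoeff c e (Suc 0) = c * e"
  using pow_Suc_nz[of 0] by (simp add: mcoeff_def qpoch_Suc)

lemma mcoeff_rec_2:
  "(1 - q * q) * mcoeff c e (Suc (Suc 0)) = c * e * mcoeff c e (Suc 0) - (c\<^sup>2 + e\<^sup>2 - 2 + (1 + q))"
  using pow_Suc_nz[of 0] pow_Suc_nz[of 1]
  by (simp add: mcoeff_def qpoch_Suc qh.simps(3) divide_simps) (simp add: power2_eq_square algebra_simps)

text \<open>\<open>mehler_step\<close> divided by (q;q)_(k+2). It is the coefficient of t^(k+3) in
  the functional equation of \<open>mehler\<close>; the \<open>case\<close> is the contribution of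
  index k - 1, absent for \<open>k = 0\<close>.\<close>

lemma mcoeff_rec_3:
  "(1 - q ^ Suc (Suc (Suc k))) * mcoeff c e (Suc (Suc (Suc k))) =
     c * e * mcoeff c e (Suc (Suc k)) - (c\<^sup>2 + e\<^sup>2 - 2 + (1 + q) * q ^ Suc k) * mcoeff c e (Suc k)
     + c * e * mcoeff c e k - (case k of 0 \<Rightarrow> 0 | Suc j \<Rightarrow> (1 - q ^ k) * mcoeff c e j)"
proof -
  define p where "p = q ^ k"
  define P where "P = qpoch q k"
  define u v U V where "u = qh q k c" and "v = qh q (Suc k) c" and "U = qh q k e" and "V = qh q (Suc k) e"
  have nz: "1 - q * p \<noteq> 0" "1 - q * (q * p) \<noteq> 0" "P \<noteq> 0" "1 - q * (q * (q * p)) \<noteq> 0"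
    using pow_Suc_nz[of k] pow_Suc_nz[of "Suc k"] pow_Suc_nz[of "Suc (Suc k)"] by (simp_all add: p_def P_def)
  define h2 g2 where "h2 = c * v - (1 - q * p) * u" and "g2 = e * V - (1 - q * p) * U"
  have h2: "qh q (Suc (Suc k)) c = h2" "qh q (Suc (Suc k)) e = g2"
    by (simp_all add: qh.simps(3) p_def u_def v_def U_def V_def h2_def g2_def)
  have h3: "qh q (Suc (Suc (Suc k))) c = c * h2 - (1 - q * (q * p)) * v"
      "qh q (Suc (Suc (Suc k))) e = e * g2 - (1 - q * (q * p)) * V"
    using h2 by (simp_all add: qh.simps(3)[of q "Suc k"] p_def v_def V_def)
  \<comment> \<open>c u - v is (1 - q^k) times the polynomial of index k - 1; for
    \<open>k = 0\<close> it is c - c = 0.\<close>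
  have last: "(case k of 0 \<Rightarrow> 0 | Suc j \<Rightarrow> (1 - q ^ k) * mcoeff c e j) = (c * u - v) * (e * U - V) / P"
  proof (cases k)
    case 0
    then show ?thesis by (simp add: u_def v_def)
  next
    case (Suc j)
    have *: "c * u - v = (1 - q ^ k) * qh q j c" "e * U - V = (1 - q ^ k) * qh q j e"
      unfolding u_def v_def U_def V_def Suc by (simp_all add: qh.simps(3))
    show ?thesis unfolding * unfolding Suc using pow_Suc_nz[of j] by (simp add: mcoeff_def P_def Suc qpoch_Suc)
  qed
  have m: "mcoeff c e k = u * U / P" "mcoeff c e (Suc k) = v * V / (P * (1 - q * p))"
    "mcoeff c e (Suc (Suc k)) = h2 * g2 / (P * (1 - q * p) * (1 - q * (q * p)))"
    "(1 - q ^ Suc (Suc (Suc k))) * mcoeff c e (Suc (Suc (Suc k))) =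
       (c * h2 - (1 - q * (q * p)) * v) * (e * g2 - (1 - q * (q * p)) * V) / (P * (1 - q * p) * (1 - q * (q * p)))"
    using nz by (simp_all add: mcoeff_def h2 h3 u_def v_def U_def V_def P_def qpoch_Suc p_def)
  have gen: "(x - y * B * w + z * (A * B) * r - A * B * s) / (P * A * B) = x / (P * A * B) - y * (w / (P * A)) + z * (r / P) - s / P"
    if "A \<noteq> 0" "B \<noteq> 0" for x y w z r s A B using that nz(3) by (simp add: field_simps)
  show ?thesis unfolding last m(4) unfolding m(1-3) using mehler_step[of c v q p u e V U]
    unfolding h2_def[symmetric] g2_def[symmetric] using gen[OF nz(1,2), of "c * e * (h2 * g2)" "c\<^sup>2 + e\<^sup>2 - 2 + (1 + q) * (q * p)" "v * V" "c * e" "u * U" "(c * u - v) * (e * U - V)"]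
    by (simp add: p_def)
qed

definition mehler :: "real \<Rightarrow> real \<Rightarrow> real \<Rightarrow> real" where
  "mehler t c e = (\<Sum>n. mcoeff c e n * t ^ n)"

text \<open>Comparison of coefficients: \<open>mehler_fac\<close> is a quartic in \<open>t\<close>,
  the factor on the right is 1 - (1 + q) t^2 + q t^4, and the resulting relations between the
  \<open>mcoeff c e n\<close> are the three recurrences above.\<close>

lemma mehler_functional:
  assumes "\<bar>c\<bar> \<le> 2" "\<bar>e\<bar> \<le> 2" "\<bar>t\<bar> < 1"
  shows "mehler_fac c e t * mehler t c e = (1 - t\<^sup>2) * (1 - q * t\<^sup>2) * mehler (q * t) c e"
proof -
  \<comment> \<open>\<open>sh\<close> delays a sequence by one place with 0 in front and keeps its
    sum, so each side becomes the sum of one sequence. Their terms agree: \<open>n = 0, 1, 2\<close>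
    are initial relations, and \<open>n = Suc (Suc (Suc k))\<close> is
    \<open>mcoeff_rec_3\<close>.\<close>
  define sh where "sh f n = (case n of 0 \<Rightarrow> 0 | Suc m \<Rightarrow> f m)" for f :: "nat \<Rightarrow> real" and n
  have sh: "sh f sums l" if "f sums l" for f l
    using sums_Suc[of "sh f" l] that by (simp add: sh_def)
  define a where "a n = mcoeff c e n * t ^ n" for n
  define b where "b n = mcoeff c e n * (q * t) ^ n" for n
  have "\<bar>q * t\<bar> < 1" using assms abs_q mult_strict_mono[of "\<bar>q\<bar>" 1 "\<bar>t\<bar>" 1] by (simp add: abs_mult)
  then have ab: "a sums mehler t c e" "b sums mehler (q * t) c e"
    unfolding a_def b_def mehler_def using assms by (auto intro!: summable_sums mcoeff_summable)
  have "(\<lambda>n. a n + (- (c * e * t)) * sh a n + ((c\<^sup>2 + e\<^sup>2 - 2) * t\<^sup>2) * sh (sh a) n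
        + (- (c * e * t ^ 3)) * sh (sh (sh a)) n + t ^ 4 * sh (sh (sh (sh a))) n) sums
      (mehler t c e + (- (c * e * t)) * mehler t c e + ((c\<^sup>2 + e\<^sup>2 - 2) * t\<^sup>2) * mehler t c e
        + (- (c * e * t ^ 3)) * mehler t c e + t ^ 4 * mehler t c e)"
    by (intro sums_add sums_mult ab sh)
  also have "(\<lambda>n. a n + (- (c * e * t)) * sh a n + ((c\<^sup>2 + e\<^sup>2 - 2) * t\<^sup>2) * sh (sh a) n
        + (- (c * e * t ^ 3)) * sh (sh (sh a)) n + t ^ 4 * sh (sh (sh (sh a))) n) =
      (\<lambda>n. b n + (- ((1 + q) * t\<^sup>2)) * sh (sh b) n + q * t ^ 4 * sh (sh (sh (sh b))) n)" (is "?f = ?g")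
  proof
    fix n
    consider "n = 0" | "n = Suc 0" | "n = Suc (Suc 0)" | k where "n = Suc (Suc (Suc k))"
      by (metis not0_implies_Suc)
    then show "?f n = ?g n"
    proof cases
      case 1
      then show ?thesis by (simp add: sh_def a_def b_def)
    next
      case 2
      then show ?thesis using arg_cong[OF mcoeff_rec_1[of c e], of "\<lambda>x. x * t"]
        by (simp add: sh_def a_def b_def mcoeff_def[of _ _ 0] algebra_simps)
    next
      case 3
      then show ?thesis using arg_cong[OF mcoeff_rec_2[of c e], of "\<lambda>x. x * t\<^sup>2"]
        by (simp add: sh_def a_def b_def mcoeff_def[of _ _ 0] algebra_simps power2_eq_square)
    next
      case 4
      define l where "l = (case k of 0 \<Rightarrow> 0 | Suc j \<Rightarrow> (1 - q ^ k) * mcoeff c e j)"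
      have l: "t ^ 4 * sh a k - q * t ^ 4 * sh b k = l * t ^ 3 * t ^ k"
        by (cases k) (simp_all add: l_def sh_def a_def b_def power_mult_distrib eval_nat_numeral algebra_simps)
      have r: "mcoeff c e (Suc (Suc (Suc k))) = q ^ Suc (Suc (Suc k)) * mcoeff c e (Suc (Suc (Suc k))) +
          c * e * mcoeff c e (Suc (Suc k)) - (c\<^sup>2 + e\<^sup>2 - 2 + (1 + q) * q ^ Suc k) * mcoeff c e (Suc k)
          + c * e * mcoeff c e k - l"
        using mcoeff_rec_3[of k c e] unfolding l_def by (simp add: algebra_simps)
      have "?f n - ?g n = mcoeff c e (Suc (Suc (Suc k))) * (t ^ 3 * t ^ k)
         - q ^ Suc (Suc (Suc k)) * mcoeff c e (Suc (Suc (Suc k))) * (t ^ 3 * t ^ k)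
         - c * e * mcoeff c e (Suc (Suc k)) * (t ^ 3 * t ^ k)
         + (c\<^sup>2 + e\<^sup>2 - 2 + (1 + q) * q ^ Suc k) * mcoeff c e (Suc k) * (t ^ 3 * t ^ k)
         - c * e * mcoeff c e k * (t ^ 3 * t ^ k) + (t ^ 4 * sh a k - q * t ^ 4 * sh b k)"
        unfolding 4 by (simp add: sh_def a_def b_def power_mult_distrib eval_nat_numeral algebra_simps)
      also have "\<dots> = 0" unfolding l
        using arg_cong[OF r, of "\<lambda>x. x * (t ^ 3 * t ^ k)"] by (simp add: algebra_simps)
      finally show ?thesis by simp
    qed
  qed
  finally have 1: "?g sums (mehler t c e + (- (c * e * t)) * mehler t c e + ((c\<^sup>2 + e\<^sup>2 - 2) * t\<^sup>2) * mehler t c e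
        + (- (c * e * t ^ 3)) * mehler t c e + t ^ 4 * mehler t c e)" .
  have 2: "?g sums (mehler (q * t) c e + (- ((1 + q) * t\<^sup>2)) * mehler (q * t) c e + q * t ^ 4 * mehler (q * t) c e)"
    by (intro sums_add sums_mult ab sh)
  from sums_unique2[OF 1 2] show ?thesis
    unfolding mehler_fac_def by (simp add: algebra_simps eval_nat_numeral)
qed

lemma abs_mult_pow_less_1: "\<bar>t\<bar> < 1 \<Longrightarrow> \<bar>t * q ^ k\<bar> < 1"
  using abs_q mult_le_one[of "\<bar>q\<bar> ^ k" "\<bar>t\<bar>"]
  by (simp add: abs_mult power_abs)
     (metis abs_ge_zero le_less_trans mult_left_le power_le_one less_imp_le)

text \<open>Each use of the functional equation replaces \<open>t\<close> by \<open>q * t\<close>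
  and releases two consecutive factors, 1 - t^2 q^(2N) and 1 - t^2 q^(2N+1); hence
  \<open>2 * N\<close> factors on the right against \<open>N\<close> on the left.\<close>

lemma mehler_iterate:
  assumes "\<bar>c\<bar> \<le> 2" "\<bar>e\<bar> \<le> 2" "\<bar>t\<bar> < 1"
  shows "(\<Prod>k<N. mehler_fac c e (t * q ^ k)) * mehler t c e =
     (\<Prod>k<2 * N. 1 - t\<^sup>2 * q ^ k) * mehler (t * q ^ N) c e"
proof (induction N)
  case (Suc N)
  have "(\<Prod>k<Suc N. mehler_fac c e (t * q ^ k)) * mehler t c e =
     (\<Prod>k<2 * N. 1 - t\<^sup>2 * q ^ k) * (mehler_fac c e (t * q ^ N) * mehler (t * q ^ N) c e)"
    using Suc by (simp add: mult_ac)
  also have "mehler_fac c e (t * q ^ N) * mehler (t * q ^ N) c e =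
      (1 - (t * q ^ N)\<^sup>2) * (1 - q * (t * q ^ N)\<^sup>2) * mehler (t * q ^ Suc N) c e"
    using mehler_functional[OF assms(1,2) abs_mult_pow_less_1[OF assms(3), of N]]
    by (simp add: mult_ac)
  also have "(t * q ^ N)\<^sup>2 = t\<^sup>2 * q ^ (2 * N)"
    by (simp add: power_mult_distrib power_mult[symmetric] mult.commute)
  finally show ?case by (simp add: mult_ac)
qed simp

lemma convergent_numer: "convergent_prod (\<lambda>k. 1 - b * q ^ k)"
  by (rule convergent_prod_near_one[where g = "\<lambda>k. \<bar>b\<bar> * \<bar>q\<bar> ^ k"])
     (use summable_mult[OF summable_abs_pow] in \<open>auto simp: abs_mult power_abs\<close>)

lemma convergent_mehler_fac:
  assumes "\<bar>c\<bar> \<le> 2" "\<bar>e\<bar> \<le> 2" "\<bar>t\<bar> < 1"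
  shows "convergent_prod (\<lambda>k. mehler_fac c e (t * q ^ k))"
proof (rule convergent_prod_near_one)
  fix k
  have "\<bar>t * q ^ k\<bar> \<le> \<bar>q\<bar> ^ k" using assms by (simp add: abs_mult power_abs mult_left_le_one_le)
  then show "\<bar>mehler_fac c e (t * q ^ k) - 1\<bar> \<le> 15 * \<bar>q\<bar> ^ k"
    using mehler_fac_near_one[of "t * q ^ k" c e] abs_mult_pow_less_1[OF assms(3), of k] assms by linarith
qed (intro summable_mult summable_abs_pow)

lemma prodinf_mehler_fac_nz:
  assumes "\<bar>c\<bar> \<le> 2" "\<bar>e\<bar> \<le> 2" "\<bar>t\<bar> < 1"
  shows "prodinf (\<lambda>k. mehler_fac c e (t * q ^ k)) \<noteq> 0"
  using mehler_fac_pos[OF abs_mult_pow_less_1[OF assms(3)] assms(1,2)]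
  by (intro prodinf_nonzero convergent_mehler_fac assms) (simp add: less_imp_neq[symmetric])

text \<open>Let N tend to infinity in \<open>mehler_iterate\<close>: the power series is continuous
  at 0 and has the value \<open>mcoeff c e 0 = 1\<close> there.\<close>

theorem mehler_prod:
  assumes "\<bar>c\<bar> \<le> 2" "\<bar>e\<bar> \<le> 2" "\<bar>t\<bar> < 1"
  shows "mehler t c e = (\<Prod>k. (1 - t\<^sup>2 * q ^ k) / mehler_fac c e (t * q ^ k))"
proof -
  have c0: "isCont (\<lambda>u. \<Sum>n. mcoeff c e n * u ^ n) 0"
    by (rule isCont_powser[OF mcoeff_summable[OF assms(1,2), of "1/2"]]) auto
  have "(\<lambda>N. t * q ^ N) \<longlonglongrightarrow> 0"
    using abs_q by (intro tendsto_mult_right_zero LIMSEQ_power_zero) simp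
  from isCont_tendsto_compose[OF c0 this]
  have lim: "(\<lambda>N. mehler (t * q ^ N) c e) \<longlonglongrightarrow> 1"
    by (simp add: mehler_def powser_zero mcoeff_def[of _ _ 0])
  have "(\<lambda>N. (\<Prod>k<2 * N. 1 - t\<^sup>2 * q ^ k) * mehler (t * q ^ N) c e) \<longlonglongrightarrow> prodinf (\<lambda>k. 1 - t\<^sup>2 * q ^ k) * 1"
    by (intro tendsto_mult lim filterlim_compose[OF convergent_prod_LIMSEQ_lessThan[OF convergent_numer]] filterlim_subseq)
       (simp add: strict_mono_def)
  then have "(\<lambda>N. (\<Prod>k<N. mehler_fac c e (t * q ^ k)) * mehler t c e) \<longlonglongrightarrow> prodinf (\<lambda>k. 1 - t\<^sup>2 * q ^ k)"
    unfolding mehler_iterate[OF assms] by simp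
  moreover have "(\<lambda>N. (\<Prod>k<N. mehler_fac c e (t * q ^ k)) * mehler t c e) \<longlonglongrightarrow>
       prodinf (\<lambda>k. mehler_fac c e (t * q ^ k)) * mehler t c e"
    by (intro tendsto_intros convergent_prod_LIMSEQ_lessThan convergent_mehler_fac assms)
  ultimately have "prodinf (\<lambda>k. mehler_fac c e (t * q ^ k)) * mehler t c e = prodinf (\<lambda>k. 1 - t\<^sup>2 * q ^ k)"
    by (rule LIMSEQ_unique[symmetric])
  then have "mehler t c e = prodinf (\<lambda>k. 1 - t\<^sup>2 * q ^ k) / prodinf (\<lambda>k. mehler_fac c e (t * q ^ k))"
    using prodinf_mehler_fac_nz[OF assms] by (simp add: field_simps)
  also have "\<dots> = (\<Prod>k. (1 - t\<^sup>2 * q ^ k) / mehler_fac c e (t * q ^ k))"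
    by (intro prodinf_divide convergent_numer convergent_mehler_fac assms)
  finally show ?thesis .
qed

lemma mehler_pos:
  assumes "\<bar>c\<bar> \<le> 2" "\<bar>e\<bar> \<le> 2" "\<bar>t\<bar> < 1"
  shows "mehler t c e > 0"
proof -
  let ?f = "\<lambda>k. (1 - t\<^sup>2 * q ^ k) / mehler_fac c e (t * q ^ k)"
  have t2: "\<bar>t\<^sup>2\<bar> < 1" using assms by (simp add: abs_square_less_1)
  have pos: "?f k > 0" for k
    using mehler_fac_pos[OF abs_mult_pow_less_1[OF assms(3), of k] assms(1,2)] abs_mult_pow_less_1[OF t2, of k]
    by (simp add: abs_less_iff)
  have conv: "convergent_prod ?f"
    by (intro convergent_prod_divide convergent_numer convergent_mehler_fac assms)
  have "?f k \<noteq> 0" for k using pos[of k] by (metis less_irrefl)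
  then have "prodinf ?f \<noteq> 0" by (intro prodinf_nonzero conv)
  moreover have "prodinf ?f \<ge> 0"
    by (rule LIMSEQ_le_const[OF convergent_prod_LIMSEQ_lessThan[OF conv]]) (intro exI allI impI prod_nonneg less_imp_le pos)
  ultimately show ?thesis unfolding mehler_prod[OF assms] by simp
qed

section \<open>Integration against the Poisson-Mehler kernel\<close>

lemma mehler_commute: "mehler t c e = mehler t e c"
  by (simp add: mehler_def mcoeff_def mult_ac)

text \<open>\<open>f\<close> is general because two cases are needed: the weight times a polynomial
  for the moments, and the weight times another kernel for the Chapman-Kolmogorov equation. The
  quadratic bound on \<open>mcoeff\<close> makes the integrals of the absolute values
  summable.\<close>

lemma integral_mehler:
  assumes int: "\<And>n. integrable lborel (\<lambda>c. f c * qh q n c)"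
    and out: "\<And>c. \<not> \<bar>c\<bar> \<le> 2 \<Longrightarrow> f c = 0"
    and e: "\<bar>e\<bar> \<le> 2" and t: "\<bar>t\<bar> < 1"
  shows "integrable lborel (\<lambda>c. f c * mehler t c e)"
    and "(LINT c|lborel. f c * mehler t c e) =
       (\<Sum>n. qh q n e / qpoch q n * t ^ n * (LINT c|lborel. f c * qh q n c))"
proof -
  obtain K where K: "K \<ge> 0" "\<And>n c e. \<bar>c\<bar> \<le> 2 \<Longrightarrow> \<bar>e\<bar> \<le> 2 \<Longrightarrow> \<bar>mcoeff c e n\<bar> \<le> K * (real (Suc n))\<^sup>2"
    using mcoeff_bound by blast
  have f: "integrable lborel f" using int[of 0] by simp
  let ?g = "\<lambda>n c. qh q n e / qpoch q n * t ^ n * (f c * qh q n c)"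
  have g: "?g n c = f c * (mcoeff c e n * t ^ n)" for n c by (simp add: mcoeff_def)
  have bnd: "norm (?g n c) \<le> \<bar>f c\<bar> * (K * ((real (Suc n))\<^sup>2 * \<bar>t\<bar> ^ n))" for n c
  proof (cases "\<bar>c\<bar> \<le> 2")
    case True
    have "norm (?g n c) = \<bar>f c\<bar> * (\<bar>mcoeff c e n\<bar> * \<bar>t\<bar> ^ n)" unfolding g by (simp add: abs_mult power_abs)
    also have "\<dots> \<le> \<bar>f c\<bar> * ((K * (real (Suc n))\<^sup>2) * \<bar>t\<bar> ^ n)"
      using K(2)[OF True e] by (intro mult_left_mono mult_right_mono) auto
    finally show ?thesis by (simp add: mult_ac)
  qed (simp add: out)
  have sm: "summable (\<lambda>n. K * ((real (Suc n))\<^sup>2 * \<bar>t\<bar> ^ n))"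
    using t by (intro summable_mult summable_poly2_geometric) auto
  have s: "(\<Sum>n. ?g n c) = f c * mehler t c e" for c
  proof (cases "\<bar>c\<bar> \<le> 2")
    case True
    then show ?thesis unfolding g mehler_def by (intro suminf_mult mcoeff_summable e t)
  qed (simp add: out)
  have 1: "integrable lborel (?g n)" for n by (intro integrable_mult_right int)
  have 2: "AE c in lborel. summable (\<lambda>n. norm (?g n c))"
  proof (intro AE_I2)
    fix c
    show "summable (\<lambda>n. norm (?g n c))"
      by (rule summable_comparison_test'[OF summable_mult[OF sm, of "\<bar>f c\<bar>"], of 0]) (use bnd in simp)
  qed
  have 3: "summable (\<lambda>n. LINT c|lborel. norm (?g n c))"
  proof (rule summable_comparison_test')
    show "summable (\<lambda>n. (LINT c|lborel. \<bar>f c\<bar>) * (K * ((real (Suc n))\<^sup>2 * \<bar>t\<bar> ^ n)))"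
      by (intro summable_mult sm)
    fix n
    have "(LINT c|lborel. norm (?g n c)) \<le> (LINT c|lborel. \<bar>f c\<bar> * (K * ((real (Suc n))\<^sup>2 * \<bar>t\<bar> ^ n)))"
      using bnd by (intro integral_mono integrable_norm 1 integrable_mult_left integrable_abs f) auto
    then show "norm (LINT c|lborel. norm (?g n c)) \<le> (LINT c|lborel. \<bar>f c\<bar>) * (K * ((real (Suc n))\<^sup>2 * \<bar>t\<bar> ^ n))"
      by simp
  qed
  show "integrable lborel (\<lambda>c. f c * mehler t c e)"
    using integrable_suminf[OF 1 2 3] unfolding s .
  show "(LINT c|lborel. f c * mehler t c e) =
       (\<Sum>n. qh q n e / qpoch q n * t ^ n * (LINT c|lborel. f c * qh q n c))"
    using integral_suminf[OF 1 2 3] unfolding s by simp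
qed

text \<open>By orthogonality only the term n = m of the series survives.\<close>

lemma mehler_moment:
  assumes "\<bar>e\<bar> \<le> 2" "\<bar>t\<bar> < 1"
  shows "integrable lborel (\<lambda>c. weight c * mehler t c e * qh q m c)"
    and "(LINT c|lborel. weight c * mehler t c e * qh q m c) = t ^ m * qh q m e"
proof -
  have int: "integrable lborel (\<lambda>c. weight c * qh q m c * qh q n c)" for n
    using integrable_hermite_pair[of m n] by (simp add: mult_ac)
  note I = integral_mehler[OF int _ assms]
  show "integrable lborel (\<lambda>c. weight c * mehler t c e * qh q m c)"
    using I(1) by (simp add: weight_outside mult_ac)
  have "(LINT c|lborel. weight c * mehler t c e * qh q m c) = (LINT c|lborel. weight c * qh q m c * mehler t c e)"
    by (simp add: mult_ac)
  also have "\<dots> = (\<Sum>n. qh q n e / qpoch q n * t ^ n * hermite_moment m n)"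
    using I(2) by (simp add: weight_outside hermite_moment_def mult.assoc)
  also have "\<dots> = (\<Sum>n\<in>{m}. qh q n e / qpoch q n * t ^ n * hermite_moment m n)"
    by (rule suminf_finite) (auto simp: qh_orthogonal)
  finally show "(LINT c|lborel. weight c * mehler t c e * qh q m c) = t ^ m * qh q m e"
    by (simp add: qh_orthogonal)
qed

text \<open>The second kernel is expanded and integrated against the first, whose moments multiply
  the n-th coefficient by s^n; the result is the series with parameter \<open>s * t\<close>.\<close>

lemma mehler_chapman:
  assumes "\<bar>e\<bar> \<le> 2" "\<bar>g\<bar> \<le> 2" "\<bar>s\<bar> < 1" "\<bar>t\<bar> < 1"
  shows "integrable lborel (\<lambda>c. weight c * mehler s c e * mehler t c g)"
    and "(LINT c|lborel. weight c * mehler s c e * mehler t c g) = mehler (s * t) e g"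
proof -
  note I = integral_mehler[OF mehler_moment(1)[OF assms(1,3)] _ assms(2,4)]
  show "integrable lborel (\<lambda>c. weight c * mehler s c e * mehler t c g)"
    by (rule I(1)) (simp add: weight_outside)
  have "(LINT c|lborel. weight c * mehler s c e * mehler t c g) =
     (\<Sum>n. qh q n g / qpoch q n * t ^ n * (s ^ n * qh q n e))"
    by (subst I(2)) (simp_all add: weight_outside mehler_moment(2)[OF assms(1,3)])
  then show "(LINT c|lborel. weight c * mehler s c e * mehler t c g) = mehler (s * t) e g"
    by (simp add: mehler_def mcoeff_def power_mult_distrib mult_ac)
qed

end

section \<open>The kernel of the q-normal chain\<close>

text \<open>The order of the arguments is start, end, opposite to \<open>q_cond_normal\<close>. The
  value 0 off the support, in either variable, replaces meaningless values of
  \<open>q_cond_normal\<close> and makes the Chapman-Kolmogorov equation true for all real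
  \<open>y\<close> and \<open>z\<close>.\<close>

definition q_kernel :: "real \<Rightarrow> real \<Rightarrow> real \<Rightarrow> real \<Rightarrow> real" where
  "q_kernel q r y x = (if x \<in> q_supp q \<and> y \<in> q_supp q then q_cond_normal x y r q else 0)"

context q_disc
begin

lemma q_less_1: "q < 1" and q_ne_1: "q \<noteq> 1"
  using abs_q by auto

definition scale :: real where "scale = sqrt (1 - q)"

lemma scale_pos: "scale > 0" and scale_sq: "scale\<^sup>2 = 1 - q"
  using q_less_1 by (simp_all add: scale_def)

lemma q_supp_iff: "x \<in> q_supp q \<longleftrightarrow> \<bar>scale * x\<bar> \<le> 2"
  using scale_pos q_ne_1 unfolding q_supp_def scale_def[symmetric]
  by (auto simp: abs_le_iff field_simps)

lemma q_int_eq: "(1 - q) * q_int q n = 1 - q ^ n"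
  unfolding q_int_def using q_ne_1 by (simp add: sum_gp_strict)

lemma qh_q_hermite: "qh q n (scale * x) = scale ^ n * q_hermite n x q"
proof (induction n rule: induct_nat_012)
  case (ge2 n)
  have "qh q (Suc (Suc n)) (scale * x) = scale ^ Suc (Suc n) * x * q_hermite (Suc n) x q - (1 - q ^ Suc n) * (scale ^ n * q_hermite n x q)"
    using ge2 by (simp add: qh.simps(3) mult_ac)
  also have "1 - q ^ Suc n = scale * scale * q_int q (Suc n)"
    using q_int_eq[of "Suc n"] scale_sq by (simp add: power2_eq_square)
  finally show ?case by (simp add: algebra_simps)
qed simp_all

text \<open>The factor of index 0 is 4 - c^2. It turns 1 / sqrt (4 - c^2) into the semicircle, and
  the remaining factors are those of \<open>weight\<close>; the outer \<open>scale\<close> is the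
  Jacobian. At the end points both sides are 0, the left one through division by zero.\<close>

lemma q_normal_eq: "q_normal x q = scale * weight (scale * x)"
proof (cases "x \<in> q_supp q")
  case True
  define c where "c = scale * x"
  have c: "\<bar>c\<bar> \<le> 2" using True by (simp add: q_supp_iff c_def)
  define f where "f k = (1 + q ^ k)\<^sup>2 - c\<^sup>2 * q ^ k" for k
  have c2: "(1 - q) * x\<^sup>2 = c\<^sup>2" by (simp add: c_def power_mult_distrib scale_sq)
  have fS: "f (Suc k) = weight_factor c k" for k
    unfolding f_def weight_factor_def by (simp add: power2_eq_square algebra_simps)
  have f0: "f 0 = 4 - c\<^sup>2" by (simp add: f_def)
  have conv: "convergent_prod f"
    using convergent_weight_factor[OF c] fS convergent_prod_iff_shift[of f 1] by simp
  have 1: "q_normal x q = scale / (2 * pi * sqrt (4 - c\<^sup>2)) * prodinf f * qinf"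
    using True q_ne_1 by (simp add: q_normal_def c2 f_def[abs_def] scale_def qinf_def)
  have ind: "indicator {-2..2} c = (1::real)" using c by (auto simp: indicator_def abs_le_iff)
  show ?thesis
  proof (cases "c\<^sup>2 = 4")
    case True
    then show ?thesis unfolding 1 by (simp add: weight_def semicircle_def c_def[symmetric])
  next
    case False
    have c4: "c\<^sup>2 < 4" using False c power_mono[of "\<bar>c\<bar>" 2 2] by simp
    have "prodinf (weight_factor c) = prodinf f / f 0"
      using prodinf_split_head[OF conv] f0 False by (simp add: fS)
    moreover define u where "u = sqrt (4 - c\<^sup>2)"
    ultimately have "prodinf f = u * u * prodinf (weight_factor c)" and u: "u > 0"
      using f0 c4 by simp_all
    then show ?thesis unfolding 1
      by (simp add: weight_def semicircle_def ind c_def[symmetric] u_def[symmetric])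
  qed
next
  case False
  then have "weight (scale * x) = 0" using q_supp_iff weight_outside by blast
  then show ?thesis using False q_ne_1 by (simp add: q_normal_def)
qed

lemma h_factor_eq: "h_factor k x y r q = mehler_fac (scale * x) (scale * y) (r * q ^ k)"
proof -
  have 1: "(r * q ^ k)\<^sup>2 = r\<^sup>2 * q ^ (2 * k)"
    by (simp add: power_mult_distrib power_mult[symmetric] mult.commute)
  have 2: "t * u * (scale * x) * (scale * y) = scale\<^sup>2 * (t * u * x * y)" for t u by (simp add: power2_eq_square)
  have 3: "(scale * x)\<^sup>2 + (scale * y)\<^sup>2 = scale\<^sup>2 * (x\<^sup>2 + y\<^sup>2)" by (simp add: power_mult_distrib algebra_simps)
  show ?thesis unfolding h_factor_def mehler_fac_def 1 2 3 scale_sq by (simp add: mult_ac)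
qed

lemma q_cond_normal_eq:
  assumes "x \<in> q_supp q" "y \<in> q_supp q" "\<bar>r\<bar> < 1"
  shows "q_cond_normal x y r q = scale * (weight (scale * x) * mehler r (scale * x) (scale * y))"
  using mehler_prod[of "scale * x" "scale * y" r] assms q_ne_1
  by (simp add: q_cond_normal_def q_normal_eq h_factor_eq q_supp_iff)

lemma q_kernel_eq:
  assumes "\<bar>r\<bar> < 1"
  shows "q_kernel q r y x = (if x \<in> q_supp q \<and> y \<in> q_supp q
     then scale * (weight (scale * x) * mehler r (scale * x) (scale * y)) else 0)"
  using assms by (simp add: q_kernel_def q_cond_normal_eq)

lemma q_kernel_eq':
  assumes "\<bar>r\<bar> < 1" "y \<in> q_supp q"
  shows "q_kernel q r y x = scale * (weight (scale * x) * mehler r (scale * x) (scale * y))"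
  using assms by (auto simp: q_kernel_eq q_supp_iff weight_outside)

lemma q_kernel_nonneg: "\<bar>r\<bar> < 1 \<Longrightarrow> q_kernel q r y x \<ge> 0"
  using scale_pos weight_nonneg[of "scale * x"] mehler_pos[of "scale * x" "scale * y" r]
  by (auto simp: q_kernel_eq q_supp_iff intro!: mult_nonneg_nonneg)

text \<open>The series form of the kernel is used, since a countable sum of products of polynomials
  is measurable in both variables jointly.\<close>

lemma q_kernel_measurable: "\<bar>r\<bar> < 1 \<Longrightarrow> (\<lambda>(y, x). q_kernel q r y x) \<in> borel_measurable (borel \<Otimes>\<^sub>M borel)"
proof -
  assume r: "\<bar>r\<bar> < 1"
  have "(\<lambda>(y, x). q_kernel q r y x) = (\<lambda>(y, x). if \<bar>scale * x\<bar> \<le> 2 \<and> \<bar>scale * y\<bar> \<le> 2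
     then scale * (weight (scale * x) * (\<Sum>n. mcoeff (scale * x) (scale * y) n * r ^ n)) else 0)"
    by (auto simp: fun_eq_iff q_kernel_eq[OF r] q_supp_iff mehler_def)
  also have "\<dots> \<in> borel_measurable (borel \<Otimes>\<^sub>M borel)"
    unfolding mcoeff_def by measurable
  finally show ?thesis .
qed

lemma has_bochner_integral_rescale:
  assumes "integrable lborel f" "(LINT c|lborel. f c) = l"
  shows "has_bochner_integral lborel (\<lambda>x. scale * f (scale * x)) l"
proof -
  have nz: "scale \<noteq> 0" using scale_pos by simp
  have "integrable lborel (\<lambda>x. scale * f (scale * x))"
    using lborel_integrable_real_affine[OF assms(1) nz, of 0] by simp
  moreover have "(LINT x|lborel. scale * f (scale * x)) = l"
    using lborel_integral_real_affine[OF nz, of f 0] scale_pos assms(2) by simp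
  ultimately show ?thesis by (simp add: has_bochner_integral_iff)
qed

lemma q_kernel_hermite:
  assumes "\<bar>r\<bar> < 1" "y \<in> q_supp q"
  shows "has_bochner_integral lborel (\<lambda>x. q_kernel q r y x * q_hermite n x q) (r ^ n * q_hermite n y q)"
proof -
  have "\<bar>scale * y\<bar> \<le> 2" using assms by (simp add: q_supp_iff)
  from has_bochner_integral_rescale[OF mehler_moment[OF this assms(1), of n]]
  have "has_bochner_integral lborel (\<lambda>x. scale * (weight (scale * x) * mehler r (scale * x) (scale * y) * (scale ^ n * q_hermite n x q)))
     (r ^ n * (scale ^ n * q_hermite n y q))"
    unfolding qh_q_hermite .
  note * = has_bochner_integral_mult_right[OF this, of "inverse (scale ^ n)"]
  have cancel: "inverse (scale ^ n) * (scale * (w * m * (scale ^ n * h))) = scale * (w * m) * h"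
    "inverse (scale ^ n) * (w * (scale ^ n * h)) = w * h" for w m h
    using scale_pos by (simp_all add: field_simps)
  from *[unfolded cancel] show ?thesis by (simp add: q_kernel_eq'[OF assms])
qed

lemma q_kernel_chapman:
  assumes "\<bar>a\<bar> < 1" "\<bar>b\<bar> < 1"
  shows "has_bochner_integral lborel (\<lambda>x. q_kernel q a y x * q_kernel q b x z) (q_kernel q (a * b) y z)"
proof (cases "y \<in> q_supp q \<and> z \<in> q_supp q")
  case True
  then have yz: "\<bar>scale * y\<bar> \<le> 2" "\<bar>scale * z\<bar> \<le> 2" and y: "y \<in> q_supp q" by (simp_all add: q_supp_iff)
  have ab: "\<bar>a * b\<bar> < 1" using assms mult_strict_mono[of "\<bar>a\<bar>" 1 "\<bar>b\<bar>" 1] by (simp add: abs_mult)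
  have eq: "q_kernel q a y x * q_kernel q b x z =
     scale * weight (scale * z) * (scale * (weight (scale * x) * mehler a (scale * x) (scale * y) * mehler b (scale * x) (scale * z)))" for x
    using True assms mehler_commute[of b "scale * x"] by (auto simp: q_kernel_eq q_supp_iff weight_outside)
  from has_bochner_integral_mult_right[OF has_bochner_integral_rescale[OF mehler_chapman[OF yz assms]], of "scale * weight (scale * z)"]
  show ?thesis unfolding eq using True mehler_commute[of "a * b" "scale * y"] by (simp add: q_kernel_eq ab mult_ac)
next
  case False
  then have "(\<lambda>x. q_kernel q a y x * q_kernel q b x z) = (\<lambda>_. 0)" "q_kernel q (a * b) y z = 0"
    by (auto simp: q_kernel_def fun_eq_iff)
  then show ?thesis by (simp add: has_bochner_integral_zero)
qed

text \<open>Bayes' formula, with every infinite product split into numerators \<open>N\<close> and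
  denominators \<open>H\<close>. It is stated multiplicatively because the kernel on the left
  vanishes when \<open>z\<close> is an end point of the support.\<close>

lemma q_bridge_eq:
  assumes "\<bar>a\<bar> < 1" "\<bar>b\<bar> < 1" "y \<in> q_supp q" "z \<in> q_supp q"
  shows "q_bridge x y z a b q * q_kernel q (a * b) y z = q_kernel q a y x * q_kernel q b x z"
proof (cases "x \<in> q_supp q")
  case False
  then show ?thesis using q_ne_1 by (auto simp: q_bridge_def q_kernel_def q_normal_def)
next
  case True
  have ab: "\<bar>a * b\<bar> < 1" using assms mult_strict_mono[of "\<bar>a\<bar>" 1 "\<bar>b\<bar>" 1] by (simp add: abs_mult)
  define H where "H u v t = (\<Prod>k. h_factor k u v t q)" for u v t
  define N where "N t = (\<Prod>k. 1 - t\<^sup>2 * q ^ k)" for t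
  have Hc: "convergent_prod (\<lambda>k. h_factor k u v t q)" and Hnz: "H u v t \<noteq> 0"
    if "u \<in> q_supp q" "v \<in> q_supp q" "\<bar>t\<bar> < 1" for u v t
    using convergent_mehler_fac[of "scale * u" "scale * v" t] prodinf_mehler_fac_nz[of "scale * u" "scale * v" t] that
    by (simp_all add: H_def h_factor_eq q_supp_iff)
  have Hsym: "H u v t = H v u t" for u v t
    by (simp add: H_def h_factor_def mult_ac add.commute)
  have Nnz: "N t \<noteq> 0" if "\<bar>t\<bar> < 1" for t
    unfolding N_def
  proof (rule prodinf_nonzero[OF convergent_numer])
    fix k have "\<bar>t\<^sup>2\<bar> < 1" using that by (simp add: abs_square_less_1)
    from abs_mult_pow_less_1[OF this, of k] show "1 - t\<^sup>2 * q ^ k \<noteq> 0" by auto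
  qed
  have k: "q_kernel q t u v = q_normal v q * (N t / H v u t)"
    if "u \<in> q_supp q" "v \<in> q_supp q" "\<bar>t\<bar> < 1" for u v t
    using that q_ne_1 prodinf_divide[OF convergent_numer[of "t\<^sup>2"] Hc[of v u t]]
    by (simp add: q_kernel_def q_cond_normal_def N_def H_def)
  have bc: "q_bridge_const a b q = N a * N b / N (a * b)"
    unfolding q_bridge_const_def N_def
    by (simp add: prodinf_mult prodinf_divide convergent_numer convergent_prod_mult power_mult_distrib)
  have bp: "(\<Prod>l. h_factor l y z (a * b) q / (h_factor l x y a q * h_factor l x z b q)) = H y z (a * b) / (H x y a * H x z b)"
    unfolding H_def using assms True ab by (simp add: prodinf_mult prodinf_divide Hc convergent_prod_mult)
  show ?thesis
    unfolding q_bridge_def bc bp using q_ne_1 assms True ab Nnz[OF ab] Hnz[of y z "a * b"]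
    by (simp add: k Hsym[of z y] Hsym[of z x])
qed

end

section \<open>The Gaussian case\<close>

lemma one_minus_sq_pos: "\<bar>r\<bar> < 1 \<Longrightarrow> 1 - r\<^sup>2 > (0::real)"
  by (simp add: abs_square_less_1)

lemma q_kernel_1: "q_kernel 1 r y x = normal_density (r * y) (sqrt (1 - r\<^sup>2)) x"
  by (simp add: q_kernel_def q_supp_def q_cond_normal_def)

text \<open>Completing the square in \<open>x\<close>. \<open>A\<close>, \<open>B\<close> and
  \<open>C\<close> are the variances of the three kernels, and \<open>A * B / C\<close> is that of
  the bridge.\<close>

lemma normal_bridge:
  assumes "\<bar>a\<bar> < 1" "\<bar>b\<bar> < 1"
  shows "q_bridge x y z a b 1 * q_kernel 1 (a * b) y z = q_kernel 1 a y x * q_kernel 1 b x z"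
proof -
  define A B C where "A = 1 - a\<^sup>2" and "B = 1 - b\<^sup>2" and "C = 1 - a\<^sup>2 * b\<^sup>2"
  have "\<bar>a * b\<bar> < 1" using assms mult_strict_mono[of "\<bar>a\<bar>" 1 "\<bar>b\<bar>" 1] by (simp add: abs_mult)
  then have pos: "A > 0" "B > 0" "C > 0"
    using assms one_minus_sq_pos[of a] one_minus_sq_pos[of b] one_minus_sq_pos[of "a * b"]
    by (simp_all add: A_def B_def C_def power_mult_distrib)
  have C: "C = 1 - (1 - A) * (1 - B)" by (simp add: A_def B_def C_def)
  let ?m = "(a * B * y + b * A * z) / C"
  have ex: "- (x - ?m)\<^sup>2 / (2 * (A * B / C)) + - (z - a * b * y)\<^sup>2 / (2 * C)
      = - (x - a * y)\<^sup>2 / (2 * A) + - (z - b * x)\<^sup>2 / (2 * B)"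
  proof -
    have "B * C * (x - a * y)\<^sup>2 + A * C * (z - b * x)\<^sup>2 = (C * x - (a * B * y + b * A * z))\<^sup>2 + A * B * (z - a * b * y)\<^sup>2"
      unfolding A_def B_def C_def by algebra
    also have "(C * x - (a * B * y + b * A * z))\<^sup>2 = C\<^sup>2 * (x - ?m)\<^sup>2"
      using pos by (simp add: power_mult_distrib[symmetric] right_diff_distrib)
    finally have e: "B * C * (x - a * y)\<^sup>2 + A * C * (z - b * x)\<^sup>2 = C\<^sup>2 * (x - ?m)\<^sup>2 + A * B * (z - a * b * y)\<^sup>2" .
    have "- u / (2 * (A * B / C)) + - v / (2 * C) = - w / (2 * A) + - t / (2 * B)"
      if "B * C * w + A * C * t = C\<^sup>2 * u + A * B * v" for u v w t
    proof -
      have "- w / (2 * A) + - t / (2 * B) = - (B * C * w + A * C * t) / (2 * A * B * C)"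
        using pos by (simp add: field_simps)
      also have "\<dots> = - u / (2 * (A * B / C)) + - v / (2 * C)"
        unfolding that using pos by (simp add: field_simps power2_eq_square)
      finally show ?thesis by simp
    qed
    from this[OF e] show ?thesis .
  qed
  have co: "1 / sqrt (2 * pi * (A * B / C)) * (1 / sqrt (2 * pi * C)) = 1 / sqrt (2 * pi * A) * (1 / sqrt (2 * pi * B))"
    using pos by (simp add: real_sqrt_mult real_sqrt_divide)
  have sq: "(sqrt (A * B / C))\<^sup>2 = A * B / C" "(sqrt A)\<^sup>2 = A" "(sqrt B)\<^sup>2 = B" "(sqrt C)\<^sup>2 = C"
    using pos by simp_all
  have "q_bridge x y z a b 1 * q_kernel 1 (a * b) y z =
     (1 / sqrt (2 * pi * (A * B / C)) * (1 / sqrt (2 * pi * C))) * (exp (- (x - ?m)\<^sup>2 / (2 * (A * B / C))) * exp (- (z - a * b * y)\<^sup>2 / (2 * C)))"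
    unfolding q_kernel_1 q_bridge_def A_def[symmetric] B_def[symmetric] C_def[symmetric] normal_density_def power_mult_distrib if_True simp_thms
    unfolding sq by (simp add: mult_ac)
  also have "\<dots> = (1 / sqrt (2 * pi * A) * (1 / sqrt (2 * pi * B))) * (exp (- (x - a * y)\<^sup>2 / (2 * A)) * exp (- (z - b * x)\<^sup>2 / (2 * B)))"
    unfolding co exp_add[symmetric] ex ..
  also have "\<dots> = q_kernel 1 a y x * q_kernel 1 b x z"
    unfolding q_kernel_1 A_def[symmetric] B_def[symmetric] normal_density_def sq by (simp add: mult_ac)
  finally show ?thesis .
qed

text \<open>The bridge is a normal density and integrates to 1, so it suffices to integrate
  \<open>normal_bridge\<close> over \<open>x\<close>.\<close>

lemma normal_chapman:
  assumes "\<bar>a\<bar> < 1" "\<bar>b\<bar> < 1"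
  shows "has_bochner_integral lborel (\<lambda>x. q_kernel 1 a y x * q_kernel 1 b x z) (q_kernel 1 (a * b) y z)"
proof -
  have ab: "\<bar>a * b\<bar> < 1" using assms mult_strict_mono[of "\<bar>a\<bar>" 1 "\<bar>b\<bar>" 1] by (simp add: abs_mult)
  have "sqrt ((1 - a\<^sup>2) * (1 - b\<^sup>2) / (1 - a\<^sup>2 * b\<^sup>2)) > 0"
    using one_minus_sq_pos[OF assms(1)] one_minus_sq_pos[OF assms(2)] one_minus_sq_pos[OF ab]
    by (simp add: power_mult_distrib)
  then have "has_bochner_integral lborel (\<lambda>x. q_bridge x y z a b 1) 1"
    by (simp add: q_bridge_def has_bochner_integral_iff)
  from has_bochner_integral_mult_left[OF this, of "q_kernel 1 (a * b) y z"]
  show ?thesis unfolding normal_bridge[OF assms] by simp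
qed

section \<open>Hermite moments of the normal law\<close>

lemma normal_moment_rec:
  assumes "\<sigma> > 0"
  shows "(LINT x|lborel. normal_density \<mu> \<sigma> x * (x - \<mu>) ^ Suc (Suc k)) =
     \<sigma>\<^sup>2 * real (Suc k) * (LINT x|lborel. normal_density \<mu> \<sigma> x * (x - \<mu>) ^ k)"
proof (cases "even k")
  case True
  then obtain j where k: "k = 2 * j" by (elim evenE)
  have 1: "(LINT x|lborel. normal_density \<mu> \<sigma> x * (x - \<mu>) ^ (2 * i)) = fact (2 * i) / ((2 / \<sigma>\<^sup>2) ^ i * fact i)" for i
    using has_bochner_integral_integral_eq[OF normal_moment_even[OF assms, of \<mu>]] .
  have "Suc (Suc k) = 2 * Suc j" by (simp add: k)
  have f: "fact (2 * Suc j) = 2 * real (Suc j) * real (Suc k) * fact (2 * j)" "fact (Suc j) = real (Suc j) * fact j"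
    by (simp_all add: k algebra_simps)
  have "2 * s * t * F / ((2 / v) ^ Suc j * (s * G)) = v * t * (F / ((2 / v) ^ j * G))"
    if "s \<noteq> 0" "v \<noteq> 0" for s t v F G :: real
    using that by (cases "G = 0") (simp_all add: field_simps)
  from this[of "real (Suc j)" "\<sigma>\<^sup>2" "real (Suc k)" "fact (2 * j)" "fact j"]
  show ?thesis unfolding \<open>Suc (Suc k) = 2 * Suc j\<close> 1 unfolding k 1 unfolding f
    using assms by (simp add: k)
next
  case False
  then obtain j where k: "k = 2 * j + 1" by (elim oddE)
  have 1: "(LINT x|lborel. normal_density \<mu> \<sigma> x * (x - \<mu>) ^ (2 * i + 1)) = 0" for i
    using has_bochner_integral_integral_eq[OF normal_moment_odd[OF assms, of \<mu>]] .
  have "Suc (Suc k) = 2 * Suc j + 1" by (simp add: k)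
  show ?thesis unfolding \<open>Suc (Suc k) = 2 * Suc j + 1\<close> unfolding k 1 by simp
qed

lemma q_hermite_1_rec:
  "q_hermite (Suc (Suc n)) x 1 = x * q_hermite (Suc n) x 1 - real (Suc n) * q_hermite n x 1"
  by (simp add: q_int_def)

declare q_hermite.simps(3) [simp del]

context
  fixes \<mu> \<sigma> :: real
  assumes \<sigma>: "\<sigma> > 0"
begin

lemma integrable_normal_hermite:
  "integrable lborel (\<lambda>x. normal_density \<mu> \<sigma> x * (q_hermite n x 1 * (x - \<mu>) ^ k))"
proof (induction n arbitrary: k rule: induct_nat_012)
  case 0
  then show ?case using integrable_normal_moment[OF \<sigma>] by simp
next
  case 1
  have "normal_density \<mu> \<sigma> x * (q_hermite (Suc 0) x 1 * (x - \<mu>) ^ k) =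
     normal_density \<mu> \<sigma> x * (x - \<mu>) ^ Suc k + \<mu> * (normal_density \<mu> \<sigma> x * (x - \<mu>) ^ k)" for x
    by (simp add: algebra_simps)
  then show ?case
    using integrable_normal_moment[OF \<sigma>, of \<mu>] by (simp del: power_Suc)
next
  case (ge2 n)
  have "normal_density \<mu> \<sigma> x * (q_hermite (Suc (Suc n)) x 1 * (x - \<mu>) ^ k) =
     normal_density \<mu> \<sigma> x * (q_hermite (Suc n) x 1 * (x - \<mu>) ^ Suc k)
     + \<mu> * (normal_density \<mu> \<sigma> x * (q_hermite (Suc n) x 1 * (x - \<mu>) ^ k))
     - real (Suc n) * (normal_density \<mu> \<sigma> x * (q_hermite n x 1 * (x - \<mu>) ^ k))" for x
    unfolding q_hermite_1_rec by (simp add: algebra_simps)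
  then show ?case
    using ge2 by (simp del: power_Suc of_nat_Suc)
qed

text \<open>The second index is there because the Hermite recurrence multiplies by x = (x - \<mu>) +
  \<mu>, which raises the central power; only \<open>k = 0\<close> is wanted in the end.\<close>

definition gauss_hermite :: "nat \<Rightarrow> nat \<Rightarrow> real" where
  "gauss_hermite n k = (LINT x|lborel. normal_density \<mu> \<sigma> x * (q_hermite n x 1 * (x - \<mu>) ^ k))"

lemma gauss_hermite_1: "gauss_hermite (Suc 0) k = gauss_hermite 0 (Suc k) + \<mu> * gauss_hermite 0 k"
proof -
  have "gauss_hermite (Suc 0) k = (LINT x|lborel. normal_density \<mu> \<sigma> x * (q_hermite 0 x 1 * (x - \<mu>) ^ Suc k)
      + \<mu> * (normal_density \<mu> \<sigma> x * (q_hermite 0 x 1 * (x - \<mu>) ^ k)))"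
    unfolding gauss_hermite_def by (intro Bochner_Integration.integral_cong refl) (simp add: algebra_simps)
  also have "\<dots> = gauss_hermite 0 (Suc k) + \<mu> * gauss_hermite 0 k"
    unfolding gauss_hermite_def by (simp add: integrable_normal_hermite del: power_Suc q_hermite.simps)
  finally show ?thesis .
qed

lemma gauss_hermite_rec: "gauss_hermite (Suc (Suc n)) k = gauss_hermite (Suc n) (Suc k) + \<mu> * gauss_hermite (Suc n) k - real (Suc n) * gauss_hermite n k"
proof -
  have "gauss_hermite (Suc (Suc n)) k = (LINT x|lborel. normal_density \<mu> \<sigma> x * (q_hermite (Suc n) x 1 * (x - \<mu>) ^ Suc k)
     + \<mu> * (normal_density \<mu> \<sigma> x * (q_hermite (Suc n) x 1 * (x - \<mu>) ^ k))
     - real (Suc n) * (normal_density \<mu> \<sigma> x * (q_hermite n x 1 * (x - \<mu>) ^ k)))"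
    unfolding gauss_hermite_def q_hermite_1_rec by (intro Bochner_Integration.integral_cong refl) (simp add: algebra_simps)
  also have "\<dots> = gauss_hermite (Suc n) (Suc k) + \<mu> * gauss_hermite (Suc n) k - real (Suc n) * gauss_hermite n k"
    unfolding gauss_hermite_def by (simp add: integrable_normal_hermite del: power_Suc q_hermite.simps of_nat_Suc)
  finally show ?thesis .
qed

text \<open>For \<open>k = 0\<close> the truncated \<open>k - 1\<close> is harmless, being
  multiplied by 0; the left-hand side is then the vanishing first central moment.\<close>

lemma gauss_hermite_0_Suc: "gauss_hermite 0 (Suc k) = \<sigma>\<^sup>2 * (real k * gauss_hermite 0 (k - 1))"
proof (cases k)
  case 0
  then show ?thesis using integral_normal_moment_odd[OF \<sigma>, of \<mu> 0] by (simp add: gauss_hermite_def)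
next
  case (Suc j)
  then show ?thesis using normal_moment_rec[OF \<sigma>, of \<mu> j] by (simp add: gauss_hermite_def)
qed

text \<open>Gaussian integration by parts, with the derivative rule
  \<open>H\<^sub>n' = n H\<^sub>n\<^sub>-\<^sub>1\<close> already applied.\<close>

lemma gauss_hermite_Suc: "gauss_hermite n (Suc k) = \<sigma>\<^sup>2 * (real n * gauss_hermite (n - 1) k + real k * gauss_hermite n (k - 1))"
proof (induction n arbitrary: k rule: induct_nat_012)
  case 0
  then show ?case using gauss_hermite_0_Suc by simp
next
  case 1
  have "real k * gauss_hermite (Suc 0) (k - 1) = real k * (gauss_hermite 0 k + \<mu> * gauss_hermite 0 (k - 1))"
    using gauss_hermite_1[of "k - 1"] by (cases k) auto
  then show ?case using gauss_hermite_1[of "Suc k"] gauss_hermite_0_Suc[of k] gauss_hermite_0_Suc[of "Suc k"] by (simp add: algebra_simps)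
next
  case (ge2 n)
  have 1: "real k * gauss_hermite (Suc (Suc n)) (k - 1) =
      real k * (gauss_hermite (Suc n) k + \<mu> * gauss_hermite (Suc n) (k - 1) - real (Suc n) * gauss_hermite n (k - 1))"
    using gauss_hermite_rec[of n "k - 1"] by (cases k) auto
  have 2: "gauss_hermite (Suc n) k = gauss_hermite n (Suc k) + \<mu> * gauss_hermite n k - real n * gauss_hermite (n - 1) k"
    using gauss_hermite_1[of k] gauss_hermite_rec[of "n - 1" k] by (cases n) auto
  have "gauss_hermite (Suc (Suc n)) (Suc k) = \<sigma>\<^sup>2 * (real (Suc n) * gauss_hermite n (Suc k) + real (Suc k) * gauss_hermite (Suc n) k)
     + \<mu> * (\<sigma>\<^sup>2 * (real (Suc n) * gauss_hermite n k + real k * gauss_hermite (Suc n) (k - 1)))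
     - real (Suc n) * (\<sigma>\<^sup>2 * (real n * gauss_hermite (n - 1) k + real k * gauss_hermite n (k - 1)))"
    using gauss_hermite_rec[of n "Suc k"] ge2(2)[of "Suc k"] ge2(2)[of k] ge2(1)[of k] by simp
  also have "\<dots> = \<sigma>\<^sup>2 * (real (Suc n) * (gauss_hermite n (Suc k) + \<mu> * gauss_hermite n k - real n * gauss_hermite (n - 1) k) + gauss_hermite (Suc n) k
     + real k * (gauss_hermite (Suc n) k + \<mu> * gauss_hermite (Suc n) (k - 1) - real (Suc n) * gauss_hermite n (k - 1)))"
    by (simp add: algebra_simps)
  also have "\<dots> = \<sigma>\<^sup>2 * (real (Suc (Suc n)) * gauss_hermite (Suc n) k + real k * gauss_hermite (Suc (Suc n)) (k - 1))"
    unfolding 1 2[symmetric] by (simp add: algebra_simps)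
  finally show ?case by simp
qed

end

text \<open>Integration by parts turns the mean of H_(n+2) into r y times that of H_(n+1) minus (n +
  1)(1 - \<sigma>^2) times that of H_n. Since 1 - \<sigma>^2 = r^2, this is the recurrence of r^n
  H_n(y).\<close>

lemma normal_kernel_hermite:
  assumes "\<bar>r\<bar> < 1"
  shows "has_bochner_integral lborel (\<lambda>x. q_kernel 1 r y x * q_hermite n x 1) (r ^ n * q_hermite n y 1)"
proof -
  define \<sigma> where "\<sigma> = sqrt (1 - r\<^sup>2)"
  have \<sigma>: "\<sigma> > 0" and \<sigma>2: "\<sigma>\<^sup>2 = 1 - r\<^sup>2"
    using one_minus_sq_pos[OF assms] by (simp_all add: \<sigma>_def)
  let ?gauss_hermite = "gauss_hermite (r * y) \<sigma>"
  have 0: "?gauss_hermite 0 0 = 1" using \<sigma> by (simp add: gauss_hermite_def[OF \<sigma>])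
  have "?gauss_hermite n 0 = r ^ n * q_hermite n y 1"
  proof (induction n rule: induct_nat_012)
    case 1
    then show ?case using 0 gauss_hermite_1[OF \<sigma>, of "r * y" 0] gauss_hermite_0_Suc[OF \<sigma>, of "r * y" 0] by simp
  next
    case (ge2 n)
    have "?gauss_hermite (Suc (Suc n)) 0 = \<sigma>\<^sup>2 * (real (Suc n) * ?gauss_hermite n 0) + r * y * ?gauss_hermite (Suc n) 0 - real (Suc n) * ?gauss_hermite n 0"
      using gauss_hermite_rec[OF \<sigma>, of "r * y" n 0] gauss_hermite_Suc[OF \<sigma>, of "r * y" "Suc n" 0] by simp
    also have "\<dots> = r ^ Suc (Suc n) * (y * q_hermite (Suc n) y 1 - real (Suc n) * q_hermite n y 1)"
      unfolding \<sigma>2 ge2 by (simp add: algebra_simps power2_eq_square)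
    finally show ?case unfolding q_hermite_1_rec .
  qed (simp add: 0)
  then show ?thesis
    using integrable_normal_hermite[OF \<sigma>, of "r * y" n 0]
    by (simp add: has_bochner_integral_iff gauss_hermite_def[OF \<sigma>] q_kernel_1 \<sigma>_def[symmetric])
qed

section \<open>Markov chains with densities\<close>

lemma borel_measurable_PiM_lborel:
  "borel_measurable (Pi\<^sub>M I (\<lambda>_. lborel :: real measure)) = borel_measurable (Pi\<^sub>M I (\<lambda>_. borel))"
  by (intro measurable_cong_sets sets_PiM_cong) auto

lemma measurable_pair_compose:
  assumes "(\<lambda>(z, x). u z x) \<in> measurable (A \<Otimes>\<^sub>M B) C" "f \<in> measurable N A" "g \<in> measurable N B"
  shows "(\<lambda>w. u (f w) (g w)) \<in> measurable N C"
  using measurable_compose[OF measurable_Pair[OF assms(2,3)] assms(1)] by simp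

lemma last_eq_Max:
  fixes L :: "'a :: linorder list"
  assumes "sorted_wrt (<) L" "L \<noteq> []"
  shows "last L = Max (set L)"
proof -
  obtain xs x where L: "L = xs @ [x]" using assms(2) by (cases L rule: rev_cases) auto
  then have "\<forall>y\<in>set xs. y < x" using assms(1) by (simp add: sorted_wrt_append)
  then have "x = Max (set L)" unfolding L by (intro Max_eqI[symmetric]) auto
  then show ?thesis by (simp add: L)
qed

text \<open>Density of a path that starts with value \<open>y\<close> at time \<open>a\<close> and
  visits the listed times. A list shows which times are consecutive, so deleting a time amounts to
  replacing two factors by one.\<close>

fun chain_density :: "(nat \<Rightarrow> nat \<Rightarrow> real \<Rightarrow> real \<Rightarrow> ennreal) \<Rightarrow> nat \<Rightarrow> real \<Rightarrow> nat list \<Rightarrow> (nat \<Rightarrow> real) \<Rightarrow> ennreal" where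
  "chain_density p a y [] z = 1"
| "chain_density p a y (b # bs) z = p a b y (z b) * chain_density p b (z b) bs z"

lemma chain_density_append:
  "chain_density p a y (xs @ ys) z =
     chain_density p a y xs z * chain_density p (last (a # xs)) (if xs = [] then y else z (last xs)) ys z"
  by (induction xs arbitrary: a y) (auto simp: mult.assoc)

lemma chain_density_cong:
  "(\<And>i. i \<in> set xs \<Longrightarrow> z i = z' i) \<Longrightarrow> chain_density p a y xs z = chain_density p a y xs z'"
  by (induction xs arbitrary: a y) auto

text \<open>Mass 1 is demanded only for starting points in the support, because the intended kernels
  vanish elsewhere, whereas Chapman-Kolmogorov is demanded at all points.\<close>

locale chain_kernels =
  fixes p :: "nat \<Rightarrow> nat \<Rightarrow> real \<Rightarrow> real \<Rightarrow> ennreal" and S :: "nat \<Rightarrow> real set"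
  assumes p_measurable: "a < b \<Longrightarrow> (\<lambda>(y, x). p a b y x) \<in> borel_measurable (borel \<Otimes>\<^sub>M borel)"
    and p_outside: "a < b \<Longrightarrow> x \<notin> S b \<Longrightarrow> p a b y x = 0"
    and p_finite: "a < b \<Longrightarrow> p a b y x < \<top>"
    and p_mass: "a < b \<Longrightarrow> y \<in> S a \<Longrightarrow> (\<integral>\<^sup>+x. p a b y x \<partial>lborel) = 1"
    and p_chapman: "a < b \<Longrightarrow> b < c \<Longrightarrow> (\<integral>\<^sup>+x. p a b y x * p b c x z \<partial>lborel) = p a c y z"
    and S_borel: "S a \<in> sets borel"
begin

lemma p_measurable_compose:
  assumes "a < b" "f \<in> measurable N borel" "g \<in> measurable N borel"
  shows "(\<lambda>z. p a b (f z) (g z)) \<in> borel_measurable N"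
  using measurable_compose[OF measurable_Pair[OF assms(2,3)] p_measurable[OF assms(1)]] by simp

lemma p_measurable_snd: "a < b \<Longrightarrow> p a b y \<in> borel_measurable lborel"
  using measurable_compose_Pair1[OF _ p_measurable, of y a b] by simp

lemma p_measurable_fst: "a < b \<Longrightarrow> (\<lambda>y. p a b y x) \<in> borel_measurable lborel"
  by (simp only: measurable_lborel2) (rule p_measurable_compose; simp)

lemma chain_density_measurable:
  assumes "sorted_wrt (<) (a # xs)" "f \<in> measurable N borel" "\<And>i. i \<in> set xs \<Longrightarrow> (\<lambda>w. g w i) \<in> measurable N borel"
  shows "(\<lambda>w. chain_density p a (f w) xs (g w)) \<in> borel_measurable N"
  using assms
proof (induction xs arbitrary: a f)
  case (Cons b bs)
  then show ?case
    by (auto intro!: borel_measurable_times_ennreal p_measurable_compose)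
qed simp

lemma chain_density_outside:
  assumes "sorted_wrt (<) (a # xs)" "c \<in> set xs" "z c \<notin> S c"
  shows "chain_density p a y xs z = 0"
  using assms
proof (induction xs arbitrary: a y)
  case (Cons b bs)
  then show ?case by (cases "c = b") (auto simp: p_outside)
qed simp

text \<open>If \<open>b\<close> is the last time, its factor integrates to 1; otherwise the two
  factors around \<open>b\<close> merge by Chapman-Kolmogorov. The restriction expresses that the
  test function does not see the coordinate \<open>b\<close>.\<close>

lemma chain_density_eliminate:
  assumes sorted: "sorted_wrt (<) (a # xs @ b # ys)" and y: "y \<in> S a"
    and F: "F \<in> borel_measurable (Pi\<^sub>M (set (xs @ ys)) (\<lambda>_. borel))"
  shows "(\<integral>\<^sup>+z. chain_density p a y (xs @ b # ys) z * F (restrict z (set (xs @ ys))) \<partial>Pi\<^sub>M (set (xs @ b # ys)) (\<lambda>_. lborel)) =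
     (\<integral>\<^sup>+z. chain_density p a y (xs @ ys) z * F z \<partial>Pi\<^sub>M (set (xs @ ys)) (\<lambda>_. lborel))"
proof -
  interpret product_sigma_finite "\<lambda>_::nat. lborel :: real measure"
    by unfold_locales
  define I where "I = set (xs @ ys)"
  have ins: "set (xs @ b # ys) = insert b I" and bI: "b \<notin> I" and finI: "finite I"
    using sorted by (auto simp: I_def sorted_wrt_append)
  have mz: "(\<lambda>z. z i) \<in> measurable (Pi\<^sub>M (insert b I) (\<lambda>_. borel)) borel" if "i \<in> insert b I" for i
    using that by (rule measurable_component_singleton)
  have meas: "(\<lambda>z. chain_density p a y (xs @ b # ys) z * F (restrict z I)) \<in> borel_measurable (Pi\<^sub>M (insert b I) (\<lambda>_. lborel))"
    unfolding borel_measurable_PiM_lborel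
  proof (rule borel_measurable_times_ennreal)
    show "chain_density p a y (xs @ b # ys) \<in> borel_measurable (Pi\<^sub>M (insert b I) (\<lambda>_. borel))"
      by (rule chain_density_measurable[OF sorted, of "\<lambda>_. y" _ "\<lambda>z. z"]) (auto intro!: mz simp: I_def)
    show "(\<lambda>z. F (restrict z I)) \<in> borel_measurable (Pi\<^sub>M (insert b I) (\<lambda>_. borel))"
      using measurable_compose[OF measurable_restrict_subset F, of "insert b I"] by (auto simp: I_def)
  qed
  define l where "l = last (a # xs)"
  define w where "w z = (if xs = [] then y else z (last xs))" for z :: "nat \<Rightarrow> real"
  have lb: "l < b" using sorted by (auto simp: l_def sorted_wrt_append)
  have sxs: "sorted_wrt (<) (a # xs)" using sorted by (auto simp: sorted_wrt_append)
  have inner: "(\<integral>\<^sup>+x. chain_density p a y (xs @ b # ys) (z(b := x)) * F (restrict (z(b := x)) I) \<partial>lborel)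
      = chain_density p a y (xs @ ys) z * F z"
    if "z \<in> space (Pi\<^sub>M I (\<lambda>_. lborel :: real measure))" for z
  proof -
    have r: "restrict (z(b := x)) I = z" for x
      using that bI by (auto simp: space_PiM PiE_def extensional_def restrict_def fun_eq_iff)
    have d1: "chain_density p a y xs (z(b := x)) = chain_density p a y xs z" for x
      using bI by (intro chain_density_cong) (auto simp: I_def)
    have d2: "chain_density p b x ys (z(b := x)) = chain_density p b x ys z" for x
      using bI by (intro chain_density_cong) (auto simp: I_def)
    have w: "w (z(b := x)) = w z" for x
      using bI by (auto simp: w_def I_def)
    have eq: "chain_density p a y (xs @ b # ys) (z(b := x)) = chain_density p a y xs z * (p l b (w z) x * chain_density p b x ys z)" for x
    proof -
      have "chain_density p a y (xs @ b # ys) (z(b := x)) =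
          chain_density p a y xs (z(b := x)) * chain_density p l (w (z(b := x))) (b # ys) (z(b := x))"
        by (simp only: chain_density_append l_def w_def)
      then show ?thesis by (simp only: d1 w chain_density.simps fun_upd_same d2)
    qed
    have pm: "(\<lambda>x. p l b (w z) x) \<in> borel_measurable lborel"
      by (rule p_measurable_snd[OF lb])
    show ?thesis
    proof (cases ys)
      case Nil
      have "(\<integral>\<^sup>+x. chain_density p a y (xs @ b # ys) (z(b := x)) * F (restrict (z(b := x)) I) \<partial>lborel) =
         (\<integral>\<^sup>+x. (chain_density p a y xs z * F z) * p l b (w z) x \<partial>lborel)"
        unfolding eq r using Nil by (simp add: mult_ac)
      also have "\<dots> = (chain_density p a y xs z * F z) * (\<integral>\<^sup>+x. p l b (w z) x \<partial>lborel)"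
        by (rule nn_integral_cmult[OF pm])
      also have "\<dots> = chain_density p a y xs z * F z"
      proof (cases "w z \<in> S l")
        case True
        then show ?thesis using p_mass[OF lb] by simp
      next
        \<comment> \<open>If the value just before \<open>b\<close> lies off its support, the
          density of the earlier part is already 0. That part is nonempty, as the starting value
          \<open>y\<close> is in the support.\<close>
        case False
        then have "xs \<noteq> []" using y by (auto simp: w_def l_def)
        then have "chain_density p a y xs z = 0"
          using False by (intro chain_density_outside[OF sxs, of l]) (auto simp: w_def l_def)
        then show ?thesis by simp
      qed
      finally show ?thesis using Nil by simp
    next
      case (Cons c cs)
      have bc: "b < c" using sorted Cons by (auto simp: sorted_wrt_append)
      have pm2: "(\<lambda>x. p b c x (z c)) \<in> borel_measurable lborel"
        by (rule p_measurable_fst[OF bc])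
      have "(\<integral>\<^sup>+x. chain_density p a y (xs @ b # ys) (z(b := x)) * F (restrict (z(b := x)) I) \<partial>lborel) =
         (\<integral>\<^sup>+x. (chain_density p a y xs z * chain_density p c (z c) cs z * F z) * (p l b (w z) x * p b c x (z c)) \<partial>lborel)"
        unfolding eq r using Cons by (simp add: mult_ac)
      also have "\<dots> = (chain_density p a y xs z * chain_density p c (z c) cs z * F z) * p l c (w z) (z c)"
        using pm pm2 p_chapman[OF lb bc] by (subst nn_integral_cmult) auto
      also have "\<dots> = chain_density p a y (xs @ ys) z * F z"
        unfolding chain_density_append by (simp add: Cons l_def w_def mult_ac)
      finally show ?thesis .
    qed
  qed
  have "(\<integral>\<^sup>+z. chain_density p a y (xs @ b # ys) z * F (restrict z I) \<partial>Pi\<^sub>M (insert b I) (\<lambda>_. lborel)) =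
      (\<integral>\<^sup>+z. (\<integral>\<^sup>+x. chain_density p a y (xs @ b # ys) (z(b := x)) * F (restrict (z(b := x)) I) \<partial>lborel) \<partial>Pi\<^sub>M I (\<lambda>_. lborel))"
    by (rule product_nn_integral_insert[OF finI bI meas])
  also have "\<dots> = (\<integral>\<^sup>+z. chain_density p a y (xs @ ys) z * F z \<partial>Pi\<^sub>M I (\<lambda>_. lborel))"
    by (intro nn_integral_cong inner)
  finally show ?thesis unfolding ins I_def .
qed

end

section \<open>Marginals of a chain\<close>

locale chain_process = chain_kernels p S + prob_space M
  for p :: "nat \<Rightarrow> nat \<Rightarrow> real \<Rightarrow> real \<Rightarrow> ennreal" and S :: "nat \<Rightarrow> real set" and M :: "'a measure" +
  fixes X :: "nat \<Rightarrow> 'a \<Rightarrow> real" and d :: nat and x0 :: real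
  assumes x0: "x0 \<in> S 0"
    and X_dist: "distributed M (Pi\<^sub>M {1..d} (\<lambda>_. lborel)) (\<lambda>\<omega>. \<lambda>i\<in>{1..d}. X i \<omega>) (chain_density p 0 x0 [1..<Suc d])"
begin

lemma X_measurable: "i \<in> {1..d} \<Longrightarrow> X i \<in> borel_measurable M"
proof -
  assume i: "i \<in> {1..d}"
  have "(\<lambda>\<omega>. \<lambda>i\<in>{1..d}. X i \<omega>) \<in> measurable M (Pi\<^sub>M {1..d} (\<lambda>_. lborel))"
    using X_dist by (rule distributed_measurable)
  from measurable_compose[OF this measurable_component_singleton[OF i]]
  show ?thesis using i by simp
qed

lemma X_restrict_measurable:
  "D \<subseteq> {1..d} \<Longrightarrow> (\<lambda>\<omega>. \<lambda>i\<in>D. X i \<omega>) \<in> measurable M (Pi\<^sub>M D (\<lambda>_. borel))"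
  by (intro measurable_restrict X_measurable) auto

text \<open>The coordinates in \<open>R\<close> are integrated out one at a time; elements of
  \<open>R\<close> that are not times of the chain change nothing.\<close>

lemma nn_integral_X_filter:
  assumes "finite R" and L: "L = filter (\<lambda>i. i \<notin> R) [1..<Suc d]"
    and F: "F \<in> borel_measurable (Pi\<^sub>M (set L) (\<lambda>_. borel))"
  shows "(\<integral>\<^sup>+\<omega>. F (\<lambda>i\<in>set L. X i \<omega>) \<partial>M) =
     (\<integral>\<^sup>+z. chain_density p 0 x0 L z * F z \<partial>Pi\<^sub>M (set L) (\<lambda>_. lborel))"
  using assms
proof (induction R arbitrary: L F rule: finite_induct)
  case empty
  have L: "L = [1..<Suc d]" and sL: "set L = {1..d}" using empty by auto
  have "F \<in> borel_measurable (Pi\<^sub>M {1..d} (\<lambda>_. lborel))"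
    using empty unfolding borel_measurable_PiM_lborel sL by simp
  from distributed_nn_integral[OF X_dist this] show ?case unfolding L[symmetric] sL by (rule sym)
next
  case (insert r R)
  define L' where "L' = filter (\<lambda>i. i \<notin> R) [1..<Suc d]"
  have LL': "L = filter (\<lambda>i. i \<noteq> r) L'" by (simp add: insert.prems L'_def conj_commute)
  have srt: "sorted_wrt (<) (0 # L')" 
    using sorted_wrt_filter[OF sorted_wrt_upt, of "\<lambda>i. i \<notin> R" 1 "Suc d"]
    by (auto simp: L'_def simp del: upt_Suc)
  show ?case
  proof (cases "r \<in> set L'")
    case False
    then have LL: "L = L'" unfolding LL' by (intro filter_True) auto
    show ?thesis using insert.IH[OF L'_def] insert.prems(2) unfolding LL by blast
  next
    case True
    then obtain xs ys where sp: "L' = xs @ r # ys" by (auto simp: in_set_conv_decomp)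
    have "filter (\<lambda>i. i \<noteq> r) xs = xs" "filter (\<lambda>i. i \<noteq> r) ys = ys"
      using srt by (auto simp: sp sorted_wrt_append intro!: filter_True)
    then have L: "L = xs @ ys" unfolding LL' sp by simp
    have F: "F \<in> borel_measurable (Pi\<^sub>M (set (xs @ ys)) (\<lambda>_. borel))" using insert.prems L by simp
    have "(\<lambda>z. F (restrict z (set (xs @ ys)))) \<in> borel_measurable (Pi\<^sub>M (set L') (\<lambda>_. borel))"
      using measurable_compose[OF measurable_restrict_subset F, of "set L'"] by (auto simp: sp)
    have r: "restrict (\<lambda>i\<in>set L'. X i \<omega>) (set (xs @ ys)) = (\<lambda>i\<in>set (xs @ ys). X i \<omega>)" for \<omega>
      by (auto simp: sp fun_eq_iff)
    from insert.IH[OF L'_def \<open>_ \<in> borel_measurable (Pi\<^sub>M (set L') _)\<close>]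
    have "(\<integral>\<^sup>+\<omega>. F (restrict (\<lambda>i\<in>set L'. X i \<omega>) (set (xs @ ys))) \<partial>M) =
       (\<integral>\<^sup>+z. chain_density p 0 x0 (xs @ r # ys) z * F (restrict z (set (xs @ ys))) \<partial>Pi\<^sub>M (set (xs @ r # ys)) (\<lambda>_. lborel))"
      unfolding sp .
    also have "\<dots> = (\<integral>\<^sup>+z. chain_density p 0 x0 (xs @ ys) z * F z \<partial>Pi\<^sub>M (set (xs @ ys)) (\<lambda>_. lborel))"
      using srt by (intro chain_density_eliminate[OF _ x0 F]) (simp add: sp)
    finally show ?thesis unfolding L r .
  qed
qed

lemma nn_integral_X:
  assumes "sorted_wrt (<) L" "set L = D" "D \<subseteq> {1..d}" and F: "F \<in> borel_measurable (Pi\<^sub>M D (\<lambda>_. borel))"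
  shows "(\<integral>\<^sup>+\<omega>. F (\<lambda>i\<in>D. X i \<omega>) \<partial>M) = (\<integral>\<^sup>+z. chain_density p 0 x0 L z * F z \<partial>Pi\<^sub>M D (\<lambda>_. lborel))"
proof -
  define L' where "L' = filter (\<lambda>i. i \<notin> {1..d} - D) [1..<Suc d]"
  have "sorted_wrt (<) L'"
    unfolding L'_def by (intro sorted_wrt_filter sorted_wrt_upt)
  moreover have "set L' = set L"
    using assms(3) unfolding L'_def assms(2) by auto
  ultimately have LL: "L' = L"
    by (intro strict_sorted_equal assms(1)) auto
  have "F \<in> borel_measurable (Pi\<^sub>M (set L') (\<lambda>_. borel))" using F by (simp add: LL assms(2))
  from nn_integral_X_filter[OF _ L'_def this] show ?thesis
    unfolding LL assms(2) by simp
qed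

lemma nn_integral_X1:
  assumes i: "i \<in> {1..d}" and u: "u \<in> borel_measurable borel"
  shows "(\<integral>\<^sup>+\<omega>. u (X i \<omega>) \<partial>M) = (\<integral>\<^sup>+x. p 0 i x0 x * u x \<partial>lborel)"
proof -
  interpret product_sigma_finite "\<lambda>_::nat. lborel :: real measure"
    by unfold_locales
  have [measurable]: "u \<in> borel_measurable borel" by (rule u)
  have "(\<integral>\<^sup>+\<omega>. u ((\<lambda>k\<in>{i}. X k \<omega>) i) \<partial>M) =
      (\<integral>\<^sup>+z. chain_density p 0 x0 [i] z * u (z i) \<partial>Pi\<^sub>M {i} (\<lambda>_. lborel))"
    using i by (intro nn_integral_X) auto
  also have "\<dots> = (\<integral>\<^sup>+x. p 0 i x0 x * u x \<partial>lborel)"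
  proof -
    have "(\<lambda>x. p 0 i x0 x * u x) \<in> borel_measurable lborel"
      using i p_measurable_snd[of 0 i x0] u by (intro borel_measurable_times_ennreal) auto
    from product_nn_integral_singleton[OF this, of i] show ?thesis by simp
  qed
  finally show ?thesis by simp
qed

lemma AE_X_in_S: "i \<in> {1..d} \<Longrightarrow> AE \<omega> in M. X i \<omega> \<in> S i"
proof -
  assume i: "i \<in> {1..d}"
  have [measurable]: "X i \<in> borel_measurable M" "S i \<in> sets borel" by (intro X_measurable i S_borel)+
  have "(\<integral>\<^sup>+\<omega>. indicator (- S i) (X i \<omega>) \<partial>M) = (\<integral>\<^sup>+x. p 0 i x0 x * indicator (- S i) x \<partial>lborel)"
    by (intro nn_integral_X1 i) simp
  also have "\<dots> = (\<integral>\<^sup>+x. 0 \<partial>(lborel :: real measure))"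
    using i by (intro nn_integral_cong) (auto simp: p_outside indicator_def)
  finally have "(\<integral>\<^sup>+\<omega>. indicator (- S i) (X i \<omega>) \<partial>M) = 0" by simp
  then have "AE \<omega> in M. indicator (- S i) (X i \<omega>) = (0::ennreal)"
    by (subst (asm) nn_integral_0_iff_AE) auto
  then show ?thesis by eventually_elim (auto simp: indicator_def split: if_splits)
qed

text \<open>The joint density of the two coordinates contains the factor \<open>p j k\<close>, so
  the event that this factor is 0 has probability 0. This is what later allows dividing by
  it.\<close>

lemma AE_p_nonzero:
  assumes "j \<in> {1..d}" "k \<in> {1..d}" "j < k"
  shows "AE \<omega> in M. p j k (X j \<omega>) (X k \<omega>) \<noteq> 0"
proof -
  have [measurable]: "X j \<in> borel_measurable M" "X k \<in> borel_measurable M" by (intro X_measurable assms)+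
  define F where "F z = (indicator {0} (p j k (z j) (z k)) :: ennreal)" for z
  have F: "F \<in> borel_measurable (Pi\<^sub>M {j, k} (\<lambda>_. borel))"
    unfolding F_def
    by (rule measurable_compose[OF p_measurable_compose[OF assms(3)] borel_measurable_indicator])
       (auto intro: measurable_component_singleton)
  have "(\<integral>\<^sup>+\<omega>. F (\<lambda>i\<in>{j, k}. X i \<omega>) \<partial>M) =
      (\<integral>\<^sup>+z. chain_density p 0 x0 [j, k] z * F z \<partial>Pi\<^sub>M {j, k} (\<lambda>_. lborel))"
    using assms by (intro nn_integral_X F) auto
  also have "\<dots> = (\<integral>\<^sup>+z. 0 \<partial>Pi\<^sub>M {j, k} (\<lambda>_. lborel :: real measure))"
    by (intro nn_integral_cong) (auto simp: F_def indicator_def)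
  finally have "(\<integral>\<^sup>+\<omega>. F (\<lambda>i\<in>{j, k}. X i \<omega>) \<partial>M) = 0" by simp
  then have "AE \<omega> in M. F (\<lambda>i\<in>{j, k}. X i \<omega>) = 0"
    using measurable_compose[OF X_restrict_measurable F] assms by (subst (asm) nn_integral_0_iff_AE) auto
  then show ?thesis by eventually_elim (auto simp: F_def indicator_def split: if_splits)
qed

lemma nn_integral_X_insert:
  assumes L: "sorted_wrt (<) (xs @ i # ys)" "set (xs @ ys) = D" "insert i D \<subseteq> {1..d}"
    and u: "(\<lambda>(z, x). u z x) \<in> borel_measurable (Pi\<^sub>M D (\<lambda>_. borel) \<Otimes>\<^sub>M borel)"
  shows "(\<integral>\<^sup>+\<omega>. u (\<lambda>j\<in>D. X j \<omega>) (X i \<omega>) \<partial>M) =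
     (\<integral>\<^sup>+z. (\<integral>\<^sup>+x. chain_density p 0 x0 (xs @ i # ys) (z(i := x)) * u z x \<partial>lborel) \<partial>Pi\<^sub>M D (\<lambda>_. lborel))"
proof -
  interpret product_sigma_finite "\<lambda>_::nat. lborel :: real measure"
    by unfold_locales
  have iD: "i \<notin> D" "finite D" using L(1) unfolding L(2)[symmetric] by (auto simp: sorted_wrt_append)
  define F where "F z = u (restrict z D) (z i)" for z
  have F: "F \<in> borel_measurable (Pi\<^sub>M (insert i D) (\<lambda>_. borel))"
    unfolding F_def
    by (rule measurable_pair_compose[OF u measurable_restrict_subset measurable_component_singleton]) auto
  have "restrict (\<lambda>j\<in>insert i D. X j \<omega>) D = (\<lambda>j\<in>D. X j \<omega>)" for \<omega> by (auto simp: fun_eq_iff)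
  then have "(\<integral>\<^sup>+\<omega>. u (\<lambda>j\<in>D. X j \<omega>) (X i \<omega>) \<partial>M) = (\<integral>\<^sup>+\<omega>. F (\<lambda>j\<in>insert i D. X j \<omega>) \<partial>M)"
    by (simp add: F_def)
  also have "\<dots> = (\<integral>\<^sup>+z. chain_density p 0 x0 (xs @ i # ys) z * F z \<partial>Pi\<^sub>M (insert i D) (\<lambda>_. lborel))"
    using L(2) by (intro nn_integral_X L F) auto
  also have "\<dots> = (\<integral>\<^sup>+z. (\<integral>\<^sup>+x. chain_density p 0 x0 (xs @ i # ys) (z(i := x)) * F (z(i := x)) \<partial>lborel) \<partial>Pi\<^sub>M D (\<lambda>_. lborel))"
  proof (rule product_nn_integral_insert[OF iD(2,1)], unfold borel_measurable_PiM_lborel, rule borel_measurable_times_ennreal[OF _ F])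
    have srt: "sorted_wrt (<) (0 # xs @ i # ys)"
      using L by (auto simp: Ball_def)
    show "chain_density p 0 x0 (xs @ i # ys) \<in> borel_measurable (Pi\<^sub>M (insert i D) (\<lambda>_. borel))"
      by (rule chain_density_measurable[OF srt, of "\<lambda>_. x0" _ "\<lambda>z. z"])
         (use L(2) in \<open>auto intro!: measurable_component_singleton\<close>)
  qed
  also have "\<dots> = (\<integral>\<^sup>+z. (\<integral>\<^sup>+x. chain_density p 0 x0 (xs @ i # ys) (z(i := x)) * u z x \<partial>lborel) \<partial>Pi\<^sub>M D (\<lambda>_. lborel))"
  proof (rule nn_integral_cong)
    fix z assume "z \<in> space (Pi\<^sub>M D (\<lambda>_. lborel :: real measure))"
    then have "restrict (z(i := x)) D = z" for x
      using iD by (auto simp: space_PiM PiE_def extensional_def restrict_def fun_eq_iff)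
    then show "(\<integral>\<^sup>+x. chain_density p 0 x0 (xs @ i # ys) (z(i := x)) * F (z(i := x)) \<partial>lborel) =
        (\<integral>\<^sup>+x. chain_density p 0 x0 (xs @ i # ys) (z(i := x)) * u z x \<partial>lborel)"
      by (simp add: F_def)
  qed
  finally show ?thesis .
qed

section \<open>Disintegration with respect to selected coordinates\<close>

lemma sorted_list_split_Max:
  assumes "finite J" "J \<noteq> {}"
  obtains xs where "sorted_wrt (<) (xs @ [Max J])" "set (xs @ [Max J]) = J"
proof -
  have "sorted_list_of_set J = butlast (sorted_list_of_set J) @ [Max J]"
    using assms last_eq_Max[of "sorted_list_of_set J"] append_butlast_last_id[of "sorted_list_of_set J"] by simp
  then show ?thesis
    using that[of "butlast (sorted_list_of_set J)"] assms
    by (metis sorted_list_of_set.set_sorted_key_list_of_set strict_sorted_list_of_set)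
qed

text \<open>As \<open>Max J\<close> is the last time before \<open>i\<close>, the density along
  \<open>J\<close> and \<open>i\<close> is the density along \<open>J\<close> times the single
  factor from \<open>Max J\<close> to \<open>i\<close>.\<close>

lemma conditional_past:
  assumes J: "J \<noteq> {}" "J \<subseteq> {1..<i}" and i: "i \<in> {1..d}"
    and u: "(\<lambda>(z, x). u z x) \<in> borel_measurable (Pi\<^sub>M J (\<lambda>_. borel) \<Otimes>\<^sub>M borel)"
  shows "(\<integral>\<^sup>+\<omega>. u (\<lambda>j\<in>J. X j \<omega>) (X i \<omega>) \<partial>M) =
     (\<integral>\<^sup>+\<omega>. (\<integral>\<^sup>+x. p (Max J) i (X (Max J) \<omega>) x * u (\<lambda>j\<in>J. X j \<omega>) x \<partial>lborel) \<partial>M)"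
proof -
  define j where "j = Max J"
  have finJ: "finite J" using J(2) finite_subset by blast
  have j: "j \<in> J" "j < i" using Max_in[OF finJ J(1)] J(2) by (auto simp: j_def)
  have iJ: "i \<notin> J" using J(2) by auto
  obtain xs where xs: "sorted_wrt (<) (xs @ [j])" "set (xs @ [j]) = J"
    using sorted_list_split_Max[OF finJ J(1)] unfolding j_def by blast
  define G where "G z = (\<integral>\<^sup>+x. p j i (z j) x * u z x \<partial>lborel)" for z
  have pu: "(\<lambda>(z, x). p j i (z j) x * u z x) \<in> borel_measurable (Pi\<^sub>M J (\<lambda>_. borel) \<Otimes>\<^sub>M lborel)"
  proof -
    have "(\<lambda>w. p j i (fst w j) (snd w) * u (fst w) (snd w)) \<in> borel_measurable (Pi\<^sub>M J (\<lambda>_. borel) \<Otimes>\<^sub>M borel)"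
      by (intro borel_measurable_times_ennreal p_measurable_compose j measurable_pair_compose[OF u]
          measurable_compose[OF measurable_fst measurable_component_singleton[OF j(1)]] measurable_fst measurable_snd)
    then show ?thesis by (simp add: case_prod_unfold cong: measurable_cong_sets sets_pair_measure_cong)
  qed
  have G: "G \<in> borel_measurable (Pi\<^sub>M J (\<lambda>_. borel))"
    unfolding G_def by (rule lborel.borel_measurable_nn_integral[OF pu])
  have "(\<integral>\<^sup>+\<omega>. u (\<lambda>j\<in>J. X j \<omega>) (X i \<omega>) \<partial>M) =
     (\<integral>\<^sup>+z. (\<integral>\<^sup>+x. chain_density p 0 x0 ((xs @ [j]) @ i # []) (z(i := x)) * u z x \<partial>lborel) \<partial>Pi\<^sub>M J (\<lambda>_. lborel))"
  proof (rule nn_integral_X_insert[OF _ _ _ u])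
    show "sorted_wrt (<) ((xs @ [j]) @ i # [])"
      using xs J(2) unfolding sorted_wrt_append by auto
  qed (use xs J i in auto)
  also have "\<dots> = (\<integral>\<^sup>+z. chain_density p 0 x0 (xs @ [j]) z * G z \<partial>Pi\<^sub>M J (\<lambda>_. lborel))"
  proof (rule nn_integral_cong)
    fix z assume z: "z \<in> space (Pi\<^sub>M J (\<lambda>_. lborel :: real measure))"
    have eq: "chain_density p 0 x0 ((xs @ [j]) @ [i]) (z(i := x)) = chain_density p 0 x0 (xs @ [j]) z * p j i (z j) x" for x
    proof -
      have "chain_density p 0 x0 (xs @ [j]) (z(i := x)) = chain_density p 0 x0 (xs @ [j]) z"
        using iJ xs(2) by (intro chain_density_cong) auto
      then show ?thesis
        using j(2) by (subst chain_density_append) simp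
    qed
    have "(\<lambda>x. p j i (z j) x * u z x) \<in> borel_measurable lborel"
      using measurable_Pair2[OF pu, of z] z by (simp add: space_PiM)
    then show "(\<integral>\<^sup>+x. chain_density p 0 x0 ((xs @ [j]) @ i # []) (z(i := x)) * u z x \<partial>lborel) = chain_density p 0 x0 (xs @ [j]) z * G z"
      unfolding eq G_def mult.assoc by (rule nn_integral_cmult)
  qed
  also have "\<dots> = (\<integral>\<^sup>+\<omega>. G (\<lambda>j\<in>J. X j \<omega>) \<partial>M)"
    by (rule nn_integral_X[symmetric, OF xs _ G]) (use J i in auto)
  also have "\<dots> = (\<integral>\<^sup>+\<omega>. (\<integral>\<^sup>+x. p j i (X j \<omega>) x * u (\<lambda>j\<in>J. X j \<omega>) x \<partial>lborel) \<partial>M)"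
    using j by (simp add: G_def)
  finally show ?thesis unfolding j_def .
qed


lemma sorted_list_split_Min:
  assumes "finite K" "K \<noteq> {}"
  obtains ys where "sorted_wrt (<) (Min K # ys)" "set (Min K # ys) = K"
proof -
  obtain y ys where L: "sorted_list_of_set K = y # ys"
    using assms by (cases "sorted_list_of_set K") auto
  have srt: "sorted_wrt (<) (y # ys)" "set (y # ys) = K"
    using assms L by (metis strict_sorted_list_of_set, metis sorted_list_of_set.set_sorted_key_list_of_set)
  then have "y = Min K"
    using assms by (intro Min_eqI[symmetric]) auto
  with srt show ?thesis using that[of ys] by simp
qed

text \<open>The densities along \<open>J\<close>, \<open>i\<close>, \<open>K\<close> and along
  \<open>J\<close>, \<open>K\<close> differ only around \<open>i\<close>, where the factors into and
  out of \<open>i\<close> stand in place of the one from \<open>Max J\<close> to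
  \<open>Min K\<close>. All other factors cancel in the quotient, so only the two neighbours
  remain.\<close>

lemma conditional_bridge:
  assumes J: "J \<noteq> {}" "J \<subseteq> {1..<i}" and K: "K \<noteq> {}" "K \<subseteq> {i<..d}" and i: "i \<in> {1..d}"
    and u: "(\<lambda>(z, x). u z x) \<in> borel_measurable (Pi\<^sub>M (J \<union> K) (\<lambda>_. borel) \<Otimes>\<^sub>M borel)"
  shows "(\<integral>\<^sup>+\<omega>. u (\<lambda>j\<in>J \<union> K. X j \<omega>) (X i \<omega>) \<partial>M) =
     (\<integral>\<^sup>+\<omega>. (\<integral>\<^sup>+x. p (Max J) i (X (Max J) \<omega>) x * p i (Min K) x (X (Min K) \<omega>)
         / p (Max J) (Min K) (X (Max J) \<omega>) (X (Min K) \<omega>) * u (\<lambda>j\<in>J \<union> K. X j \<omega>) x \<partial>lborel) \<partial>M)"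
proof -
  define j k D where "j = Max J" and "k = Min K" and "D = J \<union> K"
  have finJ: "finite J" "finite K" using J(2) K(2) finite_subset by blast+
  have j: "j \<in> D" "j < i" using Max_in[OF finJ(1) J(1)] J(2) by (auto simp: j_def D_def)
  have k: "k \<in> D" "i < k" using Min_in[OF finJ(2) K(1)] K(2) by (auto simp: k_def D_def)
  have jk: "j < k" using j k by simp
  have iD: "i \<notin> D" using J(2) K(2) by (auto simp: D_def)
  obtain xs where xs: "sorted_wrt (<) (xs @ [j])" "set (xs @ [j]) = J"
    using sorted_list_split_Max[OF finJ(1) J(1)] unfolding j_def by blast
  obtain ys where ys: "sorted_wrt (<) (k # ys)" "set (k # ys) = K"
    using sorted_list_split_Min[OF finJ(2) K(1)] unfolding k_def by blast
  have JK: "a < i" if "a \<in> J" for a using that J(2) by auto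
  have JK': "i < a" if "a \<in> K" for a using that K(2) by auto
  have srt: "sorted_wrt (<) ((xs @ [j]) @ i # (k # ys))"
    using xs(1) ys(1) JK JK' unfolding xs(2)[symmetric] ys(2)[symmetric] sorted_wrt_append by fastforce
  then have srt': "sorted_wrt (<) ((xs @ [j]) @ (k # ys))"
    unfolding sorted_wrt_append by auto
  have setD: "set ((xs @ [j]) @ (k # ys)) = D" unfolding D_def set_append[of "xs @ [j]"] xs(2) ys(2) ..
  note u' = u[folded D_def]
  define B where "B z x = p j i (z j) x * p i k x (z k) / p j k (z j) (z k)" for z x
  define G where "G z = (\<integral>\<^sup>+x. B z x * u z x \<partial>lborel)" for z
  have comp: "(\<lambda>w. fst w a) \<in> measurable (Pi\<^sub>M D (\<lambda>_. borel) \<Otimes>\<^sub>M borel) borel" if "a \<in> D" for a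
    by (rule measurable_compose[OF measurable_fst measurable_component_singleton[OF that]])
  have pp: "(\<lambda>w. p j i (fst w j) (snd w) * p i k (snd w) (fst w k)) \<in> borel_measurable (Pi\<^sub>M D (\<lambda>_. borel) \<Otimes>\<^sub>M borel)"
    by (intro borel_measurable_times_ennreal p_measurable_compose j k comp measurable_snd)
  have pB: "(\<lambda>w. B (fst w) (snd w) * u (fst w) (snd w)) \<in> borel_measurable (Pi\<^sub>M D (\<lambda>_. borel) \<Otimes>\<^sub>M borel)"
    unfolding B_def
    by (intro borel_measurable_times_ennreal borel_measurable_divide_ennreal pp p_measurable_compose jk j k comp
        measurable_pair_compose[OF u'] measurable_fst measurable_snd)
  have G: "G \<in> borel_measurable (Pi\<^sub>M D (\<lambda>_. borel))"
    unfolding G_def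
    by (rule lborel.borel_measurable_nn_integral)
       (use pB in \<open>simp add: case_prod_unfold cong: measurable_cong_sets sets_pair_measure_cong\<close>)
  have "(\<integral>\<^sup>+\<omega>. u (\<lambda>j\<in>D. X j \<omega>) (X i \<omega>) \<partial>M) =
     (\<integral>\<^sup>+z. (\<integral>\<^sup>+x. chain_density p 0 x0 ((xs @ [j]) @ i # (k # ys)) (z(i := x)) * u z x \<partial>lborel) \<partial>Pi\<^sub>M D (\<lambda>_. lborel))"
    by (rule nn_integral_X_insert[OF srt setD _ u']) (use J K i in \<open>auto simp: D_def\<close>)
  also have "\<dots> = (\<integral>\<^sup>+z. chain_density p 0 x0 ((xs @ [j]) @ (k # ys)) z * G z \<partial>Pi\<^sub>M D (\<lambda>_. lborel))"
  proof (rule nn_integral_cong)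
    fix z assume z: "z \<in> space (Pi\<^sub>M D (\<lambda>_. lborel :: real measure))"
    define A C where "A = chain_density p 0 x0 (xs @ [j]) z" and "C = chain_density p k (z k) ys z"
    have nij: "i \<noteq> j" "i \<noteq> k" "i \<notin> set ys" "i \<notin> set (xs @ [j])"
      using iD setD by auto
    have eq: "chain_density p 0 x0 ((xs @ [j]) @ i # (k # ys)) (z(i := x)) = A * C * (p j i (z j) x * p i k x (z k))" for x
    proof -
      have "chain_density p 0 x0 (xs @ [j]) (z(i := x)) = A"
        unfolding A_def using nij by (intro chain_density_cong) auto
      moreover have "chain_density p k (z k) ys (z(i := x)) = C"
        unfolding C_def using nij by (intro chain_density_cong) auto
      ultimately show ?thesis
        using nij by (subst chain_density_append) (simp add: mult_ac)
    qed
    have eq': "chain_density p 0 x0 ((xs @ [j]) @ (k # ys)) z = A * C * p j k (z j) (z k)"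
      by (subst chain_density_append) (simp add: A_def C_def mult_ac)
    have zsp: "z \<in> space (Pi\<^sub>M D (\<lambda>_. borel :: real measure))" using z by (simp add: space_PiM)
    have m1: "(\<lambda>x. p j i (z j) x * p i k x (z k)) \<in> borel_measurable lborel"
      using measurable_compose[OF measurable_Pair1'[OF zsp] pp] by simp
    have m2: "u z \<in> borel_measurable lborel"
      using measurable_compose[OF measurable_Pair1'[OF zsp] u'] by simp
    have m3: "(\<lambda>x. B z x * u z x) \<in> borel_measurable lborel"
      using measurable_compose[OF measurable_Pair1'[OF zsp] pB] by simp
    \<comment> \<open>Clears the denominator of \<open>B\<close>. If it is 0, Chapman-Kolmogorov
      forces the numerator to vanish for almost every \<open>x\<close>, so both sides are 0 whatever
      the quotient is.\<close>
    have key: "(\<integral>\<^sup>+x. p j i (z j) x * p i k x (z k) * u z x \<partial>lborel) = p j k (z j) (z k) * G z"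
    proof (cases "p j k (z j) (z k) = 0")
      case True
      then have "(\<integral>\<^sup>+x. p j i (z j) x * p i k x (z k) \<partial>lborel) = 0"
        using p_chapman[OF j(2) k(2), of "z j" "z k"] by simp
      then have "AE x in lborel. p j i (z j) x * p i k x (z k) = 0"
        using m1 by (subst (asm) nn_integral_0_iff_AE)
      then have "AE x in lborel. p j i (z j) x * p i k x (z k) * u z x = 0" by eventually_elim simp
      then have "(\<integral>\<^sup>+x. p j i (z j) x * p i k x (z k) * u z x \<partial>lborel) = 0"
        using m1 m2 by (subst nn_integral_0_iff_AE) auto
      then show ?thesis using True by simp
    next
      case False
      have "p j k (z j) (z k) * (B z x * u z x) = p j i (z j) x * p i k x (z k) * u z x" for x
      proof -
        have "p j k (z j) (z k) * B z x = p j i (z j) x * p i k x (z k)"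
          unfolding B_def using False p_finite[OF jk, of "z j" "z k"]
          by (simp add: ennreal_times_divide mult.commute[of "p j k _ _"] ennreal_mult_divide_eq)
        then show ?thesis by (simp add: mult.assoc[symmetric])
      qed
      with nn_integral_cmult[OF m3, of "p j k (z j) (z k)"] show ?thesis by (simp add: G_def)
    qed
    have "(\<integral>\<^sup>+x. chain_density p 0 x0 ((xs @ [j]) @ i # (k # ys)) (z(i := x)) * u z x \<partial>lborel) =
        A * C * (\<integral>\<^sup>+x. p j i (z j) x * p i k x (z k) * u z x \<partial>lborel)"
      unfolding eq mult.assoc[of "A * C"] using m1 m2 by (intro nn_integral_cmult) auto
    then show "(\<integral>\<^sup>+x. chain_density p 0 x0 ((xs @ [j]) @ i # (k # ys)) (z(i := x)) * u z x \<partial>lborel) =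
        chain_density p 0 x0 ((xs @ [j]) @ (k # ys)) z * G z"
      unfolding key eq' by (simp add: mult.assoc)
  qed
  also have "\<dots> = (\<integral>\<^sup>+\<omega>. G (\<lambda>j\<in>D. X j \<omega>) \<partial>M)"
    by (rule nn_integral_X[symmetric, OF srt' setD _ G]) (use J K i in \<open>auto simp: D_def\<close>)
  also have "\<dots> = (\<integral>\<^sup>+\<omega>. (\<integral>\<^sup>+x. p j i (X j \<omega>) x * p i k x (X k \<omega>)
         / p j k (X j \<omega>) (X k \<omega>) * u (\<lambda>j\<in>D. X j \<omega>) x \<partial>lborel) \<partial>M)"
    using j k by (simp add: G_def B_def)
  finally show ?thesis unfolding j_def k_def D_def .
qed

end

section \<open>From disintegrations to conditional densities\<close>

lemma prob_space_sigma_gen_by: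
  assumes "prob_space M" and XJ: "(\<lambda>\<omega>. \<lambda>j\<in>J. X j \<omega>) \<in> measurable M (Pi\<^sub>M J (\<lambda>_. borel))"
  shows "subalgebra M (sigma_gen_by M X J)"
    and "sigma_finite_subalgebra M (sigma_gen_by M X J)"
    and "(\<lambda>\<omega>. \<lambda>j\<in>J. X j \<omega>) \<in> measurable (sigma_gen_by M X J) (Pi\<^sub>M J (\<lambda>_. borel))"
proof -
  interpret prob_space M by fact
  have "sets (sigma_gen_by M X J) \<subseteq> sets M"
    unfolding sigma_gen_by_def by (rule sets_image_in_sets[OF refl XJ])
  then show sub: "subalgebra M (sigma_gen_by M X J)"
    by (simp add: subalgebra_def sigma_gen_by_def)
  have "finite_measure_subalgebra M (sigma_gen_by M X J)"
    by (intro finite_measure_subalgebra.intro finite_measure_subalgebra_axioms.intro sub finite_measure_axioms)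
  then interpret finite_measure_subalgebra M "sigma_gen_by M X J" .
  show "sigma_finite_subalgebra M (sigma_gen_by M X J)" by unfold_locales
  show "(\<lambda>\<omega>. \<lambda>j\<in>J. X j \<omega>) \<in> measurable (sigma_gen_by M X J) (Pi\<^sub>M J (\<lambda>_. borel))"
    unfolding sigma_gen_by_def
    by (rule measurable_vimage_algebra1) (use measurable_space[OF XJ] in auto)
qed

text \<open>Common form of both conditional laws: a kernel depending on the conditioning vector,
  with a disintegration formula for all nonnegative test functions. Densities and conditional
  expectations follow from this alone.\<close>

locale conditional_kernel = prob_space M for M :: "'a measure" +
  fixes X :: "nat \<Rightarrow> 'a \<Rightarrow> real" and J :: "nat set" and Y :: "'a \<Rightarrow> real"
    and k :: "(nat \<Rightarrow> real) \<Rightarrow> real \<Rightarrow> ennreal"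
  assumes XJ: "(\<lambda>\<omega>. \<lambda>j\<in>J. X j \<omega>) \<in> measurable M (Pi\<^sub>M J (\<lambda>_. borel))"
    and Y: "Y \<in> borel_measurable M"
    and k: "(\<lambda>(z, x). k z x) \<in> borel_measurable (Pi\<^sub>M J (\<lambda>_. borel) \<Otimes>\<^sub>M borel)"
    and disintegration: "\<And>u. (\<lambda>(z, x). u z x) \<in> borel_measurable (Pi\<^sub>M J (\<lambda>_. borel) \<Otimes>\<^sub>M borel) \<Longrightarrow>
      (\<integral>\<^sup>+\<omega>. u (\<lambda>j\<in>J. X j \<omega>) (Y \<omega>) \<partial>M) =
      (\<integral>\<^sup>+\<omega>. (\<integral>\<^sup>+x. k (\<lambda>j\<in>J. X j \<omega>) x * u (\<lambda>j\<in>J. X j \<omega>) x \<partial>lborel) \<partial>M)"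
begin

abbreviation XJ' :: "'a \<Rightarrow> nat \<Rightarrow> real" where "XJ' \<omega> \<equiv> \<lambda>j\<in>J. X j \<omega>"

abbreviation F :: "'a measure" where "F \<equiv> sigma_gen_by M X J"

lemmas F_sub = prob_space_sigma_gen_by[OF prob_space_axioms XJ]

sublocale sigma_finite_subalgebra M F
  by (rule F_sub(2))

lemma XJ_space: "\<omega> \<in> space M \<Longrightarrow> XJ' \<omega> \<in> space (Pi\<^sub>M J (\<lambda>_. borel))"
  by (rule measurable_space[OF XJ])

lemma ku_measurable:
  assumes "(\<lambda>(z, x). u z x) \<in> borel_measurable (Pi\<^sub>M J (\<lambda>_. borel) \<Otimes>\<^sub>M borel)"
  shows "(\<lambda>w. k (fst w) (snd w) * u (fst w) (snd w)) \<in> borel_measurable (Pi\<^sub>M J (\<lambda>_. borel) \<Otimes>\<^sub>M borel)"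
  by (intro borel_measurable_times_ennreal measurable_pair_compose[OF k] measurable_pair_compose[OF assms]
      measurable_fst measurable_snd)

lemma section_measurable:
  assumes "(\<lambda>w. h (fst w) (snd w)) \<in> measurable (Pi\<^sub>M J (\<lambda>_. borel) \<Otimes>\<^sub>M borel) N" "\<omega> \<in> space M"
  shows "h (XJ' \<omega>) \<in> measurable borel N"
  using measurable_compose[OF measurable_Pair1'[OF XJ_space[OF assms(2)]] assms(1)] by simp

text \<open>Every set of the generated sigma-algebra is a preimage under the conditioning vector, so
  its indicator can be moved into the test function. The disintegration is then the defining
  equation of the conditional expectation.\<close>

lemma nn_cond_exp_kernel:
  assumes u: "(\<lambda>(z, x). u z x) \<in> borel_measurable (Pi\<^sub>M J (\<lambda>_. borel) \<Otimes>\<^sub>M borel)"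
  shows "AE \<omega> in M. nn_cond_exp M F (\<lambda>\<omega>. u (XJ' \<omega>) (Y \<omega>)) \<omega> = (\<integral>\<^sup>+x. k (XJ' \<omega>) x * u (XJ' \<omega>) x \<partial>lborel)"
proof -
  define G where "G z = (\<integral>\<^sup>+x. k z x * u z x \<partial>lborel)" for z
  have G: "G \<in> borel_measurable (Pi\<^sub>M J (\<lambda>_. borel))"
    unfolding G_def
    by (rule lborel.borel_measurable_nn_integral)
       (use ku_measurable[OF u] in \<open>simp add: case_prod_unfold cong: measurable_cong_sets sets_pair_measure_cong\<close>)
  have "AE \<omega> in M. G (XJ' \<omega>) = nn_cond_exp M F (\<lambda>\<omega>. u (XJ' \<omega>) (Y \<omega>)) \<omega>"
  proof (rule nn_cond_exp_charact)
    show "(\<lambda>\<omega>. u (XJ' \<omega>) (Y \<omega>)) \<in> borel_measurable M"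
      by (rule measurable_pair_compose[OF u XJ Y])
    show "(\<lambda>\<omega>. G (XJ' \<omega>)) \<in> borel_measurable F"
      by (rule measurable_compose[OF F_sub(3) G])
    fix A assume "A \<in> sets F"
    then obtain A' where A': "A' \<in> sets (Pi\<^sub>M J (\<lambda>_. borel))" "A = XJ' -` A' \<inter> space M"
      unfolding sigma_gen_by_def
      by (subst (asm) sets_vimage_algebra2) (use XJ_space in auto)
    have ind: "indicator A \<omega> = (indicator A' (XJ' \<omega>) :: ennreal)" if "\<omega> \<in> space M" for \<omega>
      using that by (simp add: A' indicator_def)
    have "(\<lambda>w. u (fst w) (snd w) * indicator A' (fst w)) \<in> borel_measurable (Pi\<^sub>M J (\<lambda>_. borel) \<Otimes>\<^sub>M borel)"
      by (intro borel_measurable_times_ennreal measurable_pair_compose[OF u]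
          measurable_compose[OF measurable_fst borel_measurable_indicator] A' measurable_fst measurable_snd)
    then have u': "(\<lambda>(z, x). u z x * indicator A' z) \<in> borel_measurable (Pi\<^sub>M J (\<lambda>_. borel) \<Otimes>\<^sub>M borel)"
      by (simp add: case_prod_unfold)
    have "(\<integral>\<^sup>+\<omega>\<in>A. u (XJ' \<omega>) (Y \<omega>) \<partial>M) = (\<integral>\<^sup>+\<omega>. u (XJ' \<omega>) (Y \<omega>) * indicator A' (XJ' \<omega>) \<partial>M)"
      by (intro nn_integral_cong) (simp add: ind)
    also have "\<dots> = (\<integral>\<^sup>+\<omega>. (\<integral>\<^sup>+x. k (XJ' \<omega>) x * (u (XJ' \<omega>) x * indicator A' (XJ' \<omega>)) \<partial>lborel) \<partial>M)"
      by (rule disintegration[OF u'])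
    also have "\<dots> = (\<integral>\<^sup>+\<omega>\<in>A. G (XJ' \<omega>) \<partial>M)"
    proof (intro nn_integral_cong)
      fix \<omega> assume \<omega>: "\<omega> \<in> space M"
      have "(\<lambda>x. k (XJ' \<omega>) x * u (XJ' \<omega>) x) \<in> borel_measurable lborel"
        using section_measurable[of "\<lambda>z x. k z x * u z x", OF ku_measurable[OF u] \<omega>] by simp
      then show "(\<integral>\<^sup>+x. k (XJ' \<omega>) x * (u (XJ' \<omega>) x * indicator A' (XJ' \<omega>)) \<partial>lborel) = G (XJ' \<omega>) * indicator A \<omega>"
        unfolding G_def ind[OF \<omega>] mult.assoc[symmetric] by (rule nn_integral_multc)
    qed
    finally show "(\<integral>\<^sup>+\<omega>\<in>A. u (XJ' \<omega>) (Y \<omega>) \<partial>M) = (\<integral>\<^sup>+\<omega>\<in>A. G (XJ' \<omega>) \<partial>M)" .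
  qed
  then show ?thesis by eventually_elim (simp add: G_def)
qed

text \<open>\<open>real_cond_exp\<close> is a difference of two nonnegative conditional
  expectations, and \<open>nn_cond_exp_kernel\<close> applies to each. \<open>f\<close> is a real
  version of the kernel, required to agree with it only almost surely.\<close>

lemma real_cond_exp_kernel:
  assumes g: "(\<lambda>(z, x). g z x) \<in> borel_measurable (Pi\<^sub>M J (\<lambda>_. borel) \<Otimes>\<^sub>M borel)"
    and f: "AE \<omega> in M. \<forall>x. k (XJ' \<omega>) x = ennreal (f \<omega> x) \<and> 0 \<le> f \<omega> x"
    and c: "AE \<omega> in M. has_bochner_integral lborel (\<lambda>x. f \<omega> x * g (XJ' \<omega>) x) (c \<omega>)"
  shows "AE \<omega> in M. real_cond_exp M F (\<lambda>\<omega>. g (XJ' \<omega>) (Y \<omega>)) \<omega> = c \<omega>"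
proof -
  have g1: "(\<lambda>(z, x). ennreal (g z x)) \<in> borel_measurable (Pi\<^sub>M J (\<lambda>_. borel) \<Otimes>\<^sub>M borel)"
    and g2: "(\<lambda>(z, x). ennreal (- g z x)) \<in> borel_measurable (Pi\<^sub>M J (\<lambda>_. borel) \<Otimes>\<^sub>M borel)"
    using g by (simp_all add: case_prod_unfold)
  from nn_cond_exp_kernel[OF g1] nn_cond_exp_kernel[OF g2] f c show ?thesis
  proof eventually_elim
    case (elim \<omega>)
    have "c \<omega> = (LINT x|lborel. f \<omega> x * g (XJ' \<omega>) x)" and "integrable lborel (\<lambda>x. f \<omega> x * g (XJ' \<omega>) x)"
      using elim(4) by (simp_all add: has_bochner_integral_iff)
    from this(1) real_lebesgue_integral_def[OF this(2)]
    have "c \<omega> = enn2real (\<integral>\<^sup>+x. ennreal (f \<omega> x) * ennreal (g (XJ' \<omega>) x) \<partial>lborel)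
        - enn2real (\<integral>\<^sup>+x. ennreal (f \<omega> x) * ennreal (- g (XJ' \<omega>) x) \<partial>lborel)"
      using elim(3) by (simp add: ennreal_mult'[symmetric])
    then show ?case using elim(1,2,3) by (simp add: real_cond_exp_def)
  qed
qed

text \<open>The mass is obtained from the test function 1: its conditional expectation is 1, and by
  \<open>nn_cond_exp_kernel\<close> it is also the integral of the kernel. For the bridge this is
  how normalisation is seen.\<close>

lemma cond_density_kernel:
  assumes f: "AE \<omega> in M. \<forall>x. k (XJ' \<omega>) x = ennreal (f \<omega> x) \<and> 0 \<le> f \<omega> x"
  shows "cond_density M F Y f"
proof -
  have kf: "(\<lambda>w. k (fst w) (snd w)) \<in> borel_measurable (Pi\<^sub>M J (\<lambda>_. borel) \<Otimes>\<^sub>M borel)"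
    using k by (simp add: case_prod_unfold)
  have f_meas: "f \<omega> \<in> borel_measurable borel" if "\<omega> \<in> space M" "\<forall>x. k (XJ' \<omega>) x = ennreal (f \<omega> x) \<and> 0 \<le> f \<omega> x" for \<omega>
  proof -
    have "f \<omega> = (\<lambda>x. enn2real (k (XJ' \<omega>) x))" using that(2) by (auto simp: fun_eq_iff)
    moreover have "(\<lambda>x. enn2real (k (XJ' \<omega>) x)) \<in> borel_measurable borel"
      by (intro borel_measurable_enn2real section_measurable[OF kf that(1)])
    ultimately show ?thesis by (simp only:)
  qed
  have one: "AE \<omega> in M. (1::ennreal) = nn_cond_exp M F (\<lambda>_. 1) \<omega>"
    by (rule nn_cond_exp_F_meas) simp
  have total: "AE \<omega> in M. nn_cond_exp M F (\<lambda>_. 1) \<omega> = (\<integral>\<^sup>+x. k (XJ' \<omega>) x * 1 \<partial>lborel)"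
    by (rule nn_cond_exp_kernel) simp
  have "AE \<omega> in M. f \<omega> \<in> borel_measurable borel \<and> (\<forall>x. 0 \<le> f \<omega> x) \<and> (\<integral>\<^sup>+ x. ennreal (f \<omega> x) \<partial>lborel) = 1"
    using f one total AE_space
    by eventually_elim (auto simp: f_meas)
  moreover have "AE \<omega> in M. real_cond_exp M F (indicator (Y -` B \<inter> space M)) \<omega> = measure (density lborel (\<lambda>x. ennreal (f \<omega> x))) B"
    if B: "B \<in> sets borel" for B
  proof -
    have YB: "Y -` B \<inter> space M \<in> sets M" using Y B by (rule measurable_sets)
    have indB: "(\<lambda>\<omega>. indicator B (Y \<omega>) :: real) \<in> borel_measurable M"
      using measurable_compose[OF Y borel_measurable_indicator[OF B]] .
    have cg: "AE \<omega> in M. real_cond_exp M F (indicator (Y -` B \<inter> space M)) \<omega> = real_cond_exp M F (\<lambda>\<omega>. indicator B (Y \<omega>)) \<omega>"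
      by (rule real_cond_exp_cong) (use YB indB in \<open>auto simp: indicator_def\<close>)
    have sB: "(\<lambda>w. indicator B (snd w) :: real) \<in> borel_measurable (Pi\<^sub>M J (\<lambda>_. borel) \<Otimes>\<^sub>M borel)"
      using measurable_compose[OF measurable_snd borel_measurable_indicator[OF B]] .
    have z: "ennreal (- indicator B x) = 0" for x :: real by (simp add: ennreal_neg)
    have u1: "(\<lambda>(z, x). ennreal (indicator B x)) \<in> borel_measurable (Pi\<^sub>M J (\<lambda>_. borel) \<Otimes>\<^sub>M borel)"
      and u2: "(\<lambda>(z, x). ennreal (- indicator B x)) \<in> borel_measurable (Pi\<^sub>M J (\<lambda>_. borel) \<Otimes>\<^sub>M borel)"
      using sB unfolding z by (simp_all add: case_prod_unfold)
    from cg f nn_cond_exp_kernel[OF u1] nn_cond_exp_kernel[OF u2] AE_space show ?thesis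
    proof eventually_elim
      case (elim \<omega>)
      have fm: "f \<omega> \<in> borel_measurable borel" using f_meas elim by blast
      have "measure (density lborel (\<lambda>x. ennreal (f \<omega> x))) B = enn2real (\<integral>\<^sup>+x. ennreal (f \<omega> x) * indicator B x \<partial>lborel)"
        unfolding measure_def using fm B by (subst emeasure_density) auto
      then show ?case
        unfolding elim(1) unfolding real_cond_exp_def unfolding elim(3,4) using elim(2) z by (simp add: ennreal_indicator)
    qed
  qed
  ultimately show ?thesis
    unfolding cond_density_def using F_sub(1) Y by blast
qed

end

section \<open>The q-normal chain\<close>

lemma q_kernel_measurable:
  assumes "-1 < q" "q \<le> 1" "\<bar>r\<bar> < 1"
  shows "(\<lambda>(y, x). q_kernel q r y x) \<in> borel_measurable (borel \<Otimes>\<^sub>M borel)"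
proof (cases "q = 1")
  case True
  then show ?thesis unfolding True q_kernel_1 normal_density_def by measurable
next
  case False
  then interpret q_disc q using assms by unfold_locales auto
  show ?thesis by (rule q_kernel_measurable[OF assms(3)])
qed

lemma q_kernel_nonneg:
  assumes "-1 < q" "q \<le> 1" "\<bar>r\<bar> < 1"
  shows "q_kernel q r y x \<ge> 0"
proof (cases "q = 1")
  case True
  then show ?thesis unfolding True q_kernel_1 by simp
next
  case False
  then interpret q_disc q using assms by unfold_locales auto
  show ?thesis by (rule q_kernel_nonneg[OF assms(3)])
qed

lemma q_kernel_hermite:
  assumes "-1 < q" "q \<le> 1" "\<bar>r\<bar> < 1" "y \<in> q_supp q"
  shows "has_bochner_integral lborel (\<lambda>x. q_kernel q r y x * q_hermite n x q) (r ^ n * q_hermite n y q)"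
proof (cases "q = 1")
  case True
  then show ?thesis using normal_kernel_hermite[OF assms(3)] by simp
next
  case False
  then interpret q_disc q using assms by unfold_locales auto
  show ?thesis by (rule q_kernel_hermite[OF assms(3,4)])
qed

lemma q_kernel_chapman:
  assumes "-1 < q" "q \<le> 1" "\<bar>a\<bar> < 1" "\<bar>b\<bar> < 1"
  shows "has_bochner_integral lborel (\<lambda>x. q_kernel q a y x * q_kernel q b x z) (q_kernel q (a * b) y z)"
proof (cases "q = 1")
  case True
  then show ?thesis using normal_chapman[OF assms(3,4)] by simp
next
  case False
  then interpret q_disc q using assms by unfold_locales auto
  show ?thesis by (rule q_kernel_chapman[OF assms(3,4)])
qed

lemma q_bridge_kernel:
  assumes "-1 < q" "q \<le> 1" "\<bar>a\<bar> < 1" "\<bar>b\<bar> < 1" "y \<in> q_supp q" "z \<in> q_supp q"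
  shows "q_bridge x y z a b q * q_kernel q (a * b) y z = q_kernel q a y x * q_kernel q b x z"
proof (cases "q = 1")
  case True
  then show ?thesis using normal_bridge[OF assms(3,4)] by simp
next
  case False
  then interpret q_disc q using assms by unfold_locales auto
  show ?thesis by (rule q_bridge_eq[OF assms(3-6)])
qed

lemma q_cond_normal_kernel:
  assumes "y \<in> q_supp q"
  shows "q_cond_normal x y r q = q_kernel q r y x"
  using assms by (auto simp: q_kernel_def q_cond_normal_def q_normal_def q_supp_def)

lemma zero_in_q_supp: "q \<le> 1 \<Longrightarrow> 0 \<in> q_supp q"
  by (simp add: q_supp_def)

lemma q_supp_borel: "q_supp q \<in> sets borel"
  by (simp add: q_supp_def)

lemma q_normal_kernel: "q \<le> 1 \<Longrightarrow> q_normal x q = q_kernel q 0 0 x"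
  by (auto simp: q_cond_normal_kernel[symmetric] zero_in_q_supp q_cond_normal_def q_normal_def h_factor_def)

lemma q_hermite_measurable: "(\<lambda>x. q_hermite n x q) \<in> borel_measurable borel"
proof (induction n rule: induct_nat_012)
  case (ge2 n)
  then show ?case by (simp add: q_hermite.simps(3))
qed simp_all

lemma has_bochner_integral_shift:
  fixes f :: "real \<Rightarrow> real"
  assumes "has_bochner_integral lborel f l"
  shows "has_bochner_integral lborel (\<lambda>x. f (x - t)) l"
  using lborel_has_bochner_integral_real_affine_iff[of 1 f l "- t"] assms by simp

lemma abs_prod_less_1:
  fixes f :: "'a \<Rightarrow> real"
  assumes "finite A" "A \<noteq> {}" "\<And>i. i \<in> A \<Longrightarrow> \<bar>f i\<bar> < 1"
  shows "\<bar>prod f A\<bar> < 1"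
  using assms
proof (induction A rule: finite_ne_induct)
  case (insert i A)
  then show ?case
    using mult_strict_mono[of "\<bar>f i\<bar>" 1 "\<bar>prod f A\<bar>" 1] by (simp add: abs_mult)
qed simp

section \<open>The q-normal density as a chain density\<close>

locale q_chain_params =
  fixes q :: real and m \<rho> :: "nat \<Rightarrow> real" and d :: nat
  assumes q: "-1 < q" "q \<le> 1"
    and \<rho>: "\<And>i. i \<in> {1..<d} \<Longrightarrow> \<bar>\<rho> i\<bar> < 1"
begin

text \<open>The chain is started one step earlier, at the deterministic point \<open>0\<close> with correlation \<open>0\<close>,
  because \<open>f\<^sub>C\<^sub>N(x|y,0,q) = f\<^sub>N(x|q)\<close>.\<close>

definition corr :: "nat \<Rightarrow> nat \<Rightarrow> real" where
  "corr a b = (\<Prod>k\<in>{a..<b}. if k \<in> {1..<d} then \<rho> k else 0)"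

definition shift :: "nat \<Rightarrow> real" where
  "shift i = (if i = 0 then 0 else m i)"

definition step_density :: "nat \<Rightarrow> nat \<Rightarrow> real \<Rightarrow> real \<Rightarrow> ennreal" where
  "step_density a b y x = ennreal (q_kernel q (corr a b) (y - shift a) (x - shift b))"

definition supp :: "nat \<Rightarrow> real set" where
  "supp a = {x. x - shift a \<in> q_supp q}"

text \<open>The default 0 of \<open>corr\<close> outside the range of \<rho> makes this true for all
  pairs of times, as is needed for kernels indexed by all natural numbers.\<close>

lemma corr_abs: "a < b \<Longrightarrow> \<bar>corr a b\<bar> < 1"
  unfolding corr_def using \<rho> by (intro abs_prod_less_1) auto

lemma corr_mult: "a < b \<Longrightarrow> b < c \<Longrightarrow> corr a b * corr b c = corr a c"
  unfolding corr_def by (intro prod.atLeastLessThan_concat) auto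

lemma corr_eq: "1 \<le> a \<Longrightarrow> b \<le> d \<Longrightarrow> corr a b = (\<Prod>k\<in>{a..<b}. \<rho> k)"
  unfolding corr_def by (intro prod.cong) auto

lemma corr_0: "0 < b \<Longrightarrow> corr 0 b = 0"
  unfolding corr_def by (intro prod_zero) auto

lemma shift_eq: "1 \<le> a \<Longrightarrow> shift a = m a"
  by (simp add: shift_def)

text \<open>For \<open>n = 0\<close> this is the normalisation of the kernel.\<close>

lemma step_density_hermite:
  assumes "a < b" "y \<in> supp a"
  shows "has_bochner_integral lborel (\<lambda>x. q_kernel q (corr a b) (y - shift a) (x - shift b) * q_hermite n (x - shift b) q)
     (corr a b ^ n * q_hermite n (y - shift a) q)"
  using has_bochner_integral_shift[OF q_kernel_hermite[OF q corr_abs[OF assms(1)]]] assms(2)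
  by (simp add: supp_def)

lemma nn_integral_has_bochner:
  assumes "has_bochner_integral M f l" "\<And>x. f x \<ge> 0"
  shows "(\<integral>\<^sup>+x. ennreal (f x) \<partial>M) = ennreal l"
  using nn_integral_eq_integral[of M f] assms by (auto simp: has_bochner_integral_iff)

sublocale chain_kernels step_density supp
proof
  fix a b c :: nat and x y z :: real
  show "(\<lambda>(y, x). step_density a b y x) \<in> borel_measurable (borel \<Otimes>\<^sub>M borel)" if "a < b"
  proof -
    have "(\<lambda>w. q_kernel q (corr a b) (fst w - shift a) (snd w - shift b)) \<in> borel_measurable (borel \<Otimes>\<^sub>M borel)"
      by (rule measurable_pair_compose[OF q_kernel_measurable[OF q corr_abs[OF that]]]) measurable
    then show ?thesis by (simp add: step_density_def case_prod_unfold)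
  qed
  show "step_density a b y x = 0" if "x \<notin> supp b"
    using that by (simp add: step_density_def supp_def q_kernel_def)
  show "step_density a b y x < \<top>" by (simp add: step_density_def)
  show "(\<integral>\<^sup>+x. step_density a b y x \<partial>lborel) = 1" if "a < b" "y \<in> supp a"
    unfolding step_density_def
    using nn_integral_has_bochner[OF step_density_hermite[OF that, of 0]] q_kernel_nonneg[OF q corr_abs[OF that(1)]]
    by simp
  show "(\<integral>\<^sup>+x. step_density a b y x * step_density b c x z \<partial>lborel) = step_density a c y z" if "a < b" "b < c"
    using nn_integral_has_bochner[OF has_bochner_integral_shift[OF q_kernel_chapman[OF q corr_abs[OF that(1)] corr_abs[OF that(2)],
        of "y - shift a" "z - shift c"], of "shift b"]]
      q_kernel_nonneg[OF q corr_abs[OF that(1)]] q_kernel_nonneg[OF q corr_abs[OF that(2)]]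
    by (simp add: step_density_def ennreal_mult corr_mult[OF that])
  show "supp a \<in> sets borel"
  proof -
    have "(\<lambda>x. x - shift a) -` q_supp q \<inter> space borel \<in> sets borel"
      by (rule measurable_sets[OF _ q_supp_borel]) measurable
    then show ?thesis by (simp add: supp_def vimage_def)
  qed
qed

lemma zero_in_supp: "0 \<in> supp 0"
  using zero_in_q_supp[OF q(2)] by (simp add: supp_def shift_def)

text \<open>Off the supports both sides are 0. On them one transition is appended at a time; the
  transition out of the artificial starting point is \<open>q_normal\<close>.\<close>

lemma joint_density_eq:
  assumes "1 \<le> d"
  shows "ennreal (q_normal_joint d m \<rho> q x) = chain_density step_density 0 0 [1..<Suc d] x"
proof (cases "\<forall>i\<in>{1..d}. x i - m i \<in> q_supp q")
  case False
  then obtain i where i: "i \<in> {1..d}" "x i \<notin> supp i" by (auto simp: supp_def shift_def)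
  have "chain_density step_density 0 0 [1..<Suc d] x = 0"
    by (rule chain_density_outside[of _ _ i]) (use i in \<open>auto simp del: upt_Suc\<close>)
  moreover have "q_normal_joint d m \<rho> q x = 0"
    unfolding q_normal_joint_def using False by (rule if_not_P)
  ultimately show ?thesis by (simp del: upt_Suc)
next
  case True
  have "n \<le> d \<Longrightarrow> chain_density step_density 0 0 [1..<Suc n] x =
      ennreal (q_normal (x 1 - m 1) q * (\<Prod>i\<in>{1..<n}. q_cond_normal (x (Suc i) - m (Suc i)) (x i - m i) (\<rho> i) q))"
    if "1 \<le> n" for n
    using that
  proof (induction n rule: dec_induct)
    case base
    then show ?case using q
      by (simp add: step_density_def corr_0 shift_def q_normal_kernel)
  next
    case (step n)
    have l: "last (0 # [1..<Suc n]) = n" "[1..<Suc n] \<noteq> []" "last [1..<Suc n] = n" using step(1) by auto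
    have "[1..<Suc (Suc n)] = [1..<Suc n] @ [Suc n]" using step(1) by simp
    then have "chain_density step_density 0 0 [1..<Suc (Suc n)] x =
        chain_density step_density 0 0 [1..<Suc n] x * step_density n (Suc n) (x n) (x (Suc n))"
      using l by (simp only: chain_density_append if_False chain_density.simps mult_1_right)
    also have "step_density n (Suc n) (x n) (x (Suc n)) = ennreal (q_cond_normal (x (Suc n) - m (Suc n)) (x n - m n) (\<rho> n) q)"
      using step True by (simp add: step_density_def corr_def shift_def q_cond_normal_kernel)
    also have "chain_density step_density 0 0 [1..<Suc n] x = ennreal (q_normal (x 1 - m 1) q * (\<Prod>i\<in>{1..<n}. q_cond_normal (x (Suc i) - m (Suc i)) (x i - m i) (\<rho> i) q))"
      using step by simp
    also have "ennreal (q_normal (x 1 - m 1) q * (\<Prod>i\<in>{1..<n}. q_cond_normal (x (Suc i) - m (Suc i)) (x i - m i) (\<rho> i) q))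
        * ennreal (q_cond_normal (x (Suc n) - m (Suc n)) (x n - m n) (\<rho> n) q) =
      ennreal (q_normal (x 1 - m 1) q * (\<Prod>i\<in>{1..<n}. q_cond_normal (x (Suc i) - m (Suc i)) (x i - m i) (\<rho> i) q)
        * q_cond_normal (x (Suc n) - m (Suc n)) (x n - m n) (\<rho> n) q)"
    proof (rule ennreal_mult''[symmetric])
      show "0 \<le> q_cond_normal (x (Suc n) - m (Suc n)) (x n - m n) (\<rho> n) q"
        using step True \<rho>[of n] q by (simp add: q_cond_normal_kernel q_kernel_nonneg)
    qed
    finally show ?case using step(1) by (simp add: mult.assoc)
  qed
  from this[OF assms] show ?thesis using True by (simp add: q_normal_joint_def del: upt_Suc)
qed

end

section \<open>Conditional laws of the q-normal chain\<close>

locale q_chain = q_chain_params q m \<rho> d + prob_space M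
  for q :: real and m \<rho> :: "nat \<Rightarrow> real" and d :: nat and M :: "'a measure" +
  fixes X :: "nat \<Rightarrow> 'a \<Rightarrow> real"
  assumes d: "1 \<le> d"
    and X: "distributed M (Pi\<^sub>M {1..d} (\<lambda>_. lborel)) (\<lambda>\<omega>. \<lambda>i\<in>{1..d}. X i \<omega>)
           (\<lambda>x. ennreal (q_normal_joint d m \<rho> q x))"
begin

sublocale chain_process step_density supp M X d 0
  by unfold_locales (use X zero_in_supp joint_density_eq[OF d] in simp_all)

lemma AE_X_supp: "i \<in> {1..d} \<Longrightarrow> AE \<omega> in M. X i \<omega> - m i \<in> q_supp q"
  using AE_X_in_S[of i] by (simp add: supp_def shift_def)

lemma conditional_kernel_past:
  assumes J: "J \<noteq> {}" "J \<subseteq> {1..<i}" and i: "i \<in> {1..d}"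
  shows "conditional_kernel M X J (X i) (\<lambda>z. step_density (Max J) i (z (Max J)))"
proof
  have finJ: "finite J" using J(2) finite_subset by blast
  have j: "Max J \<in> J" "Max J < i" using Max_in[OF finJ J(1)] J(2) by auto
  show "(\<lambda>\<omega>. \<lambda>j\<in>J. X j \<omega>) \<in> measurable M (Pi\<^sub>M J (\<lambda>_. borel))"
    using J(2) i by (intro X_restrict_measurable) auto
  show "X i \<in> borel_measurable M" by (rule X_measurable[OF i])
  have "(\<lambda>w. step_density (Max J) i (fst w (Max J)) (snd w)) \<in> borel_measurable (Pi\<^sub>M J (\<lambda>_. borel) \<Otimes>\<^sub>M borel)"
    by (intro p_measurable_compose j measurable_compose[OF measurable_fst measurable_component_singleton[OF j(1)]] measurable_snd)
  then show "(\<lambda>(z, x). step_density (Max J) i (z (Max J)) x) \<in> borel_measurable (Pi\<^sub>M J (\<lambda>_. borel) \<Otimes>\<^sub>M borel)"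
    by (simp add: case_prod_unfold)
  show "(\<integral>\<^sup>+\<omega>. u (\<lambda>j\<in>J. X j \<omega>) (X i \<omega>) \<partial>M) =
      (\<integral>\<^sup>+\<omega>. (\<integral>\<^sup>+x. step_density (Max J) i ((\<lambda>j\<in>J. X j \<omega>) (Max J)) x * u (\<lambda>j\<in>J. X j \<omega>) x \<partial>lborel) \<partial>M)"
    if "(\<lambda>(z, x). u z x) \<in> borel_measurable (Pi\<^sub>M J (\<lambda>_. borel) \<Otimes>\<^sub>M borel)" for u
    using conditional_past[OF J i that] j by simp
qed

lemma conditional_kernel_bridge:
  assumes J: "J \<noteq> {}" "J \<subseteq> {1..<i}" and K: "K \<noteq> {}" "K \<subseteq> {i<..d}" and i: "i \<in> {1..d}"
  shows "conditional_kernel M X (J \<union> K) (X i)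
    (\<lambda>z x. step_density (Max J) i (z (Max J)) x * step_density i (Min K) x (z (Min K))
         / step_density (Max J) (Min K) (z (Max J)) (z (Min K)))"
proof
  have finJ: "finite J" "finite K" using J(2) K(2) finite_subset by blast+
  have j: "Max J \<in> J \<union> K" "Max J < i" using Max_in[OF finJ(1) J(1)] J(2) by auto
  have k: "Min K \<in> J \<union> K" "i < Min K" using Min_in[OF finJ(2) K(1)] K(2) by auto
  have jk: "Max J < Min K" using j k by simp
  show "(\<lambda>\<omega>. \<lambda>j\<in>J \<union> K. X j \<omega>) \<in> measurable M (Pi\<^sub>M (J \<union> K) (\<lambda>_. borel))"
    using J(2) K(2) i by (intro X_restrict_measurable) auto
  show "X i \<in> borel_measurable M" by (rule X_measurable[OF i])
  have comp: "(\<lambda>w. fst w a) \<in> measurable (Pi\<^sub>M (J \<union> K) (\<lambda>_. borel) \<Otimes>\<^sub>M borel) borel" if "a \<in> J \<union> K" for a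
    by (rule measurable_compose[OF measurable_fst measurable_component_singleton[OF that]])
  have "(\<lambda>w. step_density (Max J) i (fst w (Max J)) (snd w) * step_density i (Min K) (snd w) (fst w (Min K))
         / step_density (Max J) (Min K) (fst w (Max J)) (fst w (Min K)))
      \<in> borel_measurable (Pi\<^sub>M (J \<union> K) (\<lambda>_. borel) \<Otimes>\<^sub>M borel)"
    by (intro borel_measurable_divide_ennreal borel_measurable_times_ennreal p_measurable_compose j k jk comp measurable_snd)
  then show "(\<lambda>(z, x). step_density (Max J) i (z (Max J)) x * step_density i (Min K) x (z (Min K))
         / step_density (Max J) (Min K) (z (Max J)) (z (Min K)))
      \<in> borel_measurable (Pi\<^sub>M (J \<union> K) (\<lambda>_. borel) \<Otimes>\<^sub>M borel)"
    by (simp add: case_prod_unfold)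
  show "(\<integral>\<^sup>+\<omega>. u (\<lambda>j\<in>J \<union> K. X j \<omega>) (X i \<omega>) \<partial>M) =
      (\<integral>\<^sup>+\<omega>. (\<integral>\<^sup>+x. step_density (Max J) i ((\<lambda>j\<in>J \<union> K. X j \<omega>) (Max J)) x * step_density i (Min K) x ((\<lambda>j\<in>J \<union> K. X j \<omega>) (Min K))
         / step_density (Max J) (Min K) ((\<lambda>j\<in>J \<union> K. X j \<omega>) (Max J)) ((\<lambda>j\<in>J \<union> K. X j \<omega>) (Min K))
         * u (\<lambda>j\<in>J \<union> K. X j \<omega>) x \<partial>lborel) \<partial>M)"
    if "(\<lambda>(z, x). u z x) \<in> borel_measurable (Pi\<^sub>M (J \<union> K) (\<lambda>_. borel) \<Otimes>\<^sub>M borel)" for u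
    using conditional_bridge[OF J K i that] j(1) k(1) by (simp only: restrict_apply if_True)
qed

text \<open>The law of \<open>X i\<close> has density \<open>step_density 0 i 0\<close>, and the
  moment formula for this kernel includes integrability.\<close>

lemma integrable_hermite:
  assumes i: "i \<in> {1..d}"
  shows "integrable M (\<lambda>\<omega>. q_hermite n (X i \<omega> - m i) q)"
proof (rule integrableI_bounded)
  have H: "(\<lambda>x. q_hermite n (x - m i) q) \<in> borel_measurable borel"
    by (rule measurable_compose[OF _ q_hermite_measurable]) measurable
  show "(\<lambda>\<omega>. q_hermite n (X i \<omega> - m i) q) \<in> borel_measurable M"
    by (rule measurable_compose[OF X_measurable[OF i] H])
  let ?k = "\<lambda>x. q_kernel q (corr 0 i) (0 - shift 0) (x - shift i)"
  have i0: "0 < i" using i by simp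
  have "(\<integral>\<^sup>+\<omega>. ennreal (norm (q_hermite n (X i \<omega> - m i) q)) \<partial>M) =
      (\<integral>\<^sup>+x. step_density 0 i 0 x * ennreal (norm (q_hermite n (x - m i) q)) \<partial>lborel)"
    using H by (intro nn_integral_X1 i) simp
  also have "\<dots> = (\<integral>\<^sup>+x. ennreal (norm (?k x * q_hermite n (x - shift i) q)) \<partial>lborel)"
    using i0 q_kernel_nonneg[OF q corr_abs[OF i0]]
    by (intro nn_integral_cong) (simp add: step_density_def shift_def abs_mult ennreal_mult)
  also have "\<dots> < \<infinity>"
    using step_density_hermite[OF i0 zero_in_supp, of n] by (simp add: has_bochner_integral_iff integrable_iff_bounded)
  finally show "(\<integral>\<^sup>+\<omega>. ennreal (norm (q_hermite n (X i \<omega> - m i) q)) \<partial>M) < \<infinity>" .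
qed

lemma conditional_law_past:
  assumes J: "J \<noteq> {}" "J \<subseteq> {1..<i}" and i: "i \<in> {1..d}"
  defines "j \<equiv> Max J"
  defines "r \<equiv> (\<Prod>k\<in>{j..<i}. \<rho> k)" and "F \<equiv> sigma_gen_by M X J"
  shows "cond_density M F (X i) (\<lambda>\<omega> x. q_cond_normal (x - m i) (X j \<omega> - m j) r q)"
    and "AE \<omega> in M. real_cond_exp M F (\<lambda>\<omega>. q_hermite n (X i \<omega> - m i) q) \<omega> = r ^ n * q_hermite n (X j \<omega> - m j) q"
    and "AE \<omega> in M. cond_var M F (X i) \<omega> = 1 - r\<^sup>2"
proof -
  have finJ: "finite J" using J(2) finite_subset by blast
  have j: "j \<in> J" "j < i" "1 \<le> j" "j \<in> {1..d}" using Max_in[OF finJ J(1)] J(2) i by (auto simp: j_def)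
  have r: "corr j i = r" using corr_eq[of j i] j i by (simp add: r_def)
  interpret ck: conditional_kernel M X J "X i" "\<lambda>z. step_density j i (z j)"
    unfolding j_def by (rule conditional_kernel_past[OF J i])
  have nn: "q_kernel q r y x \<ge> 0" for x y
    using q_kernel_nonneg[OF q corr_abs[OF j(2)]] by (simp add: r)
  \<comment> \<open>\<open>q_cond_normal\<close> is identified with the kernel for conditioning
    values in the support, which is an almost sure event.\<close>
  have f: "AE \<omega> in M. \<forall>x. step_density j i ((\<lambda>j\<in>J. X j \<omega>) j) x = ennreal (q_cond_normal (x - m i) (X j \<omega> - m j) r q)
       \<and> 0 \<le> q_cond_normal (x - m i) (X j \<omega> - m j) r q"
    using AE_X_supp[OF j(4)]
  proof eventually_elim
    case (elim \<omega>)
    then show ?case using j i nn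
      by (simp add: q_cond_normal_kernel step_density_def r shift_eq)
  qed
  show "cond_density M F (X i) (\<lambda>\<omega> x. q_cond_normal (x - m i) (X j \<omega> - m j) r q)"
    unfolding F_def by (rule ck.cond_density_kernel[OF f])
  \<comment> \<open>The quantifier over \<open>n\<close> stands inside, so that the orders 0, 1 and
    2 can be combined at the same \<omega>.\<close>
  have H: "AE \<omega> in M. \<forall>n. has_bochner_integral lborel
      (\<lambda>x. q_cond_normal (x - m i) (X j \<omega> - m j) r q * q_hermite n (x - m i) q) (r ^ n * q_hermite n (X j \<omega> - m j) q)"
    using AE_X_supp[OF j(4)]
  proof eventually_elim
    case (elim \<omega>)
    then show ?case
      using step_density_hermite[OF j(2), of "X j \<omega>"] j i
      by (simp add: q_cond_normal_kernel supp_def shift_eq r)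
  qed
  have Hm: "(\<lambda>x. q_hermite n (x - m i) q) \<in> borel_measurable borel" for n
    by (rule measurable_compose[OF _ q_hermite_measurable]) measurable
  show "AE \<omega> in M. real_cond_exp M F (\<lambda>\<omega>. q_hermite n (X i \<omega> - m i) q) \<omega> = r ^ n * q_hermite n (X j \<omega> - m j) q"
    unfolding F_def
  proof (rule ck.real_cond_exp_kernel[OF _ f, of "\<lambda>_ x. q_hermite n (x - m i) q"])
    show "(\<lambda>(z, x). q_hermite n (x - m i) q) \<in> borel_measurable (Pi\<^sub>M J (\<lambda>_. borel) \<Otimes>\<^sub>M borel)"
      using measurable_compose[OF measurable_snd Hm, of n] by (simp add: case_prod_unfold)
  qed (use H in auto)
  have Xi: "X i \<in> borel_measurable M" and Xj: "X j \<in> borel_measurable M" using X_measurable i j by auto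
  \<comment> \<open>x = H_1(x - m_i) + m_i H_0, so the orders 1 and 0 suffice.\<close>
  have mean: "AE \<omega> in M. real_cond_exp M F (X i) \<omega> = r * (X j \<omega> - m j) + m i"
    unfolding F_def
  proof (rule ck.real_cond_exp_kernel[OF _ f, of "\<lambda>_ x. x"])
    show "AE \<omega> in M. has_bochner_integral lborel (\<lambda>x. q_cond_normal (x - m i) (X j \<omega> - m j) r q * x) (r * (X j \<omega> - m j) + m i)"
      using H
    proof eventually_elim
      case (elim \<omega>)
      from has_bochner_integral_add[OF spec[OF elim, of 1] has_bochner_integral_mult_left[OF spec[OF elim, of 0], of "m i"]]
      show ?case by (simp add: algebra_simps)
    qed
  qed (simp add: case_prod_unfold)
  \<comment> \<open>The squared deviation from the explicit conditional mean, written as a function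
    of the conditioning vector and the variable to fit \<open>real_cond_exp_kernel\<close>.\<close>
  define g where "g z x = (x - (r * (z j - m j) + m i))\<^sup>2" for z :: "nat \<Rightarrow> real" and x
  have gm: "(\<lambda>(z, x). g z x) \<in> borel_measurable (Pi\<^sub>M J (\<lambda>_. borel) \<Otimes>\<^sub>M borel)"
  proof -
    have [measurable]: "(\<lambda>w. fst w j) \<in> measurable (Pi\<^sub>M J (\<lambda>_. borel) \<Otimes>\<^sub>M (borel :: real measure)) (borel :: real measure)"
      by (rule measurable_compose[OF measurable_fst measurable_component_singleton[OF j(1)]])
    show ?thesis unfolding case_prod_unfold g_def by measurable
  qed
  have v1: "AE \<omega> in M. real_cond_exp M F (\<lambda>\<omega>. g (\<lambda>j\<in>J. X j \<omega>) (X i \<omega>)) \<omega> = 1 - r\<^sup>2"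
    unfolding F_def
  proof (rule ck.real_cond_exp_kernel[OF gm f])
    show "AE \<omega> in M. has_bochner_integral lborel (\<lambda>x. q_cond_normal (x - m i) (X j \<omega> - m j) r q * g (\<lambda>j\<in>J. X j \<omega>) x) (1 - r\<^sup>2)"
      using H
    proof eventually_elim
      case (elim \<omega>)
      define y where "y = X j \<omega> - m j"
      define f where "f = (\<lambda>x. q_cond_normal (x - m i) y r q)"
      have h2: "q_hermite 2 x q = x\<^sup>2 - 1" for x
        by (simp add: numeral_2_eq_2 q_hermite.simps(3) q_int_def power2_eq_square)
      have 0: "has_bochner_integral lborel f 1" and 1: "has_bochner_integral lborel (\<lambda>x. f x * (x - m i)) (r * y)"
        and 2: "has_bochner_integral lborel (\<lambda>x. f x * ((x - m i)\<^sup>2 - 1)) (r\<^sup>2 * (y\<^sup>2 - 1))"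
        using spec[OF elim, of 0] spec[OF elim, of 1] spec[OF elim, of 2]
        by (simp_all add: h2 f_def y_def)
      \<comment> \<open>In the variable x - m_i the squared deviation is H_2 - 2 r y H_1 + (1 + r^2
        y^2) H_0.\<close>
      have "has_bochner_integral lborel (\<lambda>x. f x * ((x - m i)\<^sup>2 - 1) + (- (2 * r * y) * (f x * (x - m i)) + (1 + r\<^sup>2 * y\<^sup>2) * f x))
          (r\<^sup>2 * (y\<^sup>2 - 1) + (- (2 * r * y) * (r * y) + (1 + r\<^sup>2 * y\<^sup>2) * 1))"
        by (intro has_bochner_integral_add has_bochner_integral_mult_right 0 1 2)
      also have "(\<lambda>x. f x * ((x - m i)\<^sup>2 - 1) + (- (2 * r * y) * (f x * (x - m i)) + (1 + r\<^sup>2 * y\<^sup>2) * f x)) =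
          (\<lambda>x. f x * g (\<lambda>j\<in>J. X j \<omega>) x)"
        using j by (simp add: fun_eq_iff g_def y_def[symmetric] power2_eq_square algebra_simps)
      also have "r\<^sup>2 * (y\<^sup>2 - 1) + (- (2 * r * y) * (r * y) + (1 + r\<^sup>2 * y\<^sup>2) * 1) = 1 - r\<^sup>2"
        by (simp add: power2_eq_square algebra_simps)
      finally show ?case unfolding f_def y_def .
    qed
  qed
  have "AE \<omega> in M. cond_var M F (X i) \<omega> = real_cond_exp M F (\<lambda>\<omega>. g (\<lambda>j\<in>J. X j \<omega>) (X i \<omega>)) \<omega>"
    unfolding cond_var_def F_def
  proof (rule ck.real_cond_exp_cong)
    show "AE \<omega> in M. (X i \<omega> - real_cond_exp M (sigma_gen_by M X J) (X i) \<omega>)\<^sup>2 = g (\<lambda>j\<in>J. X j \<omega>) (X i \<omega>)"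
      using mean unfolding F_def by eventually_elim (use j in \<open>simp add: g_def\<close>)
    show "(\<lambda>\<omega>. (X i \<omega> - real_cond_exp M (sigma_gen_by M X J) (X i) \<omega>)\<^sup>2) \<in> borel_measurable M"
      by (intro borel_measurable_power borel_measurable_diff Xi borel_measurable_cond_exp2)
    show "(\<lambda>\<omega>. g (\<lambda>j\<in>J. X j \<omega>) (X i \<omega>)) \<in> borel_measurable M"
      by (rule measurable_pair_compose[OF gm ck.XJ Xi])
  qed
  with v1 show "AE \<omega> in M. cond_var M F (X i) \<omega> = 1 - r\<^sup>2"
    by eventually_elim simp
qed

lemma conditional_law_bridge:
  assumes J: "J \<noteq> {}" "J \<subseteq> {1..<i}" and K: "K \<noteq> {}" "K \<subseteq> {i<..d}" and i: "i \<in> {1..d}"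
  shows "cond_density M (sigma_gen_by M X (J \<union> K)) (X i)
    (\<lambda>\<omega> x. q_bridge (x - m i) (X (Max J) \<omega> - m (Max J)) (X (Min K) \<omega> - m (Min K))
        (\<Prod>s\<in>{Max J..<i}. \<rho> s) (\<Prod>s\<in>{i..<Min K}. \<rho> s) q)"
proof -
  define j k where "j = Max J" and "k = Min K"
  have finJ: "finite J" "finite K" using J(2) K(2) finite_subset by blast+
  have j: "j \<in> J" "j < i" "1 \<le> j" "j \<in> {1..d}" using Max_in[OF finJ(1) J(1)] J(2) i by (auto simp: j_def)
  have k: "k \<in> K" "i < k" "1 \<le> k" "k \<in> {1..d}" using Min_in[OF finJ(2) K(1)] K(2) i by (auto simp: k_def)
  have jk: "j < k" using j k by simp
  define a b where "a = corr j i" and "b = corr i k"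
  have ab: "(\<Prod>s\<in>{j..<i}. \<rho> s) = a" "(\<Prod>s\<in>{i..<k}. \<rho> s) = b" "corr j k = a * b" "\<bar>a\<bar> < 1" "\<bar>b\<bar> < 1"
    using corr_eq[of j i] corr_eq[of i k] corr_mult[OF j(2) k(2)] corr_abs[OF j(2)] corr_abs[OF k(2)] j k i
    by (auto simp: a_def b_def)
  have ab1: "\<bar>a * b\<bar> < 1" using corr_abs[OF jk] ab by simp
  interpret ck: conditional_kernel M X "J \<union> K" "X i" "\<lambda>z x. step_density j i (z j) x * step_density i k x (z k)
         / step_density j k (z j) (z k)"
    unfolding j_def k_def by (rule conditional_kernel_bridge[OF J K i])
  have "AE \<omega> in M. \<forall>x. step_density j i ((\<lambda>j\<in>J \<union> K. X j \<omega>) j) x * step_density i k x ((\<lambda>j\<in>J \<union> K. X j \<omega>) k)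
         / step_density j k ((\<lambda>j\<in>J \<union> K. X j \<omega>) j) ((\<lambda>j\<in>J \<union> K. X j \<omega>) k)
       = ennreal (q_bridge (x - m i) (X j \<omega> - m j) (X k \<omega> - m k) a b q)
       \<and> 0 \<le> q_bridge (x - m i) (X j \<omega> - m j) (X k \<omega> - m k) a b q"
    using AE_X_supp[OF j(4)] AE_X_supp[OF k(4)] AE_p_nonzero[OF j(4) k(4) jk]
  proof eventually_elim
    case (elim \<omega>)
    show ?case
    proof
      fix x
      define y z t where "y = X j \<omega> - m j" and "z = X k \<omega> - m k" and "t = x - m i"
      have nn: "q_kernel q a y t \<ge> 0" "q_kernel q b t z \<ge> 0" "q_kernel q (a * b) y z \<ge> 0"
        using ab ab1 by (auto intro!: q_kernel_nonneg q)
      have sd: "step_density j i (X j \<omega>) x = ennreal (q_kernel q a y t)"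
         "step_density i k x (X k \<omega>) = ennreal (q_kernel q b t z)"
         "step_density j k (X j \<omega>) (X k \<omega>) = ennreal (q_kernel q (a * b) y z)"
        using j k i ab by (simp_all add: step_density_def shift_eq y_def z_def t_def a_def b_def)
      \<comment> \<open>Only on this almost sure event can the multiplicative identity
        \<open>q_bridge_kernel\<close> be divided by the kernel between the neighbours.\<close>
      have pos: "q_kernel q (a * b) y z > 0" using elim(3) nn(3) unfolding sd by (cases "q_kernel q (a * b) y z = 0") auto
      have br: "q_bridge t y z a b q = q_kernel q a y t * q_kernel q b t z / q_kernel q (a * b) y z"
        using q_bridge_kernel[OF q ab(4,5), of y z t] elim(1,2) pos by (simp add: y_def z_def field_simps)
      show "step_density j i ((\<lambda>j\<in>J \<union> K. X j \<omega>) j) x * step_density i k x ((\<lambda>j\<in>J \<union> K. X j \<omega>) k)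
         / step_density j k ((\<lambda>j\<in>J \<union> K. X j \<omega>) j) ((\<lambda>j\<in>J \<union> K. X j \<omega>) k)
       = ennreal (q_bridge (x - m i) (X j \<omega> - m j) (X k \<omega> - m k) a b q)
       \<and> 0 \<le> q_bridge (x - m i) (X j \<omega> - m j) (X k \<omega> - m k) a b q"
        using j(1) k(1) nn pos unfolding y_def[symmetric] z_def[symmetric] t_def[symmetric] br
        by (simp add: sd ennreal_mult[symmetric] divide_ennreal)
    qed
  qed
  from ck.cond_density_kernel[OF this] show ?thesis
    unfolding j_def[symmetric] k_def[symmetric] ab .
qed

end

theorem corollary2:
  fixes M :: "'a measure"
    and X :: "nat \<Rightarrow> 'a \<Rightarrow> real"
    and d :: nat
    and m \<rho> :: "nat \<Rightarrow> real"
    and q :: real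
  assumes "prob_space M"
    and "1 \<le> d"
    and "-1 < q" and "q \<le> 1"
    and "\<forall>i\<in>{1..<d}. \<rho> i \<in> {-1<..<1} - {0}"
    and "distributed M (Pi\<^sub>M {1..d} (\<lambda>_. lborel)) (\<lambda>\<omega>. \<lambda>i\<in>{1..d}. X i \<omega>)
           (\<lambda>x. ennreal (q_normal_joint d m \<rho> q x))"
  shows
    "(\<forall>i\<in>{1..d}. \<forall>J. J \<noteq> {} \<and> J \<subseteq> {1..<i} \<longrightarrow>
        (let jm = Max J; r = (\<Prod>k\<in>{jm..<i}. \<rho> k); F = sigma_gen_by M X J in
          cond_density M F (X i) (\<lambda>\<omega> x. q_cond_normal (x - m i) (X jm \<omega> - m jm) r q) \<and>
          (\<forall>n. integrable M (\<lambda>\<omega>. q_hermite n (X i \<omega> - m i) q) \<and>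
               (AE \<omega> in M. real_cond_exp M F (\<lambda>\<omega>. q_hermite n (X i \<omega> - m i) q) \<omega> =
                  r ^ n * q_hermite n (X jm \<omega> - m jm) q)) \<and>
          (AE \<omega> in M. cond_var M F (X i) \<omega> = 1 - r\<^sup>2)))
     \<and>
     (\<forall>i\<in>{1..d}. \<forall>J K. J \<noteq> {} \<and> J \<subseteq> {1..<i} \<and> K \<noteq> {} \<and> K \<subseteq> {i<..d} \<longrightarrow>
        (let jk = Max J; jm = Min K;
             rk = (\<Prod>s\<in>{jk..<i}. \<rho> s); rm = (\<Prod>s\<in>{i..<jm}. \<rho> s) in
          cond_density M (sigma_gen_by M X (J \<union> K)) (X i)
            (\<lambda>\<omega> x. q_bridge (x - m i) (X jk \<omega> - m jk) (X jm \<omega> - m jm) rk rm q) \<and>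
          (\<forall>B\<in>sets borel. AE \<omega> in M.
             real_cond_exp M (sigma_gen_by M X (J \<union> K)) (indicator (X i -` B \<inter> space M)) \<omega> =
             real_cond_exp M (sigma_gen_by M X {jk, jm}) (indicator (X i -` B \<inter> space M)) \<omega>)))"
proof -
  interpret prob_space M by fact
  interpret q_chain q m \<rho> d M X
    using assms by unfold_locales (auto simp: abs_less_iff)
  show ?thesis
    unfolding Let_def
  proof (intro conjI ballI allI impI; (elim conjE)?)
    fix i J assume i: "i \<in> {1..d}" and J: "J \<noteq> {}" "J \<subseteq> {1..<i}"
    show "cond_density M (sigma_gen_by M X J) (X i)
        (\<lambda>\<omega> x. q_cond_normal (x - m i) (X (Max J) \<omega> - m (Max J)) (\<Prod>k\<in>{Max J..<i}. \<rho> k) q)"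
      by (rule conditional_law_past(1)[OF J i])
    show "AE \<omega> in M. cond_var M (sigma_gen_by M X J) (X i) \<omega> = 1 - (\<Prod>k\<in>{Max J..<i}. \<rho> k)\<^sup>2"
      by (rule conditional_law_past(3)[OF J i])
    fix n
    show "integrable M (\<lambda>\<omega>. q_hermite n (X i \<omega> - m i) q)"
      by (rule integrable_hermite[OF i])
    show "AE \<omega> in M. real_cond_exp M (sigma_gen_by M X J) (\<lambda>\<omega>. q_hermite n (X i \<omega> - m i) q) \<omega> =
        (\<Prod>k\<in>{Max J..<i}. \<rho> k) ^ n * q_hermite n (X (Max J) \<omega> - m (Max J)) q"
      by (rule conditional_law_past(2)[OF J i])
  next
    fix i J K assume i: "i \<in> {1..d}" and J: "J \<noteq> {}" "J \<subseteq> {1..<i}" and K: "K \<noteq> {}" "K \<subseteq> {i<..d}"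
    show *: "cond_density M (sigma_gen_by M X (J \<union> K)) (X i)
        (\<lambda>\<omega> x. q_bridge (x - m i) (X (Max J) \<omega> - m (Max J)) (X (Min K) \<omega> - m (Min K))
           (\<Prod>s\<in>{Max J..<i}. \<rho> s) (\<Prod>s\<in>{i..<Min K}. \<rho> s) q)"
      by (rule conditional_law_bridge[OF J K i])
    have fin: "finite J" "finite K" using J(2) K(2) finite_subset by blast+
    have "{Max J} \<subseteq> {1..<i}" "{Min K} \<subseteq> {i<..d}"
      using Max_in[OF fin(1) J(1)] Min_in[OF fin(2) K(1)] J(2) K(2) by auto
    \<comment> \<open>For the singletons of the two neighbours the same law gives the same density,
      so both conditional probabilities are integrals of one function.\<close>
    from conditional_law_bridge[OF _ this(1) _ this(2) i]
    have **: "cond_density M (sigma_gen_by M X {Max J, Min K}) (X i)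
        (\<lambda>\<omega> x. q_bridge (x - m i) (X (Max J) \<omega> - m (Max J)) (X (Min K) \<omega> - m (Min K))
           (\<Prod>s\<in>{Max J..<i}. \<rho> s) (\<Prod>s\<in>{i..<Min K}. \<rho> s) q)"
      by (simp add: insert_commute)
    fix B :: "real set" assume B: "B \<in> sets borel"
    from * ** B show "AE \<omega> in M.
        real_cond_exp M (sigma_gen_by M X (J \<union> K)) (indicator (X i -` B \<inter> space M)) \<omega> =
        real_cond_exp M (sigma_gen_by M X {Max J, Min K}) (indicator (X i -` B \<inter> space M)) \<omega>"
      unfolding cond_density_def by (auto elim!: AE_mp dest!: bspec[OF _ B])
  qed
qed

end
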